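(* Let $\mathbb{K}$ be a field, let $G=([n],E)$ be a finite simple graph, and let $d$ be a positive integer. If $d\ge \operatorname{pmd}(G)+k(G)+1$, where $\operatorname{pmd}(G)$ is the positive matching decomposition number of $G$ and $k(G)$ is the degeneracy of $G$, then the Lovász-Saks-Schrijver ring $R_G(d)$ is a unique factorization domain.
   Context: Let $[n]=\{1,\dots,n\}$ and let $G=([n],E)$ be a finite simple graph. For a field $\mathbb{K}$ and a positive integer $d$, put $S=\mathbb{K}[y_{ij} \mid i\in[n],\ j\in[d]]$ and, for each edge $e=\{i,j\}\in E$, $f_e=\sum_{k=1}^{d} y_{ik}y_{jk}$. The Lovász-Saks-Schrijver ideal is $L_G(d)=(f_e\mid e\in E)\subseteq S$ and the Lovász-Saks-Schrijver (LSS) ring is $R_G(d)=S/L_G(d)$. Positive matching decomposition number: a positive matching of a graph $(V,E)$ is a set $M\subset E$ of pairwise disjoint edges for which there is a weight function $w:V\to\mathbb{R}$ with $\sum_{i\in e}w(i)>0$ for all $e\in M$ and $\sum_{i\in e}w(i)<0$ for all $e\in E\setminus M$. A positive matching decomposition of $G=(V,E)$ is a partition $E=\bigcup_{i=1}^p E_i$ into pairwise disjoint subsets such that $E_i$ is a positive matching on the graph $(V,E\setminus\bigcup_{j=1}^{i-1}E_j)$ for $i=1,\dots,p$. The smallest $p$ for which $G$ admits a positive matching decomposition is $\operatorname{pmd}(G)$. Degeneracy: for a non-negative integer $k$, $G$ is $k$-degenerate if every induced subgraph of $G$ has a vertex of degree at most $k$; $k(G)$ is the smallest $k$ for which $G$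 is $k$-degenerate. *)

theory Defs
  imports
    "HOL-Algebra.Ring_Divisibility"
    "HOL-Algebra.QuotRing"
    "HOL-Library.Poly_Mapping"
    "HOL-Library.Disjoint_Sets"
begin

section \<open>Simple graphs, positive matchings and degeneracy\<close>

text \<open>A graph is given by a vertex set \<open>V\<close> and a set \<open>E\<close> of two-element subsets of \<open>V\<close>.\<close>

definition simple_graph :: "'a set \<Rightarrow> 'a set set \<Rightarrow> bool" where
  "simple_graph V E \<longleftrightarrow> finite V \<and> (\<forall>e\<in>E. e \<subseteq> V \<and> card e = 2)"

text \<open>Positive matchings do not mention the vertex set: the weight \<open>w\<close> is a total function,
  and only its values on the end points of edges are used.\<close>

definition positive_matching :: "'a set set \<Rightarrow> 'a set set \<Rightarrow> bool" where
  "positive_matching E M \<longleftrightarrow> M \<subseteq> E \<and> pairwise disjnt M \<and>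
     (\<exists>w :: 'a \<Rightarrow> real.
        (\<forall>e\<in>M. (\<Sum>i\<in>e. w i) > 0) \<and> (\<forall>e\<in>E - M. (\<Sum>i\<in>e. w i) < 0))"

text \<open>The family \<open>F 1, \<dots>, F p\<close> is a positive matching decomposition of \<open>E\<close>. Blocks may be
  empty; dropping an empty block leaves a shorter decomposition, so the minimal length
  is not affected.\<close>

definition positive_matching_decomposition ::
    "'a set set \<Rightarrow> nat \<Rightarrow> (nat \<Rightarrow> 'a set set) \<Rightarrow> bool" where
  "positive_matching_decomposition E p F \<longleftrightarrow>
     E = (\<Union>i\<in>{1..p}. F i) \<and> disjoint_family_on F {1..p} \<and>
     (\<forall>i\<in>{1..p}. positive_matching (E - (\<Union>j\<in>{1..<i}. F j)) (F i))"

definition pmd :: "'a set set \<Rightarrow> nat" where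
  "pmd E = (LEAST p. \<exists>F. positive_matching_decomposition E p F)"

definition induced_edges :: "'a set set \<Rightarrow> 'a set \<Rightarrow> 'a set set" where
  "induced_edges E W = {e \<in> E. e \<subseteq> W}"

definition vertex_degree :: "'a set set \<Rightarrow> 'a \<Rightarrow> nat" where
  "vertex_degree E v = card {e \<in> E. v \<in> e}"

text \<open>Induced subgraphs are taken on nonempty vertex sets, since the empty graph has no vertex
  of any degree.\<close>

definition degenerate :: "'a set \<Rightarrow> 'a set set \<Rightarrow> nat \<Rightarrow> bool" where
  "degenerate V E k \<longleftrightarrow>
     (\<forall>W. W \<subseteq> V \<and> W \<noteq> {} \<longrightarrow> (\<exists>v\<in>W. vertex_degree (induced_edges E W) v \<le> k))"

definition degeneracy :: "'a set \<Rightarrow> 'a set set \<Rightarrow> nat" where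
  "degeneracy V E = (LEAST k. degenerate V E k)"

text \<open>Both minima range over nonempty sets of numbers, so the \<open>LEAST\<close>s are genuine.\<close>

lemma simple_graph_finite_edges:
  assumes "simple_graph V E"
  shows "finite E"
proof (rule finite_subset)
  show "E \<subseteq> Pow V" "finite (Pow V)"
    using assms by (auto simp: simple_graph_def)
qed

lemma positive_matching_singleton:
  assumes E: "\<forall>e\<in>E. card e = 2" and e: "e \<in> E"
  shows "positive_matching E {e}"
proof -
  define w :: "'a \<Rightarrow> real" where "w = (\<lambda>v. if v \<in> e then 1 else - 2)"
  have "(\<Sum>i\<in>e. w i) > 0"
    using E e by (simp add: w_def)
  moreover have "(\<Sum>i\<in>e'. w i) < 0" if e': "e' \<in> E - {e}" for e'
  proof -
    obtain x y where xy: "e' = {x, y}" "x \<noteq> y"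
      using E e' by (meson DiffD1 card_2_iff)
    have "\<not> e' \<subseteq> e"
    proof
      assume "e' \<subseteq> e"
      moreover have "finite e"
        using E e by (intro card_ge_0_finite) auto
      ultimately have "e' = e"
        using E e e' by (intro card_subset_eq) auto
      then show False using e' by simp
    qed
    then show ?thesis
      using xy by (auto simp: w_def)
  qed
  ultimately show ?thesis
    using e unfolding positive_matching_def by (auto simp: pairwise_def)
qed

lemma ex_positive_matching_decomposition:
  assumes "simple_graph V E"
  shows "\<exists>p F. positive_matching_decomposition E p F"
proof -
  obtain h and N :: nat where h: "bij_betw h {1..N} E"
    using ex_bij_betw_nat_finite_1[OF simple_graph_finite_edges[OF assms]] by blast
  define F where "F i = {h i}" for i
  have inj: "h i \<noteq> h j" if "i \<in> {1..N}" "j \<in> {1..N}" "i \<noteq> j" for i j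
    using bij_betw_imp_inj_on[OF h] that by (meson inj_onD)
  have "E = (\<Union>i\<in>{1..N}. F i)"
    using bij_betw_imp_surj_on[OF h] unfolding F_def by blast
  moreover have "disjoint_family_on F {1..N}"
    using inj by (auto simp: disjoint_family_on_def F_def)
  moreover have "positive_matching (E - (\<Union>j\<in>{1..<i}. F j)) (F i)" if i: "i \<in> {1..N}" for i
    unfolding F_def
  proof (rule positive_matching_singleton)
    show "\<forall>e\<in>E - (\<Union>j\<in>{1..<i}. {h j}). card e = 2"
      using assms by (simp add: simple_graph_def)
    have "h i \<noteq> h j" if "j \<in> {1..<i}" for j
      using that i by (intro inj) auto
    then show "h i \<in> E - (\<Union>j\<in>{1..<i}. {h j})"
      using h i by (auto simp: bij_betw_def)
  qed
  ultimately show ?thesis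
    unfolding positive_matching_decomposition_def by blast
qed

lemma ex_degenerate:
  assumes "simple_graph V E"
  shows "\<exists>k. degenerate V E k"
proof
  have "vertex_degree (induced_edges E W) v \<le> card E" for W v
    unfolding vertex_degree_def induced_edges_def
    using simple_graph_finite_edges[OF assms] by (intro card_mono) auto
  then show "degenerate V E (card E)"
    unfolding degenerate_def by blast
qed

section \<open>Polynomial rings\<close>

text \<open>A polynomial is a finitely supported map from monomials to coefficients, and a monomial is
  a finitely supported map from variables to exponents; addition and multiplication
  are those of \<^theory>\<open>HOL-Library.Poly_Mapping\<close>.\<close>

type_synonym ('v, 'k) mpoly = "('v \<Rightarrow>\<^sub>0 nat) \<Rightarrow>\<^sub>0 'k"

definition mvar :: "'v \<Rightarrow> ('v, 'k::zero_neq_one) mpoly" where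
  "mvar v = Poly_Mapping.single (Poly_Mapping.single v 1) 1"

definition mpoly_ring :: "'v set \<Rightarrow> ('v, 'k::comm_ring_1) mpoly ring" where
  "mpoly_ring X = \<lparr>carrier = {p. \<forall>m\<in>Poly_Mapping.keys p. Poly_Mapping.keys m \<subseteq> X},
     mult = (*), one = 1, zero = 0, add = (+)\<rparr>"

lemma mpoly_ring_simps [simp]:
  "mult (mpoly_ring X) = (*)" "one (mpoly_ring X) = 1"
  "zero (mpoly_ring X) = 0" "add (mpoly_ring X) = (+)"
  by (simp_all add: mpoly_ring_def)

lemma mem_mpoly_ring_iff:
  "p \<in> carrier (mpoly_ring X) \<longleftrightarrow> (\<forall>m\<in>Poly_Mapping.keys p. Poly_Mapping.keys m \<subseteq> X)"
  by (simp add: mpoly_ring_def)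

lemma mpoly_ring_closed:
  "0 \<in> carrier (mpoly_ring X)"
  "1 \<in> carrier (mpoly_ring X)"
  "p \<in> carrier (mpoly_ring X) \<Longrightarrow> q \<in> carrier (mpoly_ring X) \<Longrightarrow> p + q \<in> carrier (mpoly_ring X)"
  "p \<in> carrier (mpoly_ring X) \<Longrightarrow> q \<in> carrier (mpoly_ring X) \<Longrightarrow> p * q \<in> carrier (mpoly_ring X)"
  "p \<in> carrier (mpoly_ring X) \<Longrightarrow> - p \<in> carrier (mpoly_ring X)"
proof -
  show "0 \<in> carrier (mpoly_ring X)" "1 \<in> carrier (mpoly_ring X)"
    by (auto simp: mem_mpoly_ring_iff)
  show "p + q \<in> carrier (mpoly_ring X)"
    if "p \<in> carrier (mpoly_ring X)" "q \<in> carrier (mpoly_ring X)"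
    using that Poly_Mapping.keys_add[of p q] unfolding mem_mpoly_ring_iff by blast
  show "p * q \<in> carrier (mpoly_ring X)"
    if p: "p \<in> carrier (mpoly_ring X)" and q: "q \<in> carrier (mpoly_ring X)"
    unfolding mem_mpoly_ring_iff
  proof
    fix m assume "m \<in> Poly_Mapping.keys (p * q)"
    then obtain a b where "a \<in> Poly_Mapping.keys p" "b \<in> Poly_Mapping.keys q" "m = a + b"
      using keys_mult[of p q] by blast
    then show "Poly_Mapping.keys m \<subseteq> X"
      using p q Poly_Mapping.keys_add[of a b] unfolding mem_mpoly_ring_iff by blast
  qed
  show "- p \<in> carrier (mpoly_ring X)" if "p \<in> carrier (mpoly_ring X)"
    using that by (simp add: mem_mpoly_ring_iff in_keys_iff)
qed

lemma mvar_mem_mpoly_ring: "v \<in> X \<Longrightarrow> mvar v \<in> carrier (mpoly_ring X)"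
  by (simp add: mem_mpoly_ring_iff mvar_def)

lemma cring_mpoly_ring: "cring (mpoly_ring X :: ('v, 'k::comm_ring_1) mpoly ring)"
proof (rule cringI)
  show "abelian_group (mpoly_ring X :: ('v, 'k) mpoly ring)"
  proof (rule abelian_groupI)
    fix p :: "('v, 'k) mpoly" assume "p \<in> carrier (mpoly_ring X)"
    then show "\<exists>q\<in>carrier (mpoly_ring X). q \<oplus>\<^bsub>mpoly_ring X\<^esub> p = \<zero>\<^bsub>mpoly_ring X\<^esub>"
      by (intro bexI[of _ "- p"]) (auto intro: mpoly_ring_closed)
  qed (auto intro: mpoly_ring_closed simp: ac_simps)
  show "comm_monoid (mpoly_ring X :: ('v, 'k) mpoly ring)"
    by (rule comm_monoidI) (auto intro: mpoly_ring_closed simp: ac_simps)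
qed (simp add: distrib_right)

section \<open>Lovasz--Saks--Schrijver rings\<close>

text \<open>The variable \<open>y\<^sub>i\<^sub>k\<close> is indexed by the pair \<open>(i, k)\<close>.\<close>

definition lss_form :: "nat \<Rightarrow> nat \<Rightarrow> nat \<Rightarrow> (nat \<times> nat, 'k::comm_ring_1) mpoly" where
  "lss_form d i j = (\<Sum>k = 1..d. mvar (i, k) * mvar (j, k))"

definition lss_ambient :: "nat \<Rightarrow> nat \<Rightarrow> (nat \<times> nat, 'k::comm_ring_1) mpoly ring" where
  "lss_ambient n d = mpoly_ring ({1..n} \<times> {1..d})"

definition lss_ideal :: "nat \<Rightarrow> nat set set \<Rightarrow> nat \<Rightarrow> (nat \<times> nat, 'k::comm_ring_1) mpoly set" where
  "lss_ideal n E d = Idl\<^bsub>lss_ambient n d\<^esub> {lss_form d i j | i j. {i, j} \<in> E}"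

definition lss_ring :: "nat \<Rightarrow> nat set set \<Rightarrow> nat \<Rightarrow> (nat \<times> nat, 'k::comm_ring_1) mpoly set ring" where
  "lss_ring n E d = lss_ambient n d Quot lss_ideal n E d"

lemma lss_form_mem:
  assumes "i \<in> {1..n}" "j \<in> {1..n}"
  shows "(lss_form d i j :: (nat \<times> nat, 'k::comm_ring_1) mpoly) \<in> carrier (lss_ambient n d)"
proof -
  have "(\<Sum>k\<in>A. mvar (i, k) * mvar (j, k) :: (nat \<times> nat, 'k) mpoly) \<in> carrier (lss_ambient n d)"
    if "finite A" "A \<subseteq> {1..d}" for A
    using that
  proof (induction A rule: finite_induct)
    case empty
    then show ?case by (simp add: lss_ambient_def mpoly_ring_closed)
  next
    case (insert k A)
    then show ?case
      using assms unfolding lss_ambient_def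
      by (auto intro!: mpoly_ring_closed mvar_mem_mpoly_ring)
  qed
  then show ?thesis by (simp add: lss_form_def)
qed

lemma ideal_lss_ideal:
  assumes "simple_graph {1..n} E"
  shows "ideal (lss_ideal n E d) (lss_ambient n d)"
proof -
  interpret S: cring "lss_ambient n d"
    by (simp add: lss_ambient_def cring_mpoly_ring)
  have "i \<in> {1..n}" "j \<in> {1..n}" if "{i, j} \<in> E" for i j
    using assms that unfolding simple_graph_def by blast+
  then show ?thesis
    unfolding lss_ideal_def by (intro S.genideal_ideal) (auto intro!: lss_form_mem)
qed

end

theory Submission
  imports Defs "HOL-Library.Product_Lexorder" "Jordan_Normal_Form.Determinant"
begin

text \<open>The ring is built up by attaching the vertices one at a time, in an order in which every vertex has at most
\<open>k\<close> earlier neighbours, where \<open>k\<close> is the degeneracy. Each stage is shown to be factorial by Nagata's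
criterion, starting from a polynomial ring over a field (\<open>ufd_mod_polys\<close>).

Suppose \<open>v\<close> is attached to a graph whose ring \<open>A\<close> is factorial, and \<open>v\<close> has \<open>r \<le> k\<close> neighbours. The new
relations are \<open>r\<close> linear equations for the coordinates of \<open>v\<close>, whose coefficients are the coordinates of
the neighbours. Let \<open>\<Delta>\<close> and \<open>\<Delta>'\<close> be the maximal minors of this coefficient matrix in the columns
\<open>p + 1, \<dots>, p + r\<close> and \<open>p + 2, \<dots>, p + r + 1\<close>, where \<open>p\<close> is the positive matching decomposition
number. By Cramer's rule the new ring \<open>B\<close> and a polynomial ring over \<open>A\<close> become equal after inverting \<open>\<Delta>\<close>, and
likewise for \<open>\<Delta>'\<close> (\<open>prime_ideal_by_window_minor\<close>). For Nagata's criterion (\<open>nagata_criterion\<close>) it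
remains to see that each prime factor \<open>\<pi>\<close> of \<open>\<Delta>\<close> in \<open>A\<close> is prime in \<open>B\<close>. Multiplication by
\<open>\<Delta> / \<pi>\<close> embeds \<open>B / (\<pi>)\<close> into \<open>B / (\<Delta>)\<close>; so if \<open>\<Delta>'\<close> is regular modulo \<open>\<Delta>\<close>, it is
regular on \<open>B / (\<pi>)\<close>, and this ring embeds into its localization at \<open>\<Delta>'\<close>, which is a localized
polynomial ring over the domain \<open>A / (\<pi>)\<close>. The second chart also bounds the multiplicity of \<open>\<pi>\<close> in
elements of \<open>B\<close>, as Nagata's criterion requires (\<open>ufd_mod_attach_vertex\<close>).

Everything thus depends on \<open>\<Delta>, \<Delta>'\<close> being a regular sequence modulo the edge forms
(\<open>window_minors_regular\<close>). The weights of a positive matching decomposition combine into one weight on the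
variables in columns \<open>1, \<dots>, p\<close> for which the initial form of each edge form is a product of two
variables, and the products of different edges are coprime. The columns beyond \<open>p\<close> can be weighted such that
both minors have their diagonal terms as initial forms; these are coprime to each other and to the former.
This is why \<open>p + k + 1\<close> columns suffice. A family with pairwise coprime initial monomials is a regular
sequence (\<open>regular_modulo\<close>), because a linear bijection of the polynomial ring carries multiplication
by the initial monomials to multiplication by the family.\<close>

section \<open>Residue rings of subrings\<close>

text \<open>Every ring below is a residue ring \<open>C / I\<close>, where \<open>C\<close> is a subring of one fixed commutative ring
and \<open>I\<close> is an ideal of \<open>C\<close>. Elements are represented by elements of \<open>C\<close> and equality by membership
of the difference in \<open>I\<close>, so that several residue rings, with different \<open>C\<close> and different \<open>I\<close>, can
be compared without passing to cosets.\<close>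

definition unital_subring :: "'a::comm_ring_1 set \<Rightarrow> bool" where
  "unital_subring C \<longleftrightarrow> 1 \<in> C \<and> (\<forall>a\<in>C. \<forall>b\<in>C. a - b \<in> C \<and> a * b \<in> C)"

definition ideal_of :: "'a::comm_ring_1 set \<Rightarrow> 'a set \<Rightarrow> bool" where
  "ideal_of C I \<longleftrightarrow> I \<subseteq> C \<and> 0 \<in> I \<and> (\<forall>a\<in>I. \<forall>b\<in>I. a + b \<in> I) \<and> (\<forall>c\<in>C. \<forall>a\<in>I. c * a \<in> I)"

definition prime_ideal_of :: "'a::comm_ring_1 set \<Rightarrow> 'a set \<Rightarrow> bool" where
  "prime_ideal_of C I \<longleftrightarrow>
     ideal_of C I \<and> 1 \<notin> I \<and> (\<forall>a\<in>C. \<forall>b\<in>C. a * b \<in> I \<longrightarrow> a \<in> I \<or> b \<in> I)"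

definition dvd_mod :: "'a::comm_ring_1 set \<Rightarrow> 'a set \<Rightarrow> 'a \<Rightarrow> 'a \<Rightarrow> bool" where
  "dvd_mod C I a b \<longleftrightarrow> (\<exists>c\<in>C. b - a * c \<in> I)"

text \<open>The preimage in \<open>C\<close> of the principal ideal that \<open>a\<close> generates in \<open>C / I\<close>.\<close>

definition adjoin :: "'a::comm_ring_1 set \<Rightarrow> 'a set \<Rightarrow> 'a \<Rightarrow> 'a set" where
  "adjoin C I a = {x \<in> C. dvd_mod C I a x}"

definition prime_mod :: "'a::comm_ring_1 set \<Rightarrow> 'a set \<Rightarrow> 'a \<Rightarrow> bool" where
  "prime_mod C I p \<longleftrightarrow> p \<in> C \<and> p \<notin> I \<and> prime_ideal_of C (adjoin C I p)"

text \<open>Factors are required to be prime, not just irreducible, which makes the factorization unique.\<close>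

definition ufd_mod :: "'a::comm_ring_1 set \<Rightarrow> 'a set \<Rightarrow> bool" where
  "ufd_mod C I \<longleftrightarrow> prime_ideal_of C I \<and>
     (\<forall>a\<in>C - I. \<exists>ps u. (\<forall>p\<in>set ps. prime_mod C I p) \<and> u \<in> C \<and> dvd_mod C I u 1 \<and>
        a - u * prod_list ps \<in> I)"

locale residue_ring_of =
  fixes C I :: "'a::comm_ring_1 set"
  assumes subring: "unital_subring C" and ideal: "ideal_of C I"
begin

lemma one_mem [simp]: "1 \<in> C"
  and diff_mem [simp]: "a \<in> C \<Longrightarrow> b \<in> C \<Longrightarrow> a - b \<in> C"
  and mult_mem [simp]: "a \<in> C \<Longrightarrow> b \<in> C \<Longrightarrow> a * b \<in> C"
  using subring by (auto simp: unital_subring_def)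

lemma zero_mem [simp]: "0 \<in> C"
  using diff_mem[of 1 1] by simp

lemma uminus_mem [simp]: "a \<in> C \<Longrightarrow> - a \<in> C"
  using diff_mem[of 0 a] by simp

lemma add_mem [simp]: "a \<in> C \<Longrightarrow> b \<in> C \<Longrightarrow> a + b \<in> C"
  using diff_mem[of a "- b"] by simp

lemma prod_list_mem [simp]: "(\<And>x. x \<in> set xs \<Longrightarrow> x \<in> C) \<Longrightarrow> prod_list xs \<in> C"
  by (induction xs) auto

lemma power_mem [simp]: "a \<in> C \<Longrightarrow> a ^ m \<in> C"
  by (induction m) auto

lemma ideal_sub: "a \<in> I \<Longrightarrow> a \<in> C"
  and ideal_zero [simp]: "0 \<in> I"
  and ideal_add: "a \<in> I \<Longrightarrow> b \<in> I \<Longrightarrow> a + b \<in> I"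
  and ideal_mult: "c \<in> C \<Longrightarrow> a \<in> I \<Longrightarrow> c * a \<in> I"
  using ideal by (auto simp: ideal_of_def)

lemma ideal_lin: "x \<in> I \<Longrightarrow> y \<in> I \<Longrightarrow> c \<in> C \<Longrightarrow> e \<in> C \<Longrightarrow> z = c * x + e * y \<Longrightarrow> z \<in> I"
  by (simp add: ideal_add ideal_mult)

lemma ideal_lin1: "x \<in> I \<Longrightarrow> c \<in> C \<Longrightarrow> z = c * x \<Longrightarrow> z \<in> I"
  by (simp add: ideal_mult)

lemma ideal_sub_lin: "x \<in> I \<Longrightarrow> y \<in> I \<Longrightarrow> x - y \<in> I"
  by (rule ideal_lin[of x y 1 "-1"]) auto

lemma ideal_cong: "x - y \<in> I \<Longrightarrow> y \<in> I \<Longrightarrow> x \<in> I"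
  by (rule ideal_lin[of "x - y" y 1 1]) auto

lemma ideal_cong': "x - y \<in> I \<Longrightarrow> x \<in> I \<Longrightarrow> y \<in> I"
  by (rule ideal_lin[of "x - y" x "-1" 1]) auto

lemma dvdI: "c \<in> C \<Longrightarrow> b - a * c \<in> I \<Longrightarrow> dvd_mod C I a b"
  by (auto simp: dvd_mod_def)

lemma dvd_self_mult: "c \<in> C \<Longrightarrow> dvd_mod C I a (a * c)"
  by (rule dvdI[of c]) auto

lemma dvd_trans:
  assumes "dvd_mod C I a b" "dvd_mod C I b x"
  shows "dvd_mod C I a x"
proof -
  obtain c e where ce: "c \<in> C" "e \<in> C" "b - a * c \<in> I" "x - b * e \<in> I"
    using assms by (auto simp: dvd_mod_def)
  show ?thesis
  proof (rule dvdI[of "c * e"])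
    show "x - a * (c * e) \<in> I"
      using ce by - (rule ideal_lin[of "b - a * c" "x - b * e" e 1]; 
      auto simp: algebra_simps)
  qed (use ce in auto)
qed

lemma dvd_mult_right:
  assumes "dvd_mod C I a b" "x \<in> C"
  shows "dvd_mod C I a (b * x)"
  using dvd_trans[OF assms(1) dvd_self_mult[OF assms(2)]] .

lemma dvd_cong:
  assumes "dvd_mod C I a b" "x - b \<in> I"
  shows "dvd_mod C I a x"
proof -
  have "dvd_mod C I b x"
    using assms by (intro dvdI[of 1]) auto
  then show ?thesis
    using dvd_trans[OF assms(1)] by blast
qed

lemma dvd_add:
  assumes "dvd_mod C I a b" "dvd_mod C I a x"
  shows "dvd_mod C I a (b + x)"
proof -
  obtain c e where ce: "c \<in> C" "e \<in> C" "b - a * c \<in> I" "x - a * e \<in> I"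
    using assms by (auto simp: dvd_mod_def)
  show ?thesis
    using ce by - (rule dvdI[of "c + e"], simp, rule ideal_lin[of "b - a * c" "x - a * e" 1 1]; 
      auto simp: algebra_simps)
qed

lemma ideal_adjoin:
  assumes "a \<in> C"
  shows "ideal_of C (adjoin C I a)"
proof -
  have "dvd_mod C I a 0"
    by (rule dvdI[of 0]) auto
  then show ?thesis
    using dvd_add dvd_mult_right by (auto simp: ideal_of_def adjoin_def) (metis mult.commute)
qed

lemma prime_modD:
  assumes "prime_mod C I p"
  shows "p \<in> C" "p \<notin> I" "\<not> dvd_mod C I p 1"
    and "\<And>a b. a \<in> C \<Longrightarrow> b \<in> C \<Longrightarrow> dvd_mod C I p (a * b) \<Longrightarrow> dvd_mod C I p a \<or> dvd_mod C I p b"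
  using assms by (auto simp: prime_mod_def prime_ideal_of_def adjoin_def)

lemma prime_modI:
  assumes "p \<in> C" "p \<notin> I" "\<not> dvd_mod C I p 1"
    and "\<And>a b. a \<in> C \<Longrightarrow> b \<in> C \<Longrightarrow> dvd_mod C I p (a * b) \<Longrightarrow> dvd_mod C I p a \<or> dvd_mod C I p b"
  shows "prime_mod C I p"
  using assms ideal_adjoin[OF assms(1)] by (auto simp: prime_mod_def prime_ideal_of_def adjoin_def)

lemma prime_mod_dvd_prod_list:
  assumes "prime_mod C I p" "set xs \<subseteq> C" "dvd_mod C I p (prod_list xs)"
  shows "\<exists>x\<in>set xs. dvd_mod C I p x"
  using assms(2,3)
proof (induction xs)
  case Nil
  then show ?case using prime_modD(3)[OF assms(1)] by simp
next
  case (Cons x xs)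
  have "prod_list xs \<in> C"
    using Cons.prems by (intro prod_list_mem) auto
  then show ?case
    using prime_modD(4)[OF assms(1), of x "prod_list xs"] Cons by auto
qed

lemma dvd_prod_list:
  assumes "x \<in> set xs" "set xs \<subseteq> C"
  shows "dvd_mod C I x (prod_list xs)"
proof -
  obtain as bs where xs: "xs = as @ x # bs"
    using split_list[OF assms(1)] by blast
  have "prod_list as * prod_list bs \<in> C"
    using assms xs by (intro mult_mem prod_list_mem) auto
  then have "dvd_mod C I x (x * (prod_list as * prod_list bs))"
    by (rule dvd_self_mult)
  then show ?thesis
    by (simp add: xs ac_simps)
qed

end

locale residue_domain_of = residue_ring_of +
  assumes prime_ideal: "prime_ideal_of C I"
begin

lemma one_not_mem: "1 \<notin> I"
  and mult_memD: "a \<in> C \<Longrightarrow> b \<in> C \<Longrightarrow> a * b \<in> I \<Longrightarrow> a \<in> I \<or> b \<in> I"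
  using prime_ideal by (auto simp: prime_ideal_of_def)

lemma cancel: "a \<in> C \<Longrightarrow> a \<notin> I \<Longrightarrow> x \<in> C \<Longrightarrow> a * x \<in> I \<Longrightarrow> x \<in> I"
  using mult_memD by blast

lemma power_not_mem: "a \<in> C \<Longrightarrow> a \<notin> I \<Longrightarrow> a ^ m \<notin> I"
proof (induction m)
  case (Suc m)
  then show ?case using mult_memD[of a "a ^ m"] by auto
qed (simp add: one_not_mem)

text \<open>The primes are moved one at a time: each divides \<open>f * e\<close> but not \<open>f\<close>, hence divides \<open>e\<close>.\<close>

lemma cancel_primes:
  assumes "\<forall>p\<in>set ps. prime_mod C I p \<and> \<not> dvd_mod C I p f" "f \<in> C"
    and "e \<in> C" "x \<in> C" "f * e - prod_list ps * x \<in> I"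
  shows "dvd_mod C I f x"
  using assms(1,3,5)
proof (induction ps arbitrary: e)
  case Nil
  then have "x - f * e \<in> I"
    by - (rule ideal_lin1[of "f * e - x" "-1"]; auto)
  then show ?case using Nil by (intro dvdI)
next
  case (Cons p ps)
  let ?P = "prod_list ps"
  have p: "prime_mod C I p" "\<not> dvd_mod C I p f" "p \<in> C"
    using Cons.prems by (auto dest: prime_modD)
  have P: "?P \<in> C"
    using Cons.prems by (intro prod_list_mem) (auto dest: prime_modD)
  have "dvd_mod C I p (f * e)"
    using Cons.prems P assms(4) by (intro dvdI[of "?P * x"]) (auto simp: ac_simps)
  then have "dvd_mod C I p e"
    using prime_modD(4)[OF p(1) assms(2) Cons.prems(2)] p by blast
  then obtain e' where e': "e' \<in> C" "e - p * e' \<in> I"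
    by (auto simp: dvd_mod_def)
  have "p * (f * e' - ?P * x) \<in> I"
    using Cons.prems e' assms(2)
    by - (rule ideal_lin[of "f * e - prod_list (p # ps) * x" "e - p * e'" 1 "- f"]; 
      auto simp: algebra_simps)
  then have "f * e' - ?P * x \<in> I"
    using cancel[OF p(3)] prime_modD(2)[OF p(1)] P e' assms by auto
  then show ?case
    using Cons e' by auto
qed

text \<open>Products of primes are closed under taking divisors: every prime in the list is absorbed by one of
the two factors. Therefore unique factorization holds as soon as each nonzero element merely divides
a product of primes; this is what all later factoriality proofs establish.\<close>

lemma dvd_prod_list_primes:
  assumes "\<forall>p\<in>set ps. prime_mod C I p" "x \<in> C" "y \<in> C" "x * y - prod_list ps \<in> I"
  shows "\<exists>qs u. (\<forall>p\<in>set qs. prime_mod C I p) \<and> u \<in> C \<and> dvd_mod C I u 1 \<and>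
    x - u * prod_list qs \<in> I"
  using assms
proof (induction ps arbitrary: x y)
  case Nil
  have "1 - x * y \<in> I"
    using Nil by - (rule ideal_lin1[of "x * y - prod_list []" "-1"]; auto)
  then have "dvd_mod C I x 1" using Nil by (intro dvdI)
  then show ?case using Nil by (intro exI[of _ "[]"] exI[of _ x]) auto
next
  case (Cons p ps)
  let ?P = "prod_list ps"
  have p: "prime_mod C I p" "p \<in> C" "p \<notin> I"
    using Cons.prems by (auto dest: prime_modD)
  have P: "?P \<in> C"
    using Cons.prems by (intro prod_list_mem) (auto dest: prime_modD)
  have "dvd_mod C I p (x * y)"
    using Cons.prems P by (intro dvdI[of "?P"]) auto
  then consider "dvd_mod C I p x" | "dvd_mod C I p y"
    using prime_modD(4)[OF p(1)] Cons.prems by blast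
  then show ?case
  proof cases
    case 1
    then obtain x' where x': "x' \<in> C" "x - p * x' \<in> I"
      by (auto simp: dvd_mod_def)
    have "p * (x' * y - ?P) \<in> I"
      using Cons.prems x'
      by - (rule ideal_lin[of "x * y - prod_list (p # ps)" "x - p * x'" 1 "- y"]; 
      auto simp: algebra_simps)
    then have "x' * y - ?P \<in> I"
      using cancel[OF p(2,3)] P x' Cons.prems by auto
    then obtain qs u where qs: "\<forall>p\<in>set qs. prime_mod C I p" "u \<in> C" "dvd_mod C I u 1"
        "x' - u * prod_list qs \<in> I"
      using Cons.IH[of x' y] Cons.prems x' by auto
    have "x - u * prod_list (p # qs) \<in> I"
      using x' qs p by - (rule ideal_lin[of "x - p * x'" "x' - u * prod_list qs" 1 p]; 
      auto simp: algebra_simps)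
    then show ?thesis
      using qs p by (intro exI[of _ "p # qs"] exI[of _ u]) auto
  next
    case 2
    then obtain y' where y': "y' \<in> C" "y - p * y' \<in> I"
      by (auto simp: dvd_mod_def)
    have "p * (x * y' - ?P) \<in> I"
      using Cons.prems y'
      by - (rule ideal_lin[of "x * y - prod_list (p # ps)" "y - p * y'" 1 "- x"]; 
      auto simp: algebra_simps)
    then have "x * y' - ?P \<in> I"
      using cancel[OF p(2,3)] P y' Cons.prems by auto
    then show ?thesis
      using Cons y' by auto
  qed
qed

lemma ufd_modI:
  assumes "\<And>a. a \<in> C \<Longrightarrow> a \<notin> I \<Longrightarrow> \<exists>ps. (\<forall>p\<in>set ps. prime_mod C I p) \<and> dvd_mod C I a (prod_list ps)"
  shows "ufd_mod C I"
  unfolding ufd_mod_def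
proof (intro conjI prime_ideal ballI)
  fix a assume a: "a \<in> C - I"
  then obtain ps c where ps: "\<forall>p\<in>set ps. prime_mod C I p" "c \<in> C" "prod_list ps - a * c \<in> I"
    using assms[of a] by (auto simp: dvd_mod_def)
  have "a * c - prod_list ps \<in> I"
    using ps by - (rule ideal_lin1[of "prod_list ps - a * c" "-1"]; auto)
  then show "\<exists>ps u. (\<forall>p\<in>set ps. prime_mod C I p) \<and> u \<in> C \<and> dvd_mod C I u 1 \<and>
        a - u * prod_list ps \<in> I"
    using dvd_prod_list_primes[of ps a c] ps a by auto
qed

lemma ufd_mod_dvd_primes:
  assumes "ufd_mod C I" "a \<in> C" "a \<notin> I"
  shows "\<exists>ps. (\<forall>p\<in>set ps. prime_mod C I p \<and> dvd_mod C I p a) \<and> dvd_mod C I a (prod_list ps)"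
proof -
  obtain ps u where ps: "\<forall>p\<in>set ps. prime_mod C I p" "u \<in> C" "dvd_mod C I u 1"
      "a - u * prod_list ps \<in> I"
    using assms unfolding ufd_mod_def by blast
  have sub: "set ps \<subseteq> C" using ps by (auto dest: prime_modD)
  have P: "prod_list ps \<in> C"
    using sub by (intro prod_list_mem) auto
  obtain w where w: "w \<in> C" "1 - u * w \<in> I"
    using ps by (auto simp: dvd_mod_def)
  have "prod_list ps - a * w \<in> I"
    using ps w P by - (rule ideal_lin[of "a - u * prod_list ps" "1 - u * w" "- w" "prod_list ps"]; 
      auto simp: algebra_simps)
  then have "dvd_mod C I a (prod_list ps)"
    using w by (intro dvdI)
  moreover have "dvd_mod C I p a" if "p \<in> set ps" for p
    using dvd_cong[OF dvd_mult_right[OF dvd_prod_list[OF that sub] ps(2)]] ps(4)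
    by (simp add: ac_simps)
  ultimately show ?thesis using ps by blast
qed

text \<open>Applied to a factorization of a fixed element into primes, this bounds the number of primes, with
multiplicity, that can be split off from it.\<close>

lemma length_primes_le:
  assumes "\<forall>p\<in>set rs. prime_mod C I p" "\<forall>p\<in>set qs. prime_mod C I p"
    and "dvd_mod C I (prod_list rs) (prod_list qs)"
  shows "length rs \<le> length qs"
  using assms
proof (induction rs arbitrary: qs)
  case (Cons r rs)
  have r: "prime_mod C I r" "r \<in> C" "r \<notin> I" and sub: "set qs \<subseteq> C"
    using Cons.prems by (auto dest: prime_modD)
  have R: "prod_list rs \<in> C"
    using Cons.prems by (intro prod_list_mem) (auto dest: prime_modD)
  obtain e where e: "e \<in> C" "prod_list qs - r * prod_list rs * e \<in> I"
    using Cons.prems by (auto simp: dvd_mod_def)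
  have "dvd_mod C I r (prod_list qs)"
    using e R by (intro dvdI[of "prod_list rs * e"]) (auto simp: ac_simps)
  then obtain q where q: "q \<in> set qs" "dvd_mod C I r q"
    using prime_mod_dvd_prod_list[OF r(1) sub] by blast
  obtain as bs where qs: "qs = as @ q # bs"
    using split_list[OF q(1)] by blast
  let ?Q = "prod_list (as @ bs)"
  have Q: "?Q \<in> C"
    using sub qs by (intro prod_list_mem) auto
  have q': "prime_mod C I q" "q \<in> C" "q \<notin> I"
    using Cons.prems q by (auto dest: prime_modD)
  obtain c where c: "c \<in> C" "q - r * c \<in> I"
    using q by (auto simp: dvd_mod_def)
  have "dvd_mod C I q (r * c)"
    using c by - (rule dvdI[of 1], simp, rule ideal_lin1[of "q - r * c" "-1"]; auto)
  moreover have False if qc: "dvd_mod C I q c"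
  proof -
    obtain c' where c': "c' \<in> C" "c - q * c' \<in> I"
      using qc by (auto simp: dvd_mod_def)
    have "q * (1 - r * c') \<in> I"
      using c c' r by - (rule ideal_lin[of "q - r * c" "c - q * c'" 1 r]; 
      auto simp: algebra_simps)
    then have "1 - r * c' \<in> I"
      using cancel[OF q'(2,3)] r c' by auto
    then show False
      using prime_modD(3)[OF r(1)] c' by (auto simp: dvd_mod_def)
  qed
  ultimately obtain c' where c': "c' \<in> C" "r - q * c' \<in> I"
    using prime_modD(4)[OF q'(1) r(2) c(1)] by (auto simp: dvd_mod_def)
  have "q * (?Q - prod_list rs * (c' * e)) \<in> I"
    using e c' R by - (rule ideal_lin[of "prod_list qs - r * prod_list rs * e" "r - q * c'"
          1 "prod_list rs * e"]; 
      auto simp: algebra_simps qs)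
  then have "?Q - prod_list rs * (c' * e) \<in> I"
    using cancel[OF q'(2,3)] R c' e Q by auto
  then have "dvd_mod C I (prod_list rs) ?Q"
    using c' e by (intro dvdI) auto
  then have "length rs \<le> length (as @ bs)"
    using Cons.prems by (intro Cons.IH) (auto simp: qs)
  then show ?case by (simp add: qs)
qed simp

text \<open>The bound provides a product of primes from \<open>S\<close> of maximal length that divides \<open>b\<close>; its cofactor is free
of primes from \<open>S\<close>.\<close>

lemma extract_primes:
  assumes S: "\<And>p. p \<in> S \<Longrightarrow> prime_mod C I p" and b: "b \<in> C"
    and bound: "\<And>rs. set rs \<subseteq> S \<Longrightarrow> dvd_mod C I (prod_list rs) b \<Longrightarrow> length rs \<le> N"
  obtains rs b' where "set rs \<subseteq> S" "b' \<in> C" "b - prod_list rs * b' \<in> I"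
    "\<And>p. p \<in> S \<Longrightarrow> \<not> dvd_mod C I p b'"
proof -
  define Q where "Q rs \<longleftrightarrow> set rs \<subseteq> S \<and> dvd_mod C I (prod_list rs) b" for rs
  have "Q []" using b by (auto simp: Q_def dvd_mod_def intro!: bexI[of _ b])
  moreover have "\<And>rs. Q rs \<Longrightarrow> length rs \<le> N" using bound by (auto simp: Q_def)
  ultimately obtain rs where rs: "Q rs" "\<And>rs'. Q rs' \<Longrightarrow> length rs' \<le> length rs"
    using ex_has_greatest_nat[of Q "[]" length "Suc N"] by (auto simp: less_Suc_eq_le)
  then obtain b' where b': "b' \<in> C" "b - prod_list rs * b' \<in> I"
    by (auto simp: Q_def dvd_mod_def)
  have R: "prod_list rs \<in> C"
    using rs(1) S by (intro prod_list_mem) (auto simp: Q_def dest!: prime_modD(1))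
  have "\<not> dvd_mod C I p b'" if "p \<in> S" for p
  proof
    assume "dvd_mod C I p b'"
    then obtain b'' where b'': "b'' \<in> C" "b' - p * b'' \<in> I"
      by (auto simp: dvd_mod_def)
    have "b - prod_list (p # rs) * b'' \<in> I"
      using b' b'' R by - (rule ideal_lin[of "b - prod_list rs * b'" "b' - p * b''" 1 "prod_list rs"]; 
      auto simp: algebra_simps)
    then have "Q (p # rs)"
      using b'' that rs by (auto simp: Q_def dvd_mod_def)
    then show False using rs(2) by fastforce
  qed
  then show ?thesis
    using that rs b' by (auto simp: Q_def)
qed

lemma prod_primes_dvd_cancel:
  assumes "\<forall>p\<in>set rs. prime_mod C I p \<and> \<not> dvd_mod C I p s" "s \<in> C" "x \<in> C"
    and "dvd_mod C I (prod_list rs) (s * x)"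
  shows "dvd_mod C I (prod_list rs) x"
  using assms(1,3,4)
proof (induction rs arbitrary: x)
  case Nil
  then show ?case by (auto simp: dvd_mod_def intro!: bexI[of _ x])
next
  case (Cons p rs)
  have p: "prime_mod C I p" "\<not> dvd_mod C I p s" "p \<in> C" "p \<notin> I"
    using Cons.prems by (auto dest: prime_modD)
  have R: "prod_list rs \<in> C"
    using Cons.prems by (intro prod_list_mem) (auto dest: prime_modD)
  obtain c where c: "c \<in> C" "s * x - p * prod_list rs * c \<in> I"
    using Cons.prems by (auto simp: dvd_mod_def)
  have "dvd_mod C I p (s * x)"
    using c R by (intro dvdI[of "prod_list rs * c"]) (auto simp: ac_simps)
  then obtain x' where x': "x' \<in> C" "x - p * x' \<in> I"
    using prime_modD(4)[OF p(1) assms(2) Cons.prems(2)] p(2) by (auto simp: dvd_mod_def)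
  have "p * (s * x' - prod_list rs * c) \<in> I"
    using c x' R assms(2) by - (rule ideal_lin[of "s * x - p * prod_list rs * c" "x - p * x'" 1 "- s"]; 
      auto simp: algebra_simps)
  then have "s * x' - prod_list rs * c \<in> I"
    using cancel[OF p(3,4)] c x' R assms(2) by auto
  then have "dvd_mod C I (prod_list rs) x'"
    using Cons c x' by (auto simp: dvd_mod_def)
  then obtain e where e: "e \<in> C" "x' - prod_list rs * e \<in> I"
    by (auto simp: dvd_mod_def)
  have "x - prod_list (p # rs) * e \<in> I"
    using x' e p by - (rule ideal_lin[of "x - p * x'" "x' - prod_list rs * e" 1 p]; 
      auto simp: algebra_simps)
  then show ?case
    using e by (auto simp: dvd_mod_def)
qed

end

lemma residue_domain_ofI:
  "unital_subring C \<Longrightarrow> prime_ideal_of C I \<Longrightarrow> residue_domain_of C I"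
  by (simp add: residue_domain_of_def residue_ring_of_def residue_domain_of_axioms_def
      prime_ideal_of_def)

section \<open>Nagata's criterion\<close>

context residue_ring_of
begin

lemma prime_mod_dvd_power:
  assumes "prime_mod C I p" "a \<in> C" "dvd_mod C I p (a ^ m)"
  shows "dvd_mod C I p a"
proof -
  have "\<exists>x\<in>set (replicate m a). dvd_mod C I p x"
    using assms by (intro prime_mod_dvd_prod_list) auto
  then show ?thesis by (auto split: if_splits)
qed

text \<open>If \<open>D = p * e\<close> is a nonzerodivisor, multiplication by \<open>e\<close> embeds \<open>C / (p)\<close> into \<open>C / (D)\<close>. Hence an
element that is regular modulo \<open>D\<close> is regular modulo every factor \<open>p\<close> of \<open>D\<close>.\<close>

lemma dvd_of_regular_factor:
  assumes mem: "D \<in> C" "D' \<in> C" "p \<in> C" "e \<in> C" "D - p * e \<in> I"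
    and reg: "\<And>x. x \<in> C \<Longrightarrow> D * x \<in> I \<Longrightarrow> x \<in> I"
    and reg': "\<And>x. x \<in> C \<Longrightarrow> dvd_mod C I D (D' * x) \<Longrightarrow> dvd_mod C I D x"
    and x: "x \<in> C" "dvd_mod C I p (D' * x)"
  shows "dvd_mod C I p x"
proof -
  obtain c where c: "c \<in> C" "D' * x - p * c \<in> I"
    using x by (auto simp: dvd_mod_def)
  have "D' * (e * x) - D * c \<in> I"
    using c mem x by - (rule ideal_lin[of "D' * x - p * c" "D - p * e" e "- c"];
      auto simp: algebra_simps)
  then have "dvd_mod C I D (e * x)"
    using mem x c by - (rule reg', simp, rule dvdI[of c]; auto simp: algebra_simps)
  then obtain c' where c': "c' \<in> C" "e * x - D * c' \<in> I"
    by (auto simp: dvd_mod_def)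
  have "D * (x - p * c') \<in> I"
    using c' mem x by - (rule ideal_lin[of "e * x - D * c'" "D - p * e" p "x"];
      auto simp: algebra_simps)
  then have "x - p * c' \<in> I"
    using c' x mem by - (rule reg; auto)
  then show ?thesis using c' by (intro dvdI)
qed

end

text \<open>Suppose \<open>C / I\<close> becomes equal to a factorial subring \<open>A / J\<close> after inverting \<open>D\<close>, and that the elements
of \<open>S\<close> are prime in \<open>A / J\<close> and do not divide \<open>D\<close>. A factorization of \<open>b\<close> in \<open>C / I\<close> then turns, after
multiplication by a power of \<open>D\<close>, into one in \<open>A / J\<close>, where the number of prime factors of a fixed
nonzero element is bounded.\<close>

lemma (in residue_domain_of) multiplicity_bounded_by_chart:
  assumes A: "residue_domain_of A J" and AC: "A \<subseteq> C" and J: "J = I \<inter> A" and ufd: "ufd_mod A J"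
    and D: "D \<in> A" "D \<notin> I" and loc: "\<And>x. x \<in> C \<Longrightarrow> \<exists>m. \<exists>a\<in>A. D ^ m * x - a \<in> I"
    and S: "\<And>p. p \<in> S \<Longrightarrow> prime_mod A J p \<and> \<not> dvd_mod A J p D"
    and b: "b \<in> C" "b \<notin> I"
  shows "\<exists>N. \<forall>rs. set rs \<subseteq> S \<and> dvd_mod C I (prod_list rs) b \<longrightarrow> length rs \<le> N"
proof -
  interpret A: residue_domain_of A J by (rule A)
  obtain m a where a: "a \<in> A" "D ^ m * b - a \<in> I"
    using loc[OF b(1)] by blast
  have "a \<notin> J"
  proof
    assume "a \<in> J"
    then have "D ^ m * b \<in> I" using ideal_cong[OF a(2)] J by auto
    then show False using cancel[of "D ^ m" b] power_not_mem[of D m] D AC b by auto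
  qed
  then obtain qs where qs: "\<forall>q\<in>set qs. prime_mod A J q" "dvd_mod A J a (prod_list qs)"
    using A.ufd_mod_dvd_primes[OF ufd a(1)] by blast
  have "length rs \<le> length qs" if rs: "set rs \<subseteq> S" "dvd_mod C I (prod_list rs) b" for rs
  proof -
    let ?R = "prod_list rs"
    have R: "?R \<in> A"
      using rs S A.prime_modD(1) by (intro A.prod_list_mem) blast
    obtain c where c: "c \<in> C" "b - ?R * c \<in> I"
      using rs by (auto simp: dvd_mod_def)
    obtain k c' where c': "c' \<in> A" "D ^ k * c - c' \<in> I"
      using loc[OF c(1)] by blast
    have mem: "D \<in> C" "a \<in> C" "c' \<in> C" "?R \<in> C"
      using D a c' R AC by auto
    have 1: "D ^ (k + m) * b - D ^ k * a \<in> I"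
      using a mem by - (rule ideal_lin1[of "D ^ m * b - a" "D ^ k"];
        auto simp: algebra_simps power_add)
    have 2: "D ^ (k + m) * b - D ^ m * (?R * c') \<in> I"
      using c c' mem by - (rule ideal_lin[of "b - ?R * c" "D ^ k * c - c'" "D ^ (k + m)" "D ^ m * ?R"];
        auto simp: algebra_simps power_add)
    have "D ^ k * a - ?R * (D ^ m * c') \<in> I"
      using ideal_sub_lin[OF 2 1] by (simp add: algebra_simps)
    moreover have "D ^ k * a - ?R * (D ^ m * c') \<in> A"
      using D a R c' by auto
    ultimately have "dvd_mod A J ?R (D ^ k * a)"
      using D c' J by (intro A.dvdI[of "D ^ m * c'"]) auto
    then have "dvd_mod A J ?R a"
      using a D rs S A.prime_mod_dvd_power[of _ D k]
      by - (rule A.prod_primes_dvd_cancel[of rs "D ^ k"]; auto)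
    then show ?thesis
      using qs rs S A.dvd_trans[OF _ qs(2)] by (intro A.length_primes_le) auto
  qed
  then show ?thesis by blast
qed

text \<open>If \<open>C / I\<close> and its factorial subring \<open>A / J\<close> become equal after inverting \<open>D\<close>, and the prime
factors \<open>ps\<close> of \<open>D\<close> are prime in \<open>C / I\<close>, then \<open>C / I\<close> is factorial. Some power of \<open>D\<close> moves a given element
into \<open>A / J\<close>, so it suffices that every prime \<open>q\<close> of \<open>A / J\<close> divides a product of primes of \<open>C / I\<close>. If
\<open>q\<close> does not divide \<open>D\<close>, then \<open>q\<close> is prime in the localization at \<open>D\<close>; after all prime factors of \<open>D\<close>
are split off from \<open>q\<close> in \<open>C / I\<close>, the cofactor \<open>q'\<close> is prime in \<open>C / I\<close> or a unit. The last hypothesis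
makes this splitting terminate.\<close>

theorem (in residue_domain_of) nagata_criterion:
  assumes A: "residue_domain_of A J" and AC: "A \<subseteq> C" and J: "J = I \<inter> A" and ufd: "ufd_mod A J"
    and D: "D \<in> A" "D \<notin> I" and loc: "\<And>x. x \<in> C \<Longrightarrow> \<exists>m. \<exists>a\<in>A. D ^ m * x - a \<in> I"
    and ps: "\<And>p. p \<in> set ps \<Longrightarrow> prime_mod C I p" "\<And>p. p \<in> set ps \<Longrightarrow> p \<in> A \<and> dvd_mod A J p D"
    and Dps: "dvd_mod A J D (prod_list ps)"
    and bound: "\<And>b. b \<in> C \<Longrightarrow> b \<notin> I \<Longrightarrow>
      \<exists>N. \<forall>rs. set rs \<subseteq> set ps \<and> dvd_mod C I (prod_list rs) b \<longrightarrow> length rs \<le> N"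
  shows "ufd_mod C I"
proof (rule ufd_modI)
  interpret A: residue_domain_of A J by (rule A)
  have AC': "x \<in> A \<Longrightarrow> x \<in> C" and JI: "x \<in> J \<Longrightarrow> x \<in> I" for x
    using AC J by auto
  have dvdAC: "dvd_mod A J x y \<Longrightarrow> dvd_mod C I x y" for x y
    using AC' JI unfolding dvd_mod_def by blast
  have DC: "D \<in> C" using D AC' by blast
  have P: "prod_list ps \<in> C"
    using ps(2) AC' by (intro prod_list_mem) blast
  obtain e where e: "e \<in> C" "prod_list ps - D * e \<in> I"
    using dvdAC[OF Dps] by (auto simp: dvd_mod_def)
  have prime_case: "\<exists>rs. (\<forall>p\<in>set rs. prime_mod C I p) \<and> dvd_mod C I q (prod_list rs)"
    if q: "prime_mod A J q" for q
  proof (cases "dvd_mod A J q D")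
    case True
    then show ?thesis
      using ps(1) dvdAC[OF A.dvd_trans[OF True Dps]] by blast
  next
    case False
    have qA: "q \<in> A" "q \<in> C" "q \<notin> I"
      using A.prime_modD[OF q] AC' J by auto
    obtain N where N: "\<And>rs. set rs \<subseteq> set ps \<Longrightarrow> dvd_mod C I (prod_list rs) q \<Longrightarrow> length rs \<le> N"
      using bound[OF qA(2,3)] by blast
    obtain rs q' where rs: "set rs \<subseteq> set ps" and q': "q' \<in> C" "q - prod_list rs * q' \<in> I"
      and nd: "\<And>p. p \<in> set ps \<Longrightarrow> \<not> dvd_mod C I p q'"
      using extract_primes[of "set ps" q N] ps(1) qA(2) N by blast
    let ?R = "prod_list rs"
    have R: "?R \<in> A"
      using rs ps(2) by (intro A.prod_list_mem) blast
    have RC: "?R \<in> C" using AC' R by blast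
    \<comment> \<open>None of the prime factors of \<open>D\<close> divides \<open>q'\<close>, so powers of \<open>D\<close> cancel.\<close>
    have cancelD: "dvd_mod C I q' x" if x: "x \<in> C" "dvd_mod C I q' (D ^ m * x)" for x m
      using x
    proof (induction m arbitrary: x)
      case (Suc m)
      have "dvd_mod C I q' (D ^ m * (D * x))"
        using Suc.prems by (simp add: ac_simps)
      then have "dvd_mod C I q' (D * x)"
        using Suc.prems DC by - (rule Suc.IH; auto)
      then obtain s where s: "s \<in> C" "D * x - q' * s \<in> I"
        by (auto simp: dvd_mod_def)
      have "q' * (s * e) - prod_list ps * x \<in> I"
        using s e Suc.prems DC P q'
        by - (rule ideal_lin[of "D * x - q' * s" "prod_list ps - D * e" "- e" "- x"];
          auto simp: algebra_simps)
      then show ?case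
        using ps(1) nd q' s e Suc.prems by (intro cancel_primes[of ps q' "s * e" x]) auto
    qed simp
    show ?thesis
    proof (cases "dvd_mod C I q' 1")
      case True
      then obtain w where w: "w \<in> C" "1 - q' * w \<in> I"
        by (auto simp: dvd_mod_def)
      have "?R - q * w \<in> I"
        using w q' RC by - (rule ideal_lin[of "1 - q' * w" "q - ?R * q'" ?R "- w"];
          auto simp: algebra_simps)
      then have "dvd_mod C I q ?R" using w by (intro dvdI)
      then show ?thesis using rs ps(1) by blast
    next
      case nunit: False
      have "prime_mod C I q'"
      proof (rule prime_modI[OF q'(1) _ nunit])
        show "q' \<notin> I"
        proof
          assume "q' \<in> I"
          then have "?R * q' \<in> I" using RC by (simp add: ideal_mult)
          then show False using ideal_cong[OF q'(2)] qA by blast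
        qed
        fix x y assume xy: "x \<in> C" "y \<in> C" "dvd_mod C I q' (x * y)"
        then obtain z where z: "z \<in> C" "x * y - q' * z \<in> I"
          by (auto simp: dvd_mod_def)
        obtain i a1 where a1: "a1 \<in> A" "D ^ i * x - a1 \<in> I" using loc xy by blast
        obtain j a2 where a2: "a2 \<in> A" "D ^ j * y - a2 \<in> I" using loc xy by blast
        obtain k a3 where a3: "a3 \<in> A" "D ^ k * z - a3 \<in> I" using loc z by blast
        \<comment> \<open>Clearing denominators turns the relation between \<open>x\<close>, \<open>y\<close>, \<open>z\<close> into one in \<open>A / J\<close>, where \<open>q\<close> is prime.\<close>
        let ?X = "D ^ i * x" and ?Y = "D ^ j * y" and ?Z = "D ^ k * z"
        have mem: "a1 \<in> C" "a2 \<in> C" "a3 \<in> C"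
          using a1 a2 a3 AC' by auto
        have 1: "?X * ?Y - a1 * a2 \<in> I"
          using a1 a2 mem xy DC
          by - (rule ideal_lin[of "?X - a1" "?Y - a2" ?Y a1]; auto simp: algebra_simps)
        have 2: "D ^ k * D ^ i * D ^ j * ?R * (x * y) - q * (a3 * D ^ i * D ^ j) \<in> I"
        proof -
          have s1: "D ^ k * D ^ i * D ^ j * ?R * (x * y) - ?R * q' * (D ^ k * z) * D ^ i * D ^ j \<in> I"
            using z DC RC by - (rule ideal_lin1[of "x * y - q' * z" "D ^ k * D ^ i * D ^ j * ?R"];
              auto simp: algebra_simps)
          have s2: "q * ?Z - ?R * q' * ?Z \<in> I"
            using q' z DC by - (rule ideal_lin1[of "q - ?R * q'" ?Z]; auto simp: algebra_simps)
          have s3: "q * ?Z - q * a3 \<in> I"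
            using a3 qA by - (rule ideal_lin1[of "?Z - a3" q]; auto simp: algebra_simps)
          have s4: "(?R * q' * ?Z - q * a3) \<in> I"
            using ideal_sub_lin[OF s3 s2] by simp
          show ?thesis
            using s1 s4 DC by - (rule ideal_lin[OF s1 s4, of 1 "D ^ i * D ^ j"]; auto simp: algebra_simps)
        qed
        have 3: "D ^ k * D ^ i * D ^ j * ?R * (x * y) - ?R * D ^ k * (a1 * a2) \<in> I"
          using 1 DC RC by - (rule ideal_lin1[OF 1, of "?R * D ^ k"]; auto simp: algebra_simps)
        have "?R * D ^ k * (a1 * a2) - q * (a3 * D ^ i * D ^ j) \<in> I"
          using ideal_sub_lin[OF 2 3] by simp
        moreover have "?R * D ^ k * (a1 * a2) - q * (a3 * D ^ i * D ^ j) \<in> A"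
          using R D a1 a2 a3 qA by auto
        ultimately have "dvd_mod A J q (?R * D ^ k * (a1 * a2))"
          using J a3 D by (intro A.dvdI[of "a3 * D ^ i * D ^ j"]) auto
        then have "dvd_mod A J q (prod_list (rs @ replicate k D @ [a1, a2]))"
          by (simp add: ac_simps)
        moreover have "set (rs @ replicate k D @ [a1, a2]) \<subseteq> A"
          using rs ps(2) D a1 a2 by auto
        ultimately obtain t where t: "t \<in> set (rs @ replicate k D @ [a1, a2])" "dvd_mod A J q t"
          using A.prime_mod_dvd_prod_list[OF q] by blast
        have "\<not> dvd_mod A J q t" if "t \<in> set rs"
          using False A.dvd_trans[of q t D] ps(2)[of t] rs that by auto
        then have "dvd_mod A J q a1 \<or> dvd_mod A J q a2"
          using t False by (auto split: if_splits)
        moreover have q'q: "dvd_mod C I q' q"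
          using q' RC by (intro dvdI[of ?R]) (auto simp: ac_simps)
        moreover have "dvd_mod C I q' w" if w: "w \<in> C" "D ^ h * w - a \<in> I" "dvd_mod A J q a" for w a h
          using cancelD[of w h] dvd_cong[OF dvd_trans[OF q'q dvdAC[OF w(3)]] w(2)] w(1) by blast
        ultimately show "dvd_mod C I q' x \<or> dvd_mod C I q' y"
          using xy a1 a2 by blast
      qed
      moreover have "dvd_mod C I q (prod_list (rs @ [q']))"
        using q' by - (rule dvdI[of 1], simp, rule ideal_lin1[of "q - ?R * q'" "-1"]; auto)
      ultimately show ?thesis
        using rs ps(1) by (intro exI[of _ "rs @ [q']"]) auto
    qed
  qed
  have prod_case: "\<exists>rs. (\<forall>p\<in>set rs. prime_mod C I p) \<and> dvd_mod C I (prod_list qs) (prod_list rs)"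
    if "\<forall>q\<in>set qs. prime_mod A J q" for qs
    using that
  proof (induction qs)
    case Nil
    have "dvd_mod C I 1 1" by (rule dvdI[of 1]) auto
    then show ?case by (intro exI[of _ "[]"]) auto
  next
    case (Cons q qs)
    obtain rs1 where rs1: "\<forall>p\<in>set rs1. prime_mod C I p" "dvd_mod C I q (prod_list rs1)"
      using prime_case[of q] Cons.prems by auto
    obtain rs2 where rs2: "\<forall>p\<in>set rs2. prime_mod C I p" "dvd_mod C I (prod_list qs) (prod_list rs2)"
      using Cons by auto
    obtain c1 c2 where c: "c1 \<in> C" "c2 \<in> C" "prod_list rs1 - q * c1 \<in> I"
        "prod_list rs2 - prod_list qs * c2 \<in> I"
      using rs1 rs2 by (auto simp: dvd_mod_def)
    have mem: "prod_list rs2 \<in> C" "q \<in> C"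
      using rs2 Cons.prems A.prime_modD(1) AC' by (auto intro!: prod_list_mem dest: prime_modD(1))
    have "prod_list (rs1 @ rs2) - prod_list (q # qs) * (c1 * c2) \<in> I"
      using c mem by - (rule ideal_lin[OF c(3,4), of "prod_list rs2" "q * c1"];
        auto simp: algebra_simps)
    then have "dvd_mod C I (prod_list (q # qs)) (prod_list (rs1 @ rs2))"
      using c by (intro dvdI[of "c1 * c2"]) auto
    then show ?case
      using rs1 rs2 by (intro exI[of _ "rs1 @ rs2"]) auto
  qed
  fix b assume b: "b \<in> C" "b \<notin> I"
  obtain m a where a: "a \<in> A" "D ^ m * b - a \<in> I"
    using loc[OF b(1)] by blast
  have "a \<notin> J"
  proof
    assume "a \<in> J"
    then have "D ^ m * b \<in> I" using ideal_cong[OF a(2)] JI by auto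
    then show False using cancel[of "D ^ m" b] power_not_mem[of D m] D DC b by auto
  qed
  then obtain qs where qs: "\<forall>q\<in>set qs. prime_mod A J q" "dvd_mod A J a (prod_list qs)"
    using A.ufd_mod_dvd_primes[OF ufd a(1)] by blast
  have "a - b * D ^ m \<in> I"
    using a by - (rule ideal_lin1[of "D ^ m * b - a" "-1"]; auto simp: algebra_simps)
  then have "dvd_mod C I b a"
    using DC by (intro dvdI[of "D ^ m"]) auto
  then have ba: "dvd_mod C I b (prod_list qs)"
    using dvd_trans[OF _ dvdAC[OF qs(2)]] by simp
  obtain rs where "\<forall>p\<in>set rs. prime_mod C I p" "dvd_mod C I (prod_list qs) (prod_list rs)"
    using prod_case[OF qs(1)] by blast
  then show "\<exists>rs. (\<forall>p\<in>set rs. prime_mod C I p) \<and> dvd_mod C I b (prod_list rs)"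
    using dvd_trans[OF ba, of "prod_list rs"] by (intro exI[of _ rs]) simp
qed

lemma residue_domain_of_zero:
  fixes C :: "'a::idom set"
  assumes "unital_subring C"
  shows "residue_domain_of C {0}"
proof (rule residue_domain_ofI[OF assms])
  have "0 \<in> C" using assms unfolding unital_subring_def by (metis diff_self)
  then show "prime_ideal_of C {0}"
    by (auto simp: prime_ideal_of_def ideal_of_def)
qed

section \<open>Gauss's lemma\<close>

lemma dvd_mod_zero: "dvd_mod C {0} a b \<longleftrightarrow> (\<exists>c\<in>C. b = a * c)"
  by (simp add: dvd_mod_def)

text \<open>This is Gauss's lemma with all denominators cleared. The ring \<open>C\<close> plays the role of a polynomial ring over
\<open>C0\<close>, and division with remainder is available after multiplication by a nonzero constant. By induction
on the degree, a nonzero \<open>f\<close> divides a product of primes. If some constant multiple of \<open>f\<close> splits into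
factors of smaller degree, the induction hypothesis applies to them. Otherwise \<open>f\<close> is irreducible over
the fraction field of \<open>C0\<close>, and its primitive part \<open>f'\<close> is prime: for \<open>f'\<close> dividing \<open>g * h\<close>, a nonzero
combination \<open>u\<close> of \<open>f'\<close> and \<open>g\<close> of least degree divides constant multiples of both; by irreducibility
\<open>u\<close> is a constant, and then \<open>f'\<close> divides \<open>u * h\<close>, or it has the degree of \<open>f'\<close>, and then \<open>f'\<close> divides a
constant multiple of \<open>g\<close>. Constants are products of primes that do not divide \<open>f'\<close>, hence they cancel.\<close>

theorem ufd_mod_of_pseudo_division:
  fixes C C0 :: "'a::idom set" and deg :: "'a \<Rightarrow> nat"
  assumes C: "unital_subring C" and C0: "unital_subring C0" "C0 \<subseteq> C" and ufd: "ufd_mod C0 {0}"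
    and primes: "\<And>p. prime_mod C0 {0} p \<Longrightarrow> prime_mod C {0} p"
    and deg_mult: "\<And>f g. f \<noteq> 0 \<Longrightarrow> g \<noteq> 0 \<Longrightarrow> deg (f * g) = deg f + deg g"
    and deg_zero: "\<And>f. f \<in> C \<Longrightarrow> deg f = 0 \<Longrightarrow> f \<in> C0" "\<And>f. f \<in> C0 \<Longrightarrow> deg f = 0"
    and division: "\<And>f g. f \<in> C \<Longrightarrow> g \<in> C \<Longrightarrow> g \<noteq> 0 \<Longrightarrow>
      \<exists>a\<in>C0. \<exists>q\<in>C. \<exists>r\<in>C. a \<noteq> 0 \<and> a * f = g * q + r \<and> (r = 0 \<or> deg r < deg g)"
    and bound: "\<And>f. f \<in> C \<Longrightarrow> f \<noteq> 0 \<Longrightarrow> \<exists>N. \<forall>rs. (\<forall>p\<in>set rs. prime_mod C0 {0} p) \<and>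
      dvd_mod C {0} (prod_list rs) f \<longrightarrow> length rs \<le> N"
  shows "ufd_mod C {0}"
proof -
  interpret R: residue_domain_of C "{0}" by (rule residue_domain_of_zero[OF C])
  interpret Z: residue_domain_of C0 "{0}" by (rule residue_domain_of_zero[OF C0(1)])
  have sub: "a \<in> C0 \<Longrightarrow> a \<in> C" for a using C0 by blast
  have const: "\<exists>ps. (\<forall>p\<in>set ps. prime_mod C {0} p) \<and> dvd_mod C {0} a (prod_list ps)"
    and const0: "\<exists>ps. (\<forall>p\<in>set ps. prime_mod C0 {0} p) \<and> dvd_mod C {0} a (prod_list ps)"
    if a: "a \<in> C0" "a \<noteq> 0" for a
  proof -
    obtain ps where ps: "\<forall>p\<in>set ps. prime_mod C0 {0} p" "dvd_mod C0 {0} a (prod_list ps)"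
      using Z.ufd_mod_dvd_primes[OF ufd, of a] a by auto
    then show "\<exists>ps. (\<forall>p\<in>set ps. prime_mod C0 {0} p) \<and> dvd_mod C {0} a (prod_list ps)"
      using sub unfolding dvd_mod_zero by blast
    then show "\<exists>ps. (\<forall>p\<in>set ps. prime_mod C {0} p) \<and> dvd_mod C {0} a (prod_list ps)"
      using primes by blast
  qed
  have mult_case: "\<exists>ps. (\<forall>p\<in>set ps. prime_mod C {0} p) \<and> dvd_mod C {0} (f * g) (prod_list ps)"
    if f: "\<exists>ps. (\<forall>p\<in>set ps. prime_mod C {0} p) \<and> dvd_mod C {0} f (prod_list ps)"
      and g: "\<exists>ps. (\<forall>p\<in>set ps. prime_mod C {0} p) \<and> dvd_mod C {0} g (prod_list ps)" for f g
  proof -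
    obtain ps c where 1: "\<forall>p\<in>set ps. prime_mod C {0} p" "c \<in> C" "prod_list ps = f * c"
      using f by (auto simp: dvd_mod_zero)
    obtain qs e where 2: "\<forall>p\<in>set qs. prime_mod C {0} p" "e \<in> C" "prod_list qs = g * e"
      using g by (auto simp: dvd_mod_zero)
    show ?thesis
      using 1 2 by (intro exI[of _ "ps @ qs"]) (auto simp: dvd_mod_zero intro!: bexI[of _ "c * e"])
  qed
  show ?thesis
  proof (rule R.ufd_modI)
    fix f assume "f \<in> C" "f \<notin> {0}"
    then show "\<exists>ps. (\<forall>p\<in>set ps. prime_mod C {0} p) \<and> dvd_mod C {0} f (prod_list ps)"
    proof (induction "deg f" arbitrary: f rule: less_induct)
      case (less f)
      then have f: "f \<in> C" "f \<noteq> 0" by auto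
      consider "deg f = 0"
        | (red) a g h where "a \<in> C0" "a \<noteq> 0" "g \<in> C" "h \<in> C" "a * f = g * h" "0 < deg g" "deg g < deg f"
        | (irred) "deg f > 0" "\<And>a g h. a \<in> C0 \<Longrightarrow> a \<noteq> 0 \<Longrightarrow> g \<in> C \<Longrightarrow> h \<in> C \<Longrightarrow> a * f = g * h \<Longrightarrow>
            deg g = 0 \<or> deg g \<ge> deg f"
      proof (cases "deg f > 0 \<and> (\<forall>a\<in>C0. \<forall>g\<in>C. \<forall>h\<in>C. a \<noteq> 0 \<longrightarrow> a * f = g * h \<longrightarrow>
          deg g = 0 \<or> deg g \<ge> deg f)")
        case True
        then show ?thesis using that(3) by blast
      next
        case False
        then consider "deg f = 0" | a g h where "a \<in> C0" "g \<in> C" "h \<in> C" "a \<noteq> 0" "a * f = g * h"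
          "\<not> (deg g = 0 \<or> deg g \<ge> deg f)" by blast
        then show ?thesis using that(1) that(2)[of _ _ _] by cases auto
      qed
      then show ?case
      proof cases
        case 1
        then show ?thesis using const deg_zero(1) f by blast
      next
        case red
        have nz: "g \<noteq> 0" "h \<noteq> 0" using red f by auto
        have "deg g + deg h = deg f"
          using deg_mult[OF nz] deg_mult[of a f] deg_zero(2)[of a] red f by simp
        then have "\<exists>ps. (\<forall>p\<in>set ps. prime_mod C {0} p) \<and> dvd_mod C {0} (g * h) (prod_list ps)"
          using red nz by (intro mult_case less.hyps) auto
        moreover have "dvd_mod C {0} f (g * h)"
          using red sub by (auto simp: dvd_mod_zero ac_simps intro!: bexI[of _ a])
        ultimately show ?thesis
          using R.dvd_trans[of f "g * h"] by auto
      next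
        case irred
        obtain N where N: "\<And>rs. set rs \<subseteq> Collect (prime_mod C0 {0}) \<Longrightarrow>
            dvd_mod C {0} (prod_list rs) f \<Longrightarrow> length rs \<le> N"
          using bound[OF f] by blast
        obtain rs f' where rs: "set rs \<subseteq> Collect (prime_mod C0 {0})" and f': "f' \<in> C"
            "f - prod_list rs * f' \<in> {0}"
          and nd: "\<And>p. prime_mod C0 {0} p \<Longrightarrow> \<not> dvd_mod C {0} p f'"
        proof (rule R.extract_primes[of "Collect (prime_mod C0 {0})" f N])
          fix rs b' assume "set rs \<subseteq> Collect (prime_mod C0 {0})" "b' \<in> C" "f - prod_list rs * b' \<in> {0}"
            "\<And>p. p \<in> Collect (prime_mod C0 {0}) \<Longrightarrow> \<not> dvd_mod C {0} p b'"
          then show thesis by (intro that[of rs b']) auto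
        qed (use primes f N in auto)
        let ?c = "prod_list rs"
        have c: "?c \<in> C0" using rs by (intro Z.prod_list_mem) (auto dest: Z.prime_modD(1))
        have ff': "f = ?c * f'" using f' by auto
        then have "?c * f' \<noteq> 0" using f(2) by metis
        then have nz: "?c \<noteq> 0" "f' \<noteq> 0" by (metis mult_zero_left mult_zero_right)+
        have degf': "deg f' = deg f"
          using deg_mult[OF nz] deg_zero(2)[OF c] ff' by simp
        have irr: "deg g = 0 \<or> deg g \<ge> deg f"
          if "a \<in> C0" "a \<noteq> 0" "g \<in> C" "h \<in> C" "a * f' = g * h" for a g h
          using irred(2)[of a g "?c * h"] that c sub ff' by (auto simp: algebra_simps)
        have cancel_const: "dvd_mod C {0} f' x" if a: "a \<in> C0" "a \<noteq> 0" "x \<in> C" "dvd_mod C {0} f' (a * x)" for a x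
        proof -
          obtain ps where ps: "\<forall>p\<in>set ps. prime_mod C0 {0} p" "dvd_mod C {0} a (prod_list ps)"
            using const0[OF a(1,2)] by blast
          obtain s where s: "s \<in> C" "prod_list ps = a * s" using ps by (auto simp: dvd_mod_zero)
          obtain t where t: "t \<in> C" "a * x = f' * t" using a by (auto simp: dvd_mod_zero)
          have "f' * (t * s) = (a * x) * s" using t by (simp add: ac_simps)
          also have "\<dots> = prod_list ps * x" using s by (simp add: ac_simps)
          finally have "f' * (t * s) - prod_list ps * x \<in> {0}" by simp
          then show ?thesis
            using ps primes nd f' s t a by (intro R.cancel_primes[of ps f' "t * s" x]) auto
        qed
        have "prime_mod C {0} f'"
        proof (rule R.prime_modI)
          show "f' \<in> C" "f' \<notin> {0}" using f' nz by auto
          show "\<not> dvd_mod C {0} f' 1"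
          proof
            assume "dvd_mod C {0} f' 1"
            then obtain x where x: "1 = f' * x" by (auto simp: dvd_mod_zero)
            then have "f' \<noteq> 0" "x \<noteq> 0" by auto
            then have "deg (1::'a) = deg f' + deg x" using deg_mult[of f' x] x by simp
            then show False using deg_zero(2)[OF Z.one_mem] degf' irred(1) by simp
          qed
          fix g h assume gh: "g \<in> C" "h \<in> C" "dvd_mod C {0} f' (g * h)"
          then obtain z where z: "z \<in> C" "g * h = f' * z" by (auto simp: dvd_mod_zero)
          define K where "K = {x. x \<noteq> 0 \<and> (\<exists>\<alpha>\<in>C. \<exists>\<beta>\<in>C. x = f' * \<alpha> + g * \<beta>)}"
          have "f' = f' * 1 + g * 0" by simp
          then have fK: "f' \<in> K"
            using nz(2) R.one_mem R.zero_mem unfolding K_def by blast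
          obtain u where u: "u \<in> K" "\<And>v. v \<in> K \<Longrightarrow> deg u \<le> deg v"
            using ex_has_least_nat[of "\<lambda>v. v \<in> K" f' deg] fK by blast
          then obtain \<alpha> \<beta> where ab: "\<alpha> \<in> C" "\<beta> \<in> C" "u = f' * \<alpha> + g * \<beta>" "u \<noteq> 0"
            by (auto simp: K_def)
          have uC: "u \<in> C" using ab f' gh by simp
          have divides: "\<exists>a\<in>C0. \<exists>q\<in>C. a \<noteq> 0 \<and> a * w = u * q"
            if w: "w \<in> C" "\<exists>\<gamma>\<in>C. \<exists>\<delta>\<in>C. w = f' * \<gamma> + g * \<delta>" for w
          proof -
            obtain \<gamma> \<delta> where w': "\<gamma> \<in> C" "\<delta> \<in> C" "w = f' * \<gamma> + g * \<delta>" using w by blast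
            obtain a q r where d: "a \<in> C0" "q \<in> C" "r \<in> C" "a \<noteq> 0" "a * w = u * q + r" "r = 0 \<or> deg r < deg u"
              using division[OF w(1) uC ab(4)] by blast
            have "r = f' * (a * \<gamma> - \<alpha> * q) + g * (a * \<delta> - \<beta> * q)"
              using d(5) ab(3) w'(3) by (simp add: algebra_simps)
            moreover have "a * \<gamma> - \<alpha> * q \<in> C" "a * \<delta> - \<beta> * q \<in> C"
              using d sub w' ab by auto
            ultimately have "r = 0 \<or> r \<in> K" unfolding K_def by blast
            then have "r = 0" using d(6) u(2) by fastforce
            then show ?thesis using d by auto
          qed
          obtain a q where aq: "a \<in> C0" "q \<in> C" "a \<noteq> 0" "a * f' = u * q"
          proof -
            have "\<exists>\<gamma>\<in>C. \<exists>\<delta>\<in>C. f' = f' * \<gamma> + g * \<delta>"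
              by (intro bexI[of _ 1] bexI[of _ 0]) auto
            then show ?thesis using that divides[OF f'(1)] by blast
          qed
          obtain a' q' where aq': "a' \<in> C0" "q' \<in> C" "a' \<noteq> 0" "a' * g = u * q'"
          proof -
            have "\<exists>\<gamma>\<in>C. \<exists>\<delta>\<in>C. g = f' * \<gamma> + g * \<delta>"
              by (intro bexI[of _ 1] bexI[of _ 0]) auto
            then show ?thesis using that divides[OF gh(1)] by blast
          qed
          have "deg u \<le> deg f" using u(2)[OF fK] degf' by simp
          then consider "deg u = 0" | "deg u = deg f" using irr[OF aq(1,3) uC aq(2,4)] by linarith
          then show "dvd_mod C {0} f' g \<or> dvd_mod C {0} f' h"
          proof cases
            case 1
            have "u * h = f' * (\<alpha> * h + z * \<beta>)"
              using ab(3) z(2) by (simp add: algebra_simps)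
            then have "dvd_mod C {0} f' (u * h)"
              using ab z gh by (auto simp: dvd_mod_zero)
            then show ?thesis
              using cancel_const[of u h] deg_zero(1)[OF uC 1] ab gh by blast
          next
            case 2
            have qz: "q \<noteq> 0" using aq nz by auto
            have "deg (a * f') = deg (u * q)" using aq by simp
            then have "deg q = 0"
              using deg_mult[OF aq(3) nz(2)] deg_mult[OF ab(4) qz] deg_zero(2)[OF aq(1)] degf' 2 by simp
            then have qC: "q \<in> C0" using deg_zero(1) aq by blast
            have "(a' * q) * g = (u * q) * q'"
              using aq'(4) by (simp add: ac_simps)
            then have "(a' * q) * g = f' * (a * q')"
              unfolding aq(4)[symmetric] by (simp add: ac_simps)
            then have "dvd_mod C {0} f' ((a' * q) * g)"
              using aq aq' sub by (auto simp: dvd_mod_zero)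
            then show ?thesis
              using cancel_const[of "a' * q" g] aq' qC qz gh by auto
          qed
        qed
        then have "\<exists>ps. (\<forall>p\<in>set ps. prime_mod C {0} p) \<and> dvd_mod C {0} f' (prod_list ps)"
          by (intro exI[of _ "[f']"]) (auto simp: dvd_mod_zero intro!: bexI[of _ 1])
        then show ?thesis
          using mult_case[OF const[OF c nz(1)]] ff' by simp
      qed
    qed
  qed
qed

section \<open>Generated ideals and isomorphisms of residue rings\<close>

inductive_set ideal_gen :: "'a::comm_ring_1 set \<Rightarrow> 'a set \<Rightarrow> 'a set" for C F where
  zero: "0 \<in> ideal_gen C F"
| step: "h \<in> ideal_gen C F \<Longrightarrow> c \<in> C \<Longrightarrow> f \<in> F \<Longrightarrow> c * f + h \<in> ideal_gen C F"

lemma ideal_gen_add: "a \<in> ideal_gen C F \<Longrightarrow> b \<in> ideal_gen C F \<Longrightarrow> a + b \<in> ideal_gen C F"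
  by (induction a rule: ideal_gen.induct) (auto simp: add.assoc intro: ideal_gen.intros)

lemma ideal_gen_mem: "1 \<in> C \<Longrightarrow> f \<in> F \<Longrightarrow> f \<in> ideal_gen C F"
  using ideal_gen.step[OF ideal_gen.zero, of 1 C f F] by simp

lemma ideal_gen_least:
  assumes "ideal_of C I" "F \<subseteq> I"
  shows "ideal_gen C F \<subseteq> I"
proof
  fix x assume "x \<in> ideal_gen C F"
  then show "x \<in> I"
    using assms by induction (auto simp: ideal_of_def)
qed

lemma ideal_gen_mult:
  assumes "unital_subring C" "a \<in> ideal_gen C F" "c \<in> C"
  shows "c * a \<in> ideal_gen C F"
  using assms(2)
proof induction
  case zero
  then show ?case by (simp add: ideal_gen.zero)
next
  case (step h e f)
  have "(c * e) * f + c * h \<in> ideal_gen C F"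
    using step assms by (intro ideal_gen.step) (auto simp: unital_subring_def)
  then show ?case by (simp add: algebra_simps)
qed

lemma ideal_of_ideal_gen:
  assumes "unital_subring C" "F \<subseteq> C"
  shows "ideal_of C (ideal_gen C F)"
proof -
  have C: "residue_ring_of C C"
    using assms residue_ring_of.ideal_add by (auto simp: residue_ring_of_def ideal_of_def unital_subring_def)
      (metis diff_minus_eq_add diff_self diff_0)+
  have "ideal_gen C F \<subseteq> C"
    using residue_ring_of.ideal[OF C] assms(2) by (rule ideal_gen_least)
  then show ?thesis
    using ideal_gen_add ideal_gen_mult[OF assms(1)] ideal_gen.zero by (auto simp: ideal_of_def)
qed

lemma ideal_gen_mono:
  assumes "C \<subseteq> C'" "F \<subseteq> F'"
  shows "ideal_gen C F \<subseteq> ideal_gen C' F'"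
proof
  fix x assume "x \<in> ideal_gen C F"
  then show "x \<in> ideal_gen C' F'"
    using assms by induction (auto intro: ideal_gen.intros)
qed

lemma ideal_gen_ideal: "ideal_of C I \<Longrightarrow> 1 \<in> C \<Longrightarrow> ideal_gen C I = I"
  by (intro subset_antisym ideal_gen_least) (auto intro: ideal_gen_mem)

lemma ideal_gen_ideal_gen:
  assumes "unital_subring C'" "C \<subseteq> C'" "F \<subseteq> C'" "1 \<in> C"
  shows "ideal_gen C' (ideal_gen C F) = ideal_gen C' F"
proof
  show "ideal_gen C' (ideal_gen C F) \<subseteq> ideal_gen C' F"
    using assms(2) by (intro ideal_gen_least[OF ideal_of_ideal_gen[OF assms(1,3)]] ideal_gen_mono) auto
  show "ideal_gen C' F \<subseteq> ideal_gen C' (ideal_gen C F)"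
    using assms by (intro ideal_gen_mono) (auto intro: ideal_gen_mem)
qed

lemma (in residue_ring_of) adjoin_ideal_gen:
  assumes "I = ideal_gen C F" "F \<subseteq> C" "a \<in> C"
  shows "adjoin C I a = ideal_gen C (insert a F)"
proof
  have aF: "residue_ring_of C (ideal_gen C (insert a F))"
    using ideal_of_ideal_gen[OF subring] assms by (simp add: residue_ring_of_def subring)
  show "ideal_gen C (insert a F) \<subseteq> adjoin C I a"
  proof (rule ideal_gen_least[OF ideal_adjoin[OF assms(3)]])
    have "dvd_mod C I a x" if "x \<in> I" for x
      using that by (intro dvdI[of 0]) auto
    moreover have "dvd_mod C I a a" by (rule dvdI[of 1]) auto
    ultimately show "insert a F \<subseteq> adjoin C I a"
      using assms by (auto simp: adjoin_def ideal_gen_mem)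
  qed
  show "adjoin C I a \<subseteq> ideal_gen C (insert a F)"
  proof
    fix x assume "x \<in> adjoin C I a"
    then obtain c where c: "c \<in> C" "x - a * c \<in> I" by (auto simp: adjoin_def dvd_mod_def)
    have "x - a * c \<in> ideal_gen C (insert a F)"
      using c assms(1) ideal_gen_mono[of C C F "insert a F"] by auto
    then have "c * a + (x - a * c) \<in> ideal_gen C (insert a F)"
      using c by (intro ideal_gen.step) auto
    then show "x \<in> ideal_gen C (insert a F)" by (simp add: ac_simps)
  qed
qed

text \<open>The ring homomorphism \<open>h\<close> induces an isomorphism from \<open>C / I\<close> onto \<open>C' / I'\<close>. It is only required to
be a homomorphism on \<open>C\<close>.\<close>

locale residue_iso = residue_ring_of C I for C I :: "'a::comm_ring_1 set" +
  fixes h :: "'a \<Rightarrow> 'b::comm_ring_1" and C' I' :: "'b set"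
  assumes hom_one: "h 1 = 1"
    and hom_diff: "\<And>a b. a \<in> C \<Longrightarrow> b \<in> C \<Longrightarrow> h (a - b) = h a - h b"
    and hom_mult: "\<And>a b. a \<in> C \<Longrightarrow> b \<in> C \<Longrightarrow> h (a * b) = h a * h b"
    and surj: "h ` C = C'" and sub: "I' \<subseteq> C'"
    and kernel: "\<And>a. a \<in> C \<Longrightarrow> h a \<in> I' \<longleftrightarrow> a \<in> I"
begin

lemma hom_add: "a \<in> C \<Longrightarrow> b \<in> C \<Longrightarrow> h (a + b) = h a + h b"
  using hom_diff[of a "- b"] hom_diff[of 0 b] hom_diff[of 0 0] by simp

lemma hom_prod_list: "set xs \<subseteq> C \<Longrightarrow> h (prod_list xs) = prod_list (map h xs)"
  by (induction xs) (auto simp: hom_one hom_mult subset_iff)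

lemma unital_subring_image: "unital_subring C'"
  unfolding unital_subring_def surj[symmetric]
  by (auto simp: hom_one[symmetric] hom_diff[symmetric] hom_mult[symmetric])

lemma ideal_of_image: "ideal_of C' I'"
  unfolding ideal_of_def
proof (intro conjI ballI sub)
  have "h 0 = 0" using hom_diff[of 0 0] by simp
  then show "0 \<in> I'" using kernel[of 0] by simp
  fix a assume "a \<in> I'"
  then obtain x where x: "x \<in> C" "a = h x" "x \<in> I" using sub surj kernel by blast
  show "a + b \<in> I'" if b: "b \<in> I'" for b
  proof -
    obtain y where "y \<in> C" "b = h y" "y \<in> I" using b sub surj kernel by blast
    then show ?thesis using x kernel[of "x + y"] hom_add[of x y] ideal_add by simp
  qed
  show "c * a \<in> I'" if c: "c \<in> C'" for c
  proof -
    obtain y where "y \<in> C" "c = h y" using c surj by blast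
    then show ?thesis using x kernel[of "y * x"] hom_mult[of y x] ideal_mult by simp
  qed
qed

lemma dvd_mod_image:
  assumes "a \<in> C" "b \<in> C"
  shows "dvd_mod C' I' (h a) (h b) \<longleftrightarrow> dvd_mod C I a b"
proof -
  have "h b - h a * h c \<in> I' \<longleftrightarrow> b - a * c \<in> I" if "c \<in> C" for c
    using kernel[of "b - a * c"] assms that by (simp add: hom_diff hom_mult)
  then show ?thesis
    unfolding dvd_mod_def surj[symmetric] by auto
qed

lemma prime_ideal_image:
  assumes "prime_ideal_of C I"
  shows "prime_ideal_of C' I'"
  unfolding prime_ideal_of_def
proof (intro conjI ideal_of_image ballI impI)
  show "1 \<notin> I'" using kernel[of 1] assms by (simp add: hom_one prime_ideal_of_def)
  fix a b assume "a \<in> C'" "b \<in> C'" "a * b \<in> I'"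
  then obtain x y where "x \<in> C" "y \<in> C" "a = h x" "b = h y" "h (x * y) \<in> I'"
    unfolding surj[symmetric] by (auto simp: hom_mult)
  then show "a \<in> I' \<or> b \<in> I'"
    using assms kernel by (auto simp: prime_ideal_of_def)
qed

lemma prime_mod_image:
  assumes "p \<in> C"
  shows "prime_mod C' I' (h p) \<longleftrightarrow> prime_mod C I p"
proof -
  interpret R': residue_ring_of C' I'
    using unital_subring_image ideal_of_image by (simp add: residue_ring_of_def)
  have one: "dvd_mod C' I' (h p) 1 \<longleftrightarrow> dvd_mod C I p 1"
    using dvd_mod_image[of p 1] assms by (simp add: hom_one)
  show ?thesis
  proof
    assume p: "prime_mod C I p"
    show "prime_mod C' I' (h p)"
    proof (rule R'.prime_modI)
      show "h p \<in> C'" "h p \<notin> I'" "\<not> dvd_mod C' I' (h p) 1"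
        using assms surj kernel prime_modD[OF p] one by auto
      fix a b assume "a \<in> C'" "b \<in> C'" "dvd_mod C' I' (h p) (a * b)"
      then obtain x y where "x \<in> C" "y \<in> C" "a = h x" "b = h y" "dvd_mod C' I' (h p) (h (x * y))"
        unfolding surj[symmetric] by (auto simp: hom_mult)
      then show "dvd_mod C' I' (h p) a \<or> dvd_mod C' I' (h p) b"
        using prime_modD(4)[OF p, of x y] assms by (simp add: dvd_mod_image)
    qed
  next
    assume p: "prime_mod C' I' (h p)"
    show "prime_mod C I p"
    proof (rule prime_modI)
      show "p \<in> C" "p \<notin> I" "\<not> dvd_mod C I p 1"
        using assms kernel R'.prime_modD[OF p] one by auto
      fix x y assume xy: "x \<in> C" "y \<in> C" "dvd_mod C I p (x * y)"
      then have "dvd_mod C' I' (h p) (h x * h y)"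
        using dvd_mod_image[of p "x * y"] assms by (simp add: hom_mult)
      then show "dvd_mod C I p x \<or> dvd_mod C I p y"
        using R'.prime_modD(4)[OF p, of "h x" "h y"] xy assms surj by (auto simp: dvd_mod_image)
    qed
  qed
qed

lemma ufd_mod_image:
  assumes "ufd_mod C I"
  shows "ufd_mod C' I'"
  unfolding ufd_mod_def
proof (intro conjI ballI)
  show "prime_ideal_of C' I'" using assms prime_ideal_image by (simp add: ufd_mod_def)
  fix a assume "a \<in> C' - I'"
  then obtain x where x: "x \<in> C" "a = h x" "x \<notin> I" using surj kernel by blast
  then obtain ps u where ps: "\<forall>p\<in>set ps. prime_mod C I p" "u \<in> C" "dvd_mod C I u 1"
      "x - u * prod_list ps \<in> I"
    using assms unfolding ufd_mod_def by blast
  have psC: "set ps \<subseteq> C" using ps prime_modD(1) by blast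
  then have P: "prod_list ps \<in> C" by (intro prod_list_mem) auto
  have "a - h u * prod_list (map h ps) \<in> I'"
    using ps(2,4) P x kernel[of "x - u * prod_list ps"] psC
    by (simp add: hom_diff hom_mult hom_prod_list)
  moreover have "dvd_mod C' I' (h u) 1"
    using dvd_mod_image[of u 1] ps by (simp add: hom_one)
  moreover have "\<forall>p\<in>set (map h ps). prime_mod C' I' p"
    using ps psC prime_mod_image by auto
  moreover have "h u \<in> C'" using ps surj by auto
  ultimately show "\<exists>ps u. (\<forall>p\<in>set ps. prime_mod C' I' p) \<and> u \<in> C' \<and> dvd_mod C' I' u 1 \<and>
      a - u * prod_list ps \<in> I'"
    by blast
qed

end

section \<open>Univariate polynomials over a subring\<close>

definition poly_over :: "'a::comm_ring_1 set \<Rightarrow> 'a poly set" where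
  "poly_over C = {f. \<forall>i. coeff f i \<in> C}"

context residue_ring_of
begin

lemma sum_mem [simp]: "(\<And>i. i \<in> K \<Longrightarrow> f i \<in> C) \<Longrightarrow> sum f K \<in> C"
  by (induction K rule: infinite_finite_induct) auto

lemma sum_ideal: "(\<And>i. i \<in> K \<Longrightarrow> f i \<in> I) \<Longrightarrow> sum f K \<in> I"
  by (induction K rule: infinite_finite_induct) (auto intro: ideal_add)

lemma unital_subring_poly_over: "unital_subring (poly_over C)"
  by (auto simp: unital_subring_def poly_over_def coeff_mult intro!: sum_mem)

lemma ideal_of_poly_over: "ideal_of (poly_over C) (poly_over I)"
  using ideal_sub by (auto simp: ideal_of_def poly_over_def coeff_mult intro!: ideal_add sum_ideal ideal_mult)

lemma pCons_poly_over: "pCons a f \<in> poly_over D \<longleftrightarrow> a \<in> D \<and> f \<in> poly_over D"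
  by (force simp: poly_over_def coeff_pCons split: nat.splits)

lemma adjoin_poly_over:
  assumes "c \<in> C"
  shows "adjoin (poly_over C) (poly_over I) [:c:] = poly_over (adjoin C I c)"
proof (intro subset_antisym subsetI)
  fix f assume "f \<in> adjoin (poly_over C) (poly_over I) [:c:]"
  then obtain g where g: "f \<in> poly_over C" "g \<in> poly_over C" "f - [:c:] * g \<in> poly_over I"
    by (auto simp: adjoin_def dvd_mod_def)
  then have "coeff f i - c * coeff g i \<in> I" "coeff g i \<in> C" "coeff f i \<in> C" for i
    by (simp_all add: poly_over_def)
  then show "f \<in> poly_over (adjoin C I c)"
    by (auto simp: poly_over_def adjoin_def dvd_mod_def)
next
  fix f assume "f \<in> poly_over (adjoin C I c)"
  then show "f \<in> adjoin (poly_over C) (poly_over I) [:c:]"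
  proof (induction f)
    case 0
    interpret P: residue_ring_of "poly_over C" "poly_over I"
      using unital_subring_poly_over ideal_of_poly_over by (simp add: residue_ring_of_def)
    show ?case by (auto simp: adjoin_def dvd_mod_def intro!: bexI[of _ 0])
  next
    case (pCons a f)
    then have "a \<in> adjoin C I c" "f \<in> adjoin (poly_over C) (poly_over I) [:c:]"
      by (auto simp: pCons_poly_over)
    then obtain q g where q: "a \<in> C" "q \<in> C" "a - c * q \<in> I"
        "f \<in> poly_over C" "g \<in> poly_over C" "f - [:c:] * g \<in> poly_over I"
      by (auto simp: adjoin_def dvd_mod_def)
    have "pCons a f - [:c:] * pCons q g = pCons (a - c * q) (f - [:c:] * g)"
      by simp
    then have "pCons a f - [:c:] * pCons q g \<in> poly_over I"
      using q by (simp only: pCons_poly_over)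
    then show ?case
      using q unfolding adjoin_def dvd_mod_def by (auto simp: pCons_poly_over intro!: bexI[of _ "pCons q g"])
  qed
qed

end

text \<open>If \<open>f\<close> and \<open>g\<close> both have coefficients outside \<open>I\<close>, consider the lowest ones, at positions \<open>m\<close> and \<open>n\<close>:
modulo \<open>I\<close> the coefficient of \<open>f * g\<close> at \<open>m + n\<close> is their product.\<close>

lemma prime_ideal_of_poly_over:
  assumes C: "unital_subring C" and I: "prime_ideal_of C I"
  shows "prime_ideal_of (poly_over C) (poly_over I)"
  unfolding prime_ideal_of_def
proof (intro conjI ballI impI)
  interpret residue_domain_of C I by (rule residue_domain_ofI[OF assms])
  show "ideal_of (poly_over C) (poly_over I)" by (rule ideal_of_poly_over)
  have "coeff 1 0 \<notin> I" using one_not_mem by simp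
  then show "1 \<notin> poly_over I" unfolding poly_over_def by blast
  fix f g assume fg: "f \<in> poly_over C" "g \<in> poly_over C" "f * g \<in> poly_over I"
  show "f \<in> poly_over I \<or> g \<in> poly_over I"
  proof (rule ccontr)
    assume "\<not> ?thesis"
    then have ex: "\<exists>i. coeff f i \<notin> I" "\<exists>i. coeff g i \<notin> I" by (auto simp: poly_over_def)
    define m where "m = (LEAST i. coeff f i \<notin> I)"
    define n where "n = (LEAST i. coeff g i \<notin> I)"
    have m: "coeff f m \<notin> I" "\<And>i. i < m \<Longrightarrow> coeff f i \<in> I"
      using LeastI_ex[OF ex(1)] not_less_Least unfolding m_def by blast+
    have n: "coeff g n \<notin> I" "\<And>i. i < n \<Longrightarrow> coeff g i \<in> I"
      using LeastI_ex[OF ex(2)] not_less_Least unfolding n_def by blast+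
    have fC: "coeff f i \<in> C" and gC: "coeff g i \<in> C" for i
      using fg by (auto simp: poly_over_def)
    have "coeff (f * g) (m + n) = coeff f m * coeff g n +
        (\<Sum>i\<in>{..m + n} - {m}. coeff f i * coeff g (m + n - i))"
      by (simp add: coeff_mult sum.remove[of "{..m + n}" m])
    moreover have "(\<Sum>i\<in>{..m + n} - {m}. coeff f i * coeff g (m + n - i)) \<in> I"
    proof (rule sum_ideal)
      fix i assume i: "i \<in> {..m + n} - {m}"
      then consider "i < m" | "m + n - i < n" by fastforce
      then show "coeff f i * coeff g (m + n - i) \<in> I"
      proof cases
        case 1
        then show ?thesis using ideal_mult[OF gC m(2)[OF 1], of "m + n - i"] by (simp add: mult.commute)
      next
        case 2
        then show ?thesis using ideal_mult[OF fC n(2)[OF 2]] by simp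
      qed
    qed
    moreover have "coeff (f * g) (m + n) \<in> I" using fg by (simp add: poly_over_def)
    ultimately have "coeff f m * coeff g n \<in> I"
      using ideal_sub_lin by fastforce
    then show False using mult_memD[OF fC gC] m n by blast
  qed
qed

lemma poly_over_zero: "poly_over {0} = {0}"
  by (auto simp: poly_over_def poly_eq_iff)

lemma pseudo_division_poly_over:
  fixes C :: "'a::idom set"
  assumes C: "unital_subring C" and f: "f \<in> poly_over C" and g: "g \<in> poly_over C" "g \<noteq> 0"
  shows "\<exists>a\<in>C. \<exists>q\<in>poly_over C. \<exists>r\<in>poly_over C.
    a \<noteq> 0 \<and> [:a:] * f = g * q + r \<and> (r = 0 \<or> degree r < degree g)"
  using f
proof (induction "degree f" arbitrary: f rule: less_induct)
  case (less f)
  interpret residue_domain_of C "{0}" by (rule residue_domain_of_zero[OF C])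
  interpret P: residue_domain_of "poly_over C" "{0}"
    by (rule residue_domain_of_zero[OF unital_subring_poly_over])
  show ?case
  proof (cases "f = 0 \<or> degree f < degree g")
    case True
    then show ?thesis using less.prems by (intro bexI[of _ 1] bexI[of _ 0] bexI[of _ f]) auto
  next
    case False
    then have fg: "f \<noteq> 0" "degree g \<le> degree f" by auto
    define t where "t = monom (lead_coeff f) (degree f - degree g)"
    define f1 where "f1 = [:lead_coeff g:] * f - g * t"
    have lc: "lead_coeff f \<in> C" "lead_coeff g \<in> C" "lead_coeff g \<noteq> 0"
      using less.prems g by (auto simp: poly_over_def)
    have t: "t \<in> poly_over C" using lc by (auto simp: t_def poly_over_def)
    have gC: "[:lead_coeff g:] \<in> poly_over C"
      using lc by (auto simp: pCons_poly_over)
    have f1C: "f1 \<in> poly_over C"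
      unfolding f1_def using t less.prems g gC by (intro P.diff_mem P.mult_mem)
    have dt: "degree ([:lead_coeff g:] * f) = degree f" "degree (g * t) = degree f"
      using fg lc g by (auto simp: t_def degree_mult_eq degree_monom_eq monom_eq_0_iff)
    have "coeff f1 (degree f) = 0"
    proof -
      have "lead_coeff (g * t) = lead_coeff g * lead_coeff f"
        using fg g by (simp add: lead_coeff_mult t_def degree_monom_eq)
      then show ?thesis using dt(2) by (simp add: f1_def)
    qed
    moreover have "degree f1 \<le> degree f"
      unfolding f1_def using dt by (intro degree_diff_le) auto
    ultimately consider "f1 = 0" | "degree f1 < degree f"
      by (metis leading_coeff_0_iff le_neq_implies_less)
    then show ?thesis
    proof cases
      case 1
      then have "[:lead_coeff g:] * f = g * t + 0" by (simp add: f1_def)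
      then show ?thesis using lc t by (intro bexI[of _ "lead_coeff g"] bexI[of _ t] bexI[of _ 0]) auto
    next
      case 2
      obtain a q r where a: "a \<in> C" "q \<in> poly_over C" "r \<in> poly_over C" "a \<noteq> 0"
          "[:a:] * f1 = g * q + r" "r = 0 \<or> degree r < degree g"
        using less.hyps[OF 2 f1C] by blast
      have "[:a * lead_coeff g:] * f = [:a:] * ([:lead_coeff g:] * f)" by (simp add: mult.commute)
      also have "\<dots> = [:a:] * f1 + g * ([:a:] * t)"
        unfolding f1_def by (simp add: algebra_simps smult_diff_right)
      also have "\<dots> = g * (q + [:a:] * t) + r" unfolding a(5) by (simp add: algebra_simps)
      finally have eq: "[:a * lead_coeff g:] * f = g * (q + [:a:] * t) + r" .
      have "[:a:] * t \<in> poly_over C"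
        using t a by (intro P.mult_mem) (auto simp: pCons_poly_over)
      then have "q + [:a:] * t \<in> poly_over C" using a(2) by (rule P.add_mem[rotated])
      then show ?thesis
        using eq a lc by (intro bexI[of _ "a * lead_coeff g"] bexI[of _ "q + [:a:] * t"] bexI[of _ r]) auto
    qed
  qed
qed

lemma lead_coeff_prod_list:
  "lead_coeff (prod_list fs :: 'a::idom poly) = prod_list (map lead_coeff fs)"
  by (induction fs) (simp_all add: lead_coeff_mult)

theorem ufd_mod_poly_over:
  fixes C :: "'a::idom set"
  assumes C: "unital_subring C" and ufd: "ufd_mod C {0}"
  shows "ufd_mod (poly_over C) {0}"
proof -
  interpret residue_domain_of C "{0}" by (rule residue_domain_of_zero[OF C])
  let ?h = "\<lambda>c::'a. [:c:]"
  interpret H: residue_iso C "{0}" ?h "?h ` C" "{0}"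
    by unfold_locales (auto simp: one_pCons)
  show ?thesis
  proof (rule ufd_mod_of_pseudo_division[of _ "?h ` C" degree])
    show "unital_subring (poly_over C)" by (rule unital_subring_poly_over)
    show "unital_subring (?h ` C)" by (rule H.unital_subring_image)
    show "?h ` C \<subseteq> poly_over C" by (auto simp: pCons_poly_over) (simp add: poly_over_def)
    show "ufd_mod (?h ` C) {0}" by (rule H.ufd_mod_image[OF ufd])
    show "prime_mod (poly_over C) {0} p" if p: "prime_mod (?h ` C) {0} p" for p
    proof -
      obtain c where c0: "c \<in> C" "p = [:c:]"
        using p by (auto simp: prime_mod_def)
      then have c: "c \<in> C" "p = [:c:]" "prime_mod C {0} c"
        using p H.prime_mod_image[of c] by simp_all
      have "prime_ideal_of (poly_over C) (poly_over (adjoin C {0} c))"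
        using c by (intro prime_ideal_of_poly_over[OF C]) (simp add: prime_mod_def)
      then show ?thesis
        using c adjoin_poly_over[OF c(1)] by (auto simp: prime_mod_def poly_over_zero pCons_poly_over)
          (simp_all add: poly_over_def)
    qed
    show "degree (f * g) = degree f + degree g" if "f \<noteq> 0" "g \<noteq> 0" for f g :: "'a poly"
      using that by (rule degree_mult_eq)
    show "f \<in> ?h ` C" if "f \<in> poly_over C" "degree f = 0" for f
      using that by (auto simp: poly_over_def elim!: degree_eq_zeroE) (metis coeff_pCons_0 imageI)
    show "degree f = 0" if "f \<in> ?h ` C" for f using that by auto
    show "\<exists>a\<in>?h ` C. \<exists>q\<in>poly_over C. \<exists>r\<in>poly_over C.
        a \<noteq> 0 \<and> a * f = g * q + r \<and> (r = 0 \<or> degree r < degree g)"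
      if fg: "f \<in> poly_over C" "g \<in> poly_over C" "g \<noteq> 0" for f g
    proof -
      obtain a q r where "a \<in> C" "q \<in> poly_over C" "r \<in> poly_over C" "a \<noteq> 0"
          "[:a:] * f = g * q + r" "r = 0 \<or> degree r < degree g"
        using pseudo_division_poly_over[OF C fg] by blast
      then show ?thesis
        by (intro bexI[of _ "[:a:]"] bexI[of _ q] bexI[of _ r]) (auto simp del: mult_pCons_left)
    qed
    show "\<exists>N. \<forall>rs. (\<forall>p\<in>set rs. prime_mod (?h ` C) {0} p) \<and>
        dvd_mod (poly_over C) {0} (prod_list rs) f \<longrightarrow> length rs \<le> N"
      if f: "f \<in> poly_over C" "f \<noteq> 0" for f
    proof -
      have "lead_coeff f \<in> C" "lead_coeff f \<notin> {0}" using f by (auto simp: poly_over_def)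
      then obtain qs where qs: "\<forall>p\<in>set qs. prime_mod C {0} p" "dvd_mod C {0} (lead_coeff f) (prod_list qs)"
        using ufd_mod_dvd_primes[OF ufd] by blast
      have "length rs \<le> length qs"
        if rs: "\<forall>p\<in>set rs. prime_mod (?h ` C) {0} p" "dvd_mod (poly_over C) {0} (prod_list rs) f" for rs
      proof -
        obtain g where g: "g \<in> poly_over C" "f = prod_list rs * g" using rs by (auto simp: dvd_mod_zero)
        have "lead_coeff f = prod_list (map lead_coeff rs) * lead_coeff g"
          by (simp add: g(2) lead_coeff_mult lead_coeff_prod_list)
        then have "dvd_mod C {0} (prod_list (map lead_coeff rs)) (lead_coeff f)"
          using g by (auto simp: dvd_mod_zero poly_over_def)
        then have "dvd_mod C {0} (prod_list (map lead_coeff rs)) (prod_list qs)"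
          using dvd_trans qs(2) by blast
        moreover have "prime_mod C {0} (lead_coeff p)" if "p \<in> set rs" for p
        proof -
          obtain c where "c \<in> C" "p = [:c:]" "prime_mod (?h ` C) {0} [:c:]"
            using rs(1) \<open>p \<in> set rs\<close> by (auto simp: prime_mod_def)
          then show ?thesis using H.prime_mod_image[of c] by simp
        qed
        ultimately show ?thesis
          using length_primes_le[of "map lead_coeff rs" qs] qs by simp
      qed
      then show ?thesis by blast
    qed
  qed
qed

section \<open>Polynomial rings in several variables\<close>

abbreviation polys :: "'v set \<Rightarrow> ('v, 'k::comm_ring_1) mpoly set" where
  "polys X \<equiv> carrier (mpoly_ring X)"

abbreviation monomial :: "('v \<Rightarrow>\<^sub>0 nat) \<Rightarrow> 'k::comm_ring_1 \<Rightarrow> ('v, 'k) mpoly" where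
  "monomial \<equiv> Poly_Mapping.single"

abbreviation keys :: "('a \<Rightarrow>\<^sub>0 'b::zero) \<Rightarrow> 'a set" where
  "keys \<equiv> Poly_Mapping.keys"

abbreviation lookup :: "('a \<Rightarrow>\<^sub>0 'b::zero) \<Rightarrow> 'a \<Rightarrow> 'b" where
  "lookup \<equiv> Poly_Mapping.lookup"

lemma unital_subring_polys: "unital_subring (polys X :: ('v, 'k::comm_ring_1) mpoly set)"
proof -
  have "a - b \<in> polys X" if "a \<in> polys X" "b \<in> polys X" for a b :: "('v, 'k) mpoly"
    using mpoly_ring_closed(3)[of a X "- b"] mpoly_ring_closed(5)[of b X] that by simp
  then show ?thesis by (auto simp: unital_subring_def mpoly_ring_closed)
qed

lemma polys_mono: "X \<subseteq> Y \<Longrightarrow> polys X \<subseteq> polys Y"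
  unfolding mem_mpoly_ring_iff subset_iff by blast

lemma lookup_outside_polys:
  assumes "p \<in> polys X" "y \<notin> X" "y \<in> keys m"
  shows "lookup p m = 0"
  using assms unfolding mem_mpoly_ring_iff by (metis in_keys_iff subsetD)

lemma monomial_mem_polys: "keys m \<subseteq> X \<Longrightarrow> monomial m c \<in> polys X"
  by (auto simp: mem_mpoly_ring_iff)

lemma sum_monomials: "(\<Sum>m\<in>keys p. monomial m (lookup p m)) = p"
  by (rule poly_mapping_eqI) (auto simp: lookup_sum lookup_single when_def in_keys_iff sum.delta)

lemma mvar_power: "mvar v ^ e = monomial (Poly_Mapping.single v e) (1::'k::comm_ring_1)"
  by (induction e) (simp_all add: mvar_def mult_single single_add[symmetric])

lemma polys_subsetI:
  fixes D :: "('v, 'k::comm_ring_1) mpoly set"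
  assumes const: "\<And>c. monomial 0 c \<in> D" and var: "\<And>v. v \<in> X \<Longrightarrow> mvar v \<in> D"
    and add: "\<And>p q. p \<in> D \<Longrightarrow> q \<in> D \<Longrightarrow> p + q \<in> D"
    and mult: "\<And>p q. p \<in> D \<Longrightarrow> q \<in> D \<Longrightarrow> p * q \<in> D"
  shows "polys X \<subseteq> D"
proof
  have pow: "mvar v ^ e \<in> D" if "v \<in> X" for v e
    using that var mult const[of 1] by (induction e) auto
  have mon: "monomial m c \<in> D" if "keys m \<subseteq> X" for m c
    using that
  proof (induction m rule: Poly_Mapping.update_induct)
    case const
    show ?case by (rule assms(1))
  next
    case (update m v e)
    have eq: "Poly_Mapping.update v e m = Poly_Mapping.single v e + m"
      using update by (intro poly_mapping_eqI) (auto simp: lookup_update lookup_add lookup_single in_keys_iff)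
    have "v \<in> X" "keys m \<subseteq> X"
      using update.prems update.hyps by (auto simp: keys_update split: if_splits)
    then have "mvar v ^ e * monomial m c \<in> D"
      using update pow mult by blast
    then show ?case by (simp add: eq mvar_power mult_single)
  qed
  fix p :: "('v, 'k) mpoly" assume p: "p \<in> polys X"
  have "(\<Sum>m\<in>M. monomial m (lookup p m)) \<in> D" if "finite M" "M \<subseteq> keys p" for M
    using that
  proof (induction M rule: finite_induct)
    case empty
    then show ?case using const[of 0] by simp
  next
    case (insert m M)
    then have "monomial m (lookup p m) \<in> D"
      using p by (intro mon) (auto simp: mem_mpoly_ring_iff)
    then show ?case using insert add by simp
  qed
  from this[of "keys p"] show "p \<in> D" by (simp add: sum_monomials)
qed

lemma lookup_monomial_mult:
  "lookup (monomial t c * p) (t + m) = c * lookup (p :: ('v, 'k::comm_ring_1) mpoly) m"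
  by (simp add: lookup_mult lookup_single when_mult)

lemma keys_monomial_mult:
  "keys (monomial t c * p) \<subseteq> (+) t ` keys (p :: ('v, 'k::comm_ring_1) mpoly)"
  using keys_mult[of "monomial t c" p] by (auto split: if_splits)

lemma lookup_poly_mvar:
  fixes q :: "('v, 'k::comm_ring_1) mpoly poly"
  assumes "q \<in> poly_over (polys X)" "y \<notin> X" "y \<notin> keys m"
  shows "lookup (poly q (mvar y)) (m + Poly_Mapping.single y e) = lookup (coeff q e) m"
  using assms(1)
proof (induction q arbitrary: e)
  case (pCons a q)
  have aq: "a \<in> polys X" "q \<in> poly_over (polys X)"
    using pCons.prems by (force simp: poly_over_def coeff_pCons split: nat.splits)+
  have a: "lookup a (m + Poly_Mapping.single y e) = (if e = 0 then lookup a m else 0)"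
  proof -
    have "y \<in> keys (m + Poly_Mapping.single y e)" if "e \<noteq> 0"
      using that by (simp add: in_keys_iff lookup_add)
    then show ?thesis using lookup_outside_polys[OF aq(1) assms(2)] by auto
  qed
  have "lookup (mvar y * poly q (mvar y)) (m + Poly_Mapping.single y e) =
      (case e of 0 \<Rightarrow> 0 | Suc e' \<Rightarrow> lookup (coeff q e') m)"
  proof (cases e)
    case 0
    have "m \<notin> (+) (Poly_Mapping.single y 1) ` keys (poly q (mvar y))"
      using assms(3) by (auto simp: in_keys_iff lookup_add)
    then show ?thesis
      using keys_monomial_mult[of "Poly_Mapping.single y 1" 1 "poly q (mvar y)"] 0
      by (auto simp: mvar_def in_keys_iff)
  next
    case (Suc e')
    have "m + Poly_Mapping.single y e = Poly_Mapping.single y 1 + (m + Poly_Mapping.single y e')"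
      by (simp add: Suc single_add[symmetric] ac_simps flip: add.assoc)
    then show ?thesis
      using lookup_monomial_mult[of "Poly_Mapping.single y 1" 1 "poly q (mvar y)" "m + Poly_Mapping.single y e'"]
        pCons.IH[OF aq(2), of e'] by (simp add: mvar_def Suc)
  qed
  then show ?case
    by (simp add: lookup_add a coeff_pCons split: nat.splits)
qed simp

lemma poly_mvar_injective:
  assumes q: "q \<in> poly_over (polys X)" "y \<notin> X" "poly q (mvar y) = 0"
  shows "q = 0"
proof -
  have "coeff q e = 0" for e
  proof (rule poly_mapping_eqI)
    fix m
    show "lookup (coeff q e) m = lookup 0 m"
    proof (cases "y \<in> keys m")
      case True
      have "coeff q e \<in> polys X" using q(1) by (simp add: poly_over_def)
      then show ?thesis using lookup_outside_polys[OF _ q(2) True] by simp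
    next
      case False
      then show ?thesis using lookup_poly_mvar[OF q(1,2) False, of e] q(3) by simp
    qed
  qed
  then show ?thesis by (simp add: poly_eq_iff)
qed

text \<open>Evaluation at the variable \<open>y\<close> identifies univariate polynomials over \<open>polys X\<close> with
\<open>polys (insert y X)\<close>. Each element of the extended ideal is the value of a polynomial with coefficients in
\<open>I\<close>, and evaluation is injective; so the polynomials with value in the extended ideal are those over \<open>I\<close>.\<close>

lemma residue_iso_extend_variable:
  fixes X :: "'v set" and I :: "('v, 'k::comm_ring_1) mpoly set"
  assumes y: "y \<notin> X" and I: "ideal_of (polys X) I"
  shows "residue_iso (poly_over (polys X)) (poly_over I) (\<lambda>q. poly q (mvar y))
    (polys (insert y X)) (ideal_gen (polys (insert y X)) I)"
proof -
  let ?h = "\<lambda>q::('v, 'k) mpoly poly. poly q (mvar y)" and ?P = "polys (insert y X) :: ('v, 'k) mpoly set"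
  interpret X: residue_ring_of "polys X" I
    using I unital_subring_polys by (simp add: residue_ring_of_def)
  interpret PX: residue_ring_of "poly_over (polys X)" "poly_over I"
    using X.unital_subring_poly_over X.ideal_of_poly_over by (simp add: residue_ring_of_def)
  have XP: "polys X \<subseteq> ?P" by (intro polys_mono) auto
  have IP: "ideal_of ?P (ideal_gen ?P I)"
    using XP X.ideal_sub by (intro ideal_of_ideal_gen unital_subring_polys) auto
  interpret P: residue_ring_of ?P "ideal_gen ?P I"
    using IP unital_subring_polys by (simp add: residue_ring_of_def)
  have y': "mvar y \<in> ?P" by (rule mvar_mem_mpoly_ring) simp
  have surj: "?h ` poly_over (polys X) = ?P"
  proof
    show "?h ` poly_over (polys X) \<subseteq> ?P"
    proof safe
      fix q :: "('v, 'k) mpoly poly" assume "q \<in> poly_over (polys X)"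
      then show "?h q \<in> ?P"
        by (induction q) (use XP y' in \<open>auto simp: X.pCons_poly_over intro!: P.add_mem P.mult_mem simp del: mpoly_ring_simps\<close>)
    qed
    show "?P \<subseteq> ?h ` poly_over (polys X)"
    proof (rule polys_subsetI)
      show "monomial 0 c \<in> ?h ` poly_over (polys X)" for c
        by (rule image_eqI[of _ _ "[:monomial 0 c:]"])
          (auto simp: X.pCons_poly_over intro!: monomial_mem_polys PX.zero_mem)
      show "mvar v \<in> ?h ` poly_over (polys X)" if "v \<in> insert y X" for v
      proof (cases "v = y")
        case True
        then show ?thesis
          by (intro image_eqI[of _ _ "[:0, 1:]"]) (auto simp: X.pCons_poly_over intro!: PX.zero_mem)
      next
        case False
        then show ?thesis using that
          by (intro image_eqI[of _ _ "[:mvar v:]"])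
            (auto simp: X.pCons_poly_over intro!: PX.zero_mem mvar_mem_mpoly_ring)
      qed
      show "p + q \<in> ?h ` poly_over (polys X)" "p * q \<in> ?h ` poly_over (polys X)"
        if pq: "p \<in> ?h ` poly_over (polys X)" "q \<in> ?h ` poly_over (polys X)" for p q
      proof -
        obtain p' q' where "p' \<in> poly_over (polys X)" "q' \<in> poly_over (polys X)" "p = ?h p'" "q = ?h q'"
          using pq by blast
        then show "p + q \<in> ?h ` poly_over (polys X)" "p * q \<in> ?h ` poly_over (polys X)"
          using image_eqI[of "p + q" ?h "p' + q'"] image_eqI[of "p * q" ?h "p' * q'"] by auto
      qed
    qed
  qed
  have gen: "ideal_gen ?P I \<subseteq> ?h ` poly_over I"
  proof (rule ideal_gen_least)
    show "ideal_of ?P (?h ` poly_over I)"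
      unfolding ideal_of_def
    proof (intro conjI ballI)
      have "?h ` poly_over I \<subseteq> ?h ` poly_over (polys X)"
        using PX.ideal_sub by blast
      then show "?h ` poly_over I \<subseteq> ?P" using surj by simp
      show "0 \<in> ?h ` poly_over I" by (rule image_eqI[of _ _ 0]) auto
      show "a + b \<in> ?h ` poly_over I" if ab: "a \<in> ?h ` poly_over I" "b \<in> ?h ` poly_over I" for a b
      proof -
        obtain p q where "p \<in> poly_over I" "q \<in> poly_over I" "a = ?h p" "b = ?h q" using ab by blast
        then show ?thesis using PX.ideal_add by (intro image_eqI[of _ _ "p + q"]) auto
      qed
      show "c * a \<in> ?h ` poly_over I" if ca: "c \<in> ?P" "a \<in> ?h ` poly_over I" for a c
      proof -
        obtain p where "p \<in> poly_over I" "a = ?h p" using ca by blast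
        moreover obtain q where "q \<in> poly_over (polys X)" "c = ?h q"
          using ca(1) unfolding surj[symmetric] by blast
        ultimately show ?thesis using PX.ideal_mult by (intro image_eqI[of _ _ "q * p"]) auto
      qed
    qed
    show "I \<subseteq> ?h ` poly_over I"
    proof
      fix a assume "a \<in> I"
      then show "a \<in> ?h ` poly_over I"
        by (intro image_eqI[of _ _ "[:a:]"]) (auto simp: X.pCons_poly_over)
    qed
  qed
  have gen': "?h q \<in> ideal_gen ?P I" if "q \<in> poly_over I" for q
    using that
  proof (induction q)
    case (pCons a q)
    then have "a \<in> I" "?h q \<in> ideal_gen ?P I" by (auto simp: X.pCons_poly_over)
    then have "a + mvar y * ?h q \<in> ideal_gen ?P I"
      using y' by (intro P.ideal_add[OF ideal_gen_mem[OF P.one_mem]] P.ideal_mult)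
    then show ?case by simp
  qed simp
  show ?thesis
  proof unfold_locales
    show "ideal_gen ?P I \<subseteq> ?P" using P.ideal_sub by blast
    show "?h q \<in> ideal_gen ?P I \<longleftrightarrow> q \<in> poly_over I" if q: "q \<in> poly_over (polys X)" for q
    proof
      assume "?h q \<in> ideal_gen ?P I"
      then obtain q' where q': "q' \<in> poly_over I" "?h q = ?h q'" using gen by blast
      then have "q - q' = 0"
        using q PX.ideal_sub[OF q'(1)] by (intro poly_mvar_injective[OF _ y]) auto
      then show "q \<in> poly_over I" using q' by simp
    qed (rule gen')
  qed (use surj in auto)
qed

lemma prime_ideal_of_extend_variables:
  fixes X :: "'v set" and I :: "('v, 'k::comm_ring_1) mpoly set"
  assumes "finite Y" and I: "prime_ideal_of (polys X) I"
  shows "prime_ideal_of (polys (X \<union> Y)) (ideal_gen (polys (X \<union> Y)) I)"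
  using assms(1)
proof induction
  case empty
  then show ?case
    using I ideal_gen_ideal[of "polys X" I] by (simp add: prime_ideal_of_def mpoly_ring_closed)
next
  case (insert y Y)
  have IX: "I \<subseteq> polys X" using I by (auto simp: prime_ideal_of_def ideal_of_def)
  show ?case
  proof (cases "y \<in> X \<union> Y")
    case True
    then show ?thesis using insert by (simp add: insert_absorb)
  next
    case False
    let ?J = "ideal_gen (polys (X \<union> Y)) I"
    interpret residue_iso "poly_over (polys (X \<union> Y))" "poly_over ?J" "\<lambda>q. poly q (mvar y)"
      "polys (insert y (X \<union> Y))" "ideal_gen (polys (insert y (X \<union> Y))) ?J"
      using insert.IH False by (intro residue_iso_extend_variable) (auto simp: prime_ideal_of_def)
    have "ideal_gen (polys (insert y (X \<union> Y))) ?J = ideal_gen (polys (insert y (X \<union> Y))) I"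
      using IX polys_mono[of X "insert y (X \<union> Y)"]
      by (intro ideal_gen_ideal_gen unital_subring_polys polys_mono) (auto simp: mpoly_ring_closed)
    then show ?thesis
      using prime_ideal_image[OF prime_ideal_of_poly_over[OF unital_subring_polys insert.IH]] by simp
  qed
qed

theorem ufd_mod_polys:
  fixes X :: "'v::linorder set"
  assumes "finite X"
  shows "ufd_mod (polys X :: ('v, 'k::field) mpoly set) {0}"
  using assms
proof induction
  case empty
  interpret residue_domain_of "polys {} :: ('v, 'k) mpoly set" "{0}"
    by (rule residue_domain_of_zero[OF unital_subring_polys])
  show ?case
  proof (rule ufd_modI)
    fix a :: "('v, 'k) mpoly" assume a: "a \<in> polys {}" "a \<notin> {0}"
    have "keys a \<subseteq> {0}" using a by (auto simp: mem_mpoly_ring_iff)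
    then have eq: "a = monomial 0 (lookup a 0)"
      by (intro poly_mapping_eqI) (auto simp: lookup_single in_keys_iff when_def)
    then have nz: "lookup a 0 \<noteq> 0" using a by (metis single_zero singletonI)
    have "a * monomial 0 (1 / lookup a 0) = monomial 0 (lookup a 0) * monomial 0 (1 / lookup a 0)"
      using eq by simp
    also have "\<dots> = 1" using nz by (simp add: mult_single)
    finally have "dvd_mod (polys {}) {0} a 1"
      by (auto simp: dvd_mod_zero intro!: bexI[of _ "monomial 0 (1 / lookup a 0)"] monomial_mem_polys)
    then show "\<exists>ps. (\<forall>p\<in>set ps. prime_mod (polys {}) {0} p) \<and> dvd_mod (polys {}) {0} a (prod_list ps)"
      by (intro exI[of _ "[]"]) simp
  qed
next
  case (insert y X)
  have zero: "ideal_gen (polys (insert y X)) {0} = {0 :: ('v, 'k) mpoly}"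
    by (intro ideal_gen_ideal) (auto simp: ideal_of_def mpoly_ring_closed)
  interpret residue_iso "poly_over (polys X :: ('v, 'k) mpoly set)" "poly_over {0}" "\<lambda>q. poly q (mvar y)"
      "polys (insert y X)" "ideal_gen (polys (insert y X)) {0}"
    using insert by (intro residue_iso_extend_variable) (auto simp: ideal_of_def mpoly_ring_closed)
  show ?case
    using ufd_mod_image ufd_mod_poly_over[OF unital_subring_polys insert.IH]
    by (simp add: zero poly_over_zero)
qed

section \<open>Elimination of variables after a localization\<close>

definition eval_monomial :: "('v \<Rightarrow> 'a::comm_ring_1) \<Rightarrow> ('v \<Rightarrow>\<^sub>0 nat) \<Rightarrow> 'a" where
  "eval_monomial g m = (\<Prod>v\<in>keys m. g v ^ lookup m v)"

definition eval_mpoly :: "('k \<Rightarrow> 'a) \<Rightarrow> ('v \<Rightarrow> 'a) \<Rightarrow> ('v, 'k::comm_ring_1) mpoly \<Rightarrow> 'a::comm_ring_1" where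
  "eval_mpoly c g p = (\<Sum>m\<in>keys p. c (lookup p m) * eval_monomial g m)"

lemma eval_monomial_superset:
  "finite S \<Longrightarrow> keys m \<subseteq> S \<Longrightarrow> eval_monomial g m = (\<Prod>v\<in>S. g v ^ lookup m v)"
  unfolding eval_monomial_def by (rule prod.mono_neutral_left) (auto simp: in_keys_iff)

lemma eval_monomial_add: "eval_monomial g (m + m') = eval_monomial g m * eval_monomial g m'"
proof -
  let ?S = "keys m \<union> keys m'"
  have "keys (m + m') \<subseteq> ?S" by (rule Poly_Mapping.keys_add)
  then show ?thesis
    using eval_monomial_superset[of ?S "m + m'" g] eval_monomial_superset[of ?S m g]
      eval_monomial_superset[of ?S m' g]
    by (simp add: lookup_add power_add prod.distrib)
qed

locale coefficient_hom =
  fixes c :: "'k::comm_ring_1 \<Rightarrow> 'a::comm_ring_1"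
  assumes zero: "c 0 = 0" and one: "c 1 = 1"
    and add: "c (x + y) = c x + c y" and mult: "c (x * y) = c x * c y"
begin

lemma eval_superset:
  assumes "finite S" "keys p \<subseteq> S"
  shows "eval_mpoly c g p = (\<Sum>m\<in>S. c (lookup p m) * eval_monomial g m)"
  unfolding eval_mpoly_def using assms by (intro sum.mono_neutral_left) (auto simp: in_keys_iff zero)

lemma eval_add: "eval_mpoly c g (p + q) = eval_mpoly c g p + eval_mpoly c g q"
proof -
  let ?S = "keys p \<union> keys q"
  have "keys (p + q) \<subseteq> ?S" by (rule Poly_Mapping.keys_add)
  then show ?thesis
    using eval_superset[of ?S "p + q" g] eval_superset[of ?S p g] eval_superset[of ?S q g]
    by (simp add: lookup_add add distrib_right sum.distrib)
qed

lemma eval_zero: "eval_mpoly c g 0 = 0"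
  by (simp add: eval_mpoly_def)

lemma eval_sum: "eval_mpoly c g (sum f K) = (\<Sum>i\<in>K. eval_mpoly c g (f i))"
  by (induction K rule: infinite_finite_induct) (simp_all add: eval_zero eval_add)

lemma eval_single: "eval_mpoly c g (monomial m x) = c x * eval_monomial g m"
  by (simp add: eval_mpoly_def zero)

lemma eval_const: "eval_mpoly c g (monomial 0 x) = c x"
  by (simp add: eval_single eval_monomial_def)

lemma eval_mvar: "eval_mpoly c g (mvar v) = g v"
  by (simp add: mvar_def eval_single one eval_monomial_def)

lemma eval_mult: "eval_mpoly c g (p * q) = eval_mpoly c g p * eval_mpoly c g q"
proof -
  let ?f = "\<lambda>p m. monomial m (lookup p m)"
  have "p * q = (\<Sum>m\<in>keys p. ?f p m) * (\<Sum>m\<in>keys q. ?f q m)"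
    by (simp add: sum_monomials)
  also have "\<dots> = (\<Sum>m\<in>keys p. \<Sum>m'\<in>keys q. ?f p m * ?f q m')"
    by (rule sum_product)
  finally have "eval_mpoly c g (p * q) =
      (\<Sum>m\<in>keys p. \<Sum>m'\<in>keys q. eval_mpoly c g (?f p m * ?f q m'))"
    by (simp add: eval_sum)
  also have "\<dots> = eval_mpoly c g p * eval_mpoly c g q"
    unfolding eval_mpoly_def[of c g p] eval_mpoly_def[of c g q] sum_product
    by (intro sum.cong refl) (simp add: mult_single eval_single eval_monomial_add mult ac_simps)
  finally show ?thesis .
qed

end

text \<open>The substitution that fixes the variables in \<open>X\<close> and replaces every other variable \<open>v\<close> by the fraction
\<open>N v / D\<close>.\<close>

abbreviation fract_eval :: "'v set \<Rightarrow> ('v::linorder \<Rightarrow> ('v, 'k::field) mpoly) \<Rightarrow> ('v, 'k) mpoly \<Rightarrow>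
    ('v, 'k) mpoly \<Rightarrow> ('v, 'k) mpoly fract" where
  "fract_eval X N D \<equiv> eval_mpoly (\<lambda>c. to_fract (monomial 0 c))
     (\<lambda>v. if v \<in> X then to_fract (mvar v) else to_fract (N v) / to_fract D)"

lemma coefficient_hom_fract:
  "coefficient_hom (\<lambda>c::'k::field. to_fract (monomial 0 c :: ('v::linorder, 'k) mpoly))"
  by unfold_locales (auto simp: single_add mult_single simp flip: to_fract_add to_fract_mult)

lemma fract_eval_fixes:
  fixes N :: "'v::linorder \<Rightarrow> ('v, 'k::field) mpoly"
  assumes "a \<in> polys XA"
  shows "fract_eval XA N D a = to_fract a"
proof -
  interpret E: coefficient_hom "\<lambda>c::'k. to_fract (monomial 0 c :: ('v, 'k) mpoly)"
    by (rule coefficient_hom_fract)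
  have "polys XA \<subseteq> {a. fract_eval XA N D a = to_fract a}"
    by (rule polys_subsetI) (auto simp: E.eval_const E.eval_mvar E.eval_add E.eval_mult)
  then show ?thesis using assms by blast
qed

text \<open>The ideal \<open>L\<close> arises from the prime ideal \<open>\<pp>\<close> of a smaller polynomial ring by adding the relations
\<open>Ls\<close>, which allow one to solve for the additional variables as \<open>v = N v / D\<close>. After inverting \<open>D\<close>, the
ring modulo \<open>L\<close> is therefore the smaller ring modulo \<open>\<pp>\<close>, a domain. If \<open>D\<close> is regular modulo \<open>L\<close>,
nothing is lost by inverting \<open>D\<close>, so \<open>L\<close> is prime and lies over \<open>\<pp>\<close>. The substitution into the
fraction field shows that \<open>L\<close> imposes no relation beyond \<open>\<pp>\<close> on the smaller ring: it kills \<open>Ls\<close>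
and fixes \<open>\<pp>\<close>, so it maps \<open>L\<close> into the extension of \<open>\<pp>\<close>, up to powers of \<open>D\<close>.\<close>

theorem prime_ideal_by_elimination:
  fixes XA X :: "'v::linorder set" and \<pp> L Ls :: "('v, 'k::field) mpoly set"
  assumes XA: "XA \<subseteq> X" and \<pp>: "prime_ideal_of (polys XA) \<pp>" and D: "D \<in> polys XA" "D \<notin> \<pp>"
    and N: "\<And>v. v \<in> X - XA \<Longrightarrow> N v \<in> polys XA"
    and Ls: "Ls \<subseteq> polys X" and L: "L = ideal_gen (polys X) (\<pp> \<union> Ls)"
    and elim: "\<And>v. v \<in> X - XA \<Longrightarrow> D * mvar v - N v \<in> L"
    and solves: "\<And>l. l \<in> Ls \<Longrightarrow> fract_eval XA N D l = 0"
    and regular: "\<And>x. x \<in> polys X \<Longrightarrow> D * x \<in> L \<Longrightarrow> x \<in> L"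
  shows "prime_ideal_of (polys X) L" and "L \<inter> polys XA = \<pp>"
    and "x \<in> polys X \<Longrightarrow> \<exists>m. \<exists>a\<in>polys XA. D ^ m * x - a \<in> L"
proof -
  let ?\<phi> = "fract_eval XA N D"
  interpret E: coefficient_hom "\<lambda>c::'k. to_fract (monomial 0 c :: ('v, 'k) mpoly)"
    by (rule coefficient_hom_fract)
  interpret A: residue_domain_of "polys XA" \<pp>
    by (rule residue_domain_ofI[OF unital_subring_polys \<pp>])
  have AX: "a \<in> polys X" if "a \<in> polys XA" for a :: "('v, 'k) mpoly"
    using polys_mono[OF XA] that by blast
  have pX: "\<pp> \<union> Ls \<subseteq> polys X" using Ls A.ideal_sub AX by blast
  interpret B: residue_ring_of "polys X" L
    using ideal_of_ideal_gen[OF unital_subring_polys pX] unital_subring_polys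
    by (simp add: residue_ring_of_def L)
  have pL: "a \<in> L" if "a \<in> \<pp>" for a
    using that by (simp add: L ideal_gen_mem)
  have DX: "D \<in> polys X" using AX D by blast
  have D0: "D \<noteq> 0" using D(2) A.ideal_zero by metis
  have fix_A: "?\<phi> a = to_fract a" if "a \<in> polys XA" for a
    using that by (rule fract_eval_fixes)
  let ?S = "{b. \<exists>m. \<exists>a\<in>polys XA. to_fract (D ^ m) * ?\<phi> b = to_fract a}"
  have clear: "\<exists>m. \<exists>a\<in>polys XA. to_fract (D ^ m) * ?\<phi> b = to_fract a" if "b \<in> polys X" for b
  proof -
    have "polys X \<subseteq> ?S"
    proof (rule polys_subsetI)
      show "monomial 0 k \<in> ?S" for k
        by (auto simp: E.eval_const intro!: exI[of _ 0] bexI[of _ "monomial 0 k"] monomial_mem_polys)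
      show "mvar v \<in> ?S" if v: "v \<in> X" for v
      proof (cases "v \<in> XA")
        case True
        then show ?thesis
          by (auto simp: E.eval_mvar intro!: exI[of _ 0] bexI[of _ "mvar v"] mvar_mem_mpoly_ring)
      next
        case False
        then show ?thesis
          using v N[of v] D0 by (auto simp: E.eval_mvar intro!: exI[of _ 1] bexI[of _ "N v"])
      qed
      fix p q assume "p \<in> ?S"
        "q \<in> ?S"
      then obtain m a n b where ab: "a \<in> polys XA" "b \<in> polys XA"
        "to_fract (D ^ m) * ?\<phi> p = to_fract a" "to_fract (D ^ n) * ?\<phi> q = to_fract b"
        by auto
      have "to_fract (D ^ (m + n)) * ?\<phi> (p * q) = (to_fract (D ^ m) * ?\<phi> p) * (to_fract (D ^ n) * ?\<phi> q)"
        by (simp add: E.eval_mult power_add ac_simps to_fract_mult)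
      also have "\<dots> = to_fract (a * b)" by (simp add: ab to_fract_mult)
      finally show "p * q \<in> ?S"
        using A.mult_mem[OF ab(1,2)] by blast
      have "to_fract (D ^ (m + n)) * ?\<phi> (p + q) =
          to_fract (D ^ n) * (to_fract (D ^ m) * ?\<phi> p) + to_fract (D ^ m) * (to_fract (D ^ n) * ?\<phi> q)"
        by (simp add: E.eval_add power_add algebra_simps to_fract_mult)
      also have "\<dots> = to_fract (D ^ n * a + D ^ m * b)" by (simp add: ab to_fract_mult to_fract_add)
      finally show "p + q \<in> ?S"
        using ab D by (auto intro!: bexI[of _ "D ^ n * a + D ^ m * b"])
    qed
    then show ?thesis using that by blast
  qed
  \<comment> \<open>The contraction along the substitution of the extension of \<open>\<pp>\<close> to the localization at \<open>D\<close>.\<close>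
  define Q where "Q = {b \<in> polys X. \<exists>m. \<exists>a\<in>\<pp>. to_fract (D ^ m) * ?\<phi> b = to_fract a}"
  have "ideal_of (polys X) Q"
    unfolding ideal_of_def
  proof (intro conjI ballI)
    show "Q \<subseteq> polys X" by (auto simp: Q_def)
    show "0 \<in> Q" by (auto simp: Q_def E.eval_zero intro!: bexI[of _ 0])
    fix p assume "p \<in> Q"
    then obtain m a where a: "p \<in> polys X" "a \<in> \<pp>" "to_fract (D ^ m) * ?\<phi> p = to_fract a"
      by (auto simp: Q_def)
    show "p + q \<in> Q" if q: "q \<in> Q" for q
    proof -
      obtain n b where b: "q \<in> polys X" "b \<in> \<pp>" "to_fract (D ^ n) * ?\<phi> q = to_fract b"
        using q by (auto simp: Q_def)
      have "to_fract (D ^ (m + n)) * ?\<phi> (p + q) =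
          to_fract (D ^ n) * (to_fract (D ^ m) * ?\<phi> p) + to_fract (D ^ m) * (to_fract (D ^ n) * ?\<phi> q)"
        by (simp add: E.eval_add power_add algebra_simps to_fract_mult)
      also have "\<dots> = to_fract (D ^ n * a + D ^ m * b)" by (simp add: a b to_fract_mult to_fract_add)
      finally have "to_fract (D ^ (m + n)) * ?\<phi> (p + q) = to_fract (D ^ n * a + D ^ m * b)" .
      moreover have "D ^ n * a + D ^ m * b \<in> \<pp>"
        using a b D by (intro A.ideal_add A.ideal_mult A.power_mem)
      ultimately show ?thesis using B.add_mem[OF a(1) b(1)] unfolding Q_def by blast
    qed
    show "r * p \<in> Q" if r: "r \<in> polys X" for r
    proof -
      obtain n b where b: "b \<in> polys XA" "to_fract (D ^ n) * ?\<phi> r = to_fract b"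
        using clear[OF r] by blast
      have "to_fract (D ^ (n + m)) * ?\<phi> (r * p) = (to_fract (D ^ n) * ?\<phi> r) * (to_fract (D ^ m) * ?\<phi> p)"
        by (simp add: E.eval_mult power_add ac_simps to_fract_mult)
      also have "\<dots> = to_fract (b * a)" by (simp add: a b to_fract_mult)
      finally show ?thesis
        using A.ideal_mult[OF b(1) a(2)] B.mult_mem[OF r a(1)] unfolding Q_def by blast
    qed
  qed
  moreover have "\<pp> \<union> Ls \<subseteq> Q"
  proof -
    have "p \<in> Q" if "p \<in> \<pp>" for p
      using that A.ideal_sub[OF that] AX[OF A.ideal_sub[OF that]]
      by (auto simp: Q_def fix_A intro!: exI[of _ 0])
    moreover have "l \<in> Q" if "l \<in> Ls" for l
      using that Ls by (auto simp: Q_def solves intro!: bexI[of _ 0])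
    ultimately show ?thesis by blast
  qed
  ultimately have LQ: "L \<subseteq> Q" unfolding L by (rule ideal_gen_least)
  show contract: "L \<inter> polys XA = \<pp>"
  proof (intro subset_antisym subsetI)
    fix b assume b: "b \<in> L \<inter> polys XA"
    then obtain m a where "a \<in> \<pp>" "to_fract (D ^ m) * ?\<phi> b = to_fract a"
      using LQ by (auto simp: Q_def)
    then have "D ^ m * b \<in> \<pp>"
      using b by (simp add: fix_A flip: to_fract_mult)
    then show "b \<in> \<pp>"
      using A.cancel[of "D ^ m" b] A.power_not_mem[OF D] D b by auto
  qed (use pL A.ideal_sub in blast)
  let ?T = "{x \<in> polys X. \<exists>m. \<exists>a\<in>polys XA. D ^ m * x - a \<in> L}"
  show loc: "\<exists>m. \<exists>a\<in>polys XA. D ^ m * x - a \<in> L" if "x \<in> polys X" for x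
  proof -
    have "polys X \<subseteq> ?T"
    proof (rule polys_subsetI)
      show "monomial 0 k \<in> ?T" for k
        by (auto intro!: exI[of _ 0] bexI[of _ "monomial 0 k"] monomial_mem_polys)
      show "mvar v \<in> ?T" if v: "v \<in> X" for v
      proof (cases "v \<in> XA")
        case True
        then show ?thesis
          using v by (auto intro!: exI[of _ 0] bexI[of _ "mvar v"] mvar_mem_mpoly_ring)
      next
        case False
        then show ?thesis
          using v N[of v] elim[of v] by (auto intro!: exI[of _ 1] bexI[of _ "N v"] mvar_mem_mpoly_ring)
      qed
      fix p q assume "p \<in> ?T"
        "q \<in> ?T"
      then obtain m a n b where ab: "p \<in> polys X" "q \<in> polys X" "a \<in> polys XA" "b \<in> polys XA"
        "D ^ m * p - a \<in> L" "D ^ n * q - b \<in> L"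
        by auto
      have "D ^ (m + n) * (p * q) - a * b \<in> L"
        using ab AX DX by - (rule B.ideal_lin[OF ab(5,6), of "D ^ n * q" a];
          auto simp: algebra_simps power_add)
      then show "p * q \<in> ?T"
        using A.mult_mem[OF ab(3,4)] B.mult_mem[OF ab(1,2)] by blast
      have "D ^ (m + n) * (p + q) - (D ^ n * a + D ^ m * b) \<in> L"
        using ab AX DX by - (rule B.ideal_lin[OF ab(5,6), of "D ^ n" "D ^ m"];
          auto simp: algebra_simps power_add)
      moreover have "D ^ n * a + D ^ m * b \<in> polys XA" using ab D by auto
      ultimately show "p + q \<in> ?T"
        using B.add_mem[OF ab(1,2)] by blast
    qed
    then show ?thesis using that by blast
  qed
  have regular_power: "x \<in> L" if "x \<in> polys X" "D ^ m * x \<in> L" for x m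
    using that
  proof (induction m)
    case (Suc m)
    have "D * (D ^ m * x) \<in> L" using Suc.prems by (simp add: ac_simps)
    then have "D ^ m * x \<in> L" using Suc.prems DX by - (rule regular; auto)
    then show ?case using Suc by blast
  qed simp
  show "prime_ideal_of (polys X) L"
    unfolding prime_ideal_of_def
  proof (intro conjI ballI impI)
    show "ideal_of (polys X) L" by (rule B.ideal)
    have "1 \<notin> L \<inter> polys XA" unfolding contract by (rule A.one_not_mem)
    then show "1 \<notin> L" by simp
    fix x y assume xy: "x \<in> polys X" "y \<in> polys X" "x * y \<in> L"
    obtain m a where a: "a \<in> polys XA" "D ^ m * x - a \<in> L" using loc[OF xy(1)] by blast
    obtain n b where b: "b \<in> polys XA" "D ^ n * y - b \<in> L" using loc[OF xy(2)] by blast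
    have "D ^ (m + n) * (x * y) - a * b \<in> L"
      using a b xy AX DX by - (rule B.ideal_lin[OF a(2) b(2), of "D ^ n * y" a];
          auto simp: algebra_simps power_add)
    moreover have "D ^ (m + n) * (x * y) \<in> L" 
      using B.ideal_mult[OF B.power_mem[OF DX] xy(3)] .
    ultimately have "a * b \<in> L" by (rule B.ideal_cong')
    then have "a * b \<in> \<pp>" using a b contract A.mult_mem by blast
    then consider "a \<in> \<pp>" | "b \<in> \<pp>" using A.mult_memD a b by blast
    then show "x \<in> L \<or> y \<in> L"
    proof cases
      case 1
      then have "D ^ m * x \<in> L" using B.ideal_cong[OF a(2) pL] by blast
      then show ?thesis using regular_power xy by blast
    next
      case 2
      then have "D ^ n * y \<in> L" using B.ideal_cong[OF b(2) pL] by blast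
      then show ?thesis using regular_power xy by blast
    qed
  qed
qed

section \<open>Regular sequences from coprime initial monomials\<close>

definition constant_monomial :: "'v set \<Rightarrow> nat \<Rightarrow> 'v \<Rightarrow>\<^sub>0 nat" where
  "constant_monomial U e = (\<Sum>v\<in>U. Poly_Mapping.single v e)"

lemma lookup_constant_monomial:
  "finite U \<Longrightarrow> lookup (constant_monomial U e) v = (if v \<in> U then e else 0)"
  by (simp add: constant_monomial_def lookup_sum lookup_single when_def)

lemma keys_constant_monomial: "finite U \<Longrightarrow> e > 0 \<Longrightarrow> keys (constant_monomial U e) = U"
  by (auto simp: in_keys_iff lookup_constant_monomial split: if_splits)

locale weighted_monomials =
  fixes X :: "'v set" and \<omega> :: "'v \<Rightarrow> real"
  assumes finite_X: "finite X"
begin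

definition total_degree :: "('v \<Rightarrow>\<^sub>0 nat) \<Rightarrow> nat" where
  "total_degree m = (\<Sum>v\<in>X. lookup m v)"

definition weight :: "('v \<Rightarrow>\<^sub>0 nat) \<Rightarrow> real" where
  "weight m = (\<Sum>v\<in>X. real (lookup m v) * \<omega> v)"

text \<open>Weights are arbitrary real numbers and do not give a well-order. Comparing only monomials of the same
total degree leaves finitely many candidates below a given monomial, which restores induction.\<close>

definition lower :: "('v \<Rightarrow>\<^sub>0 nat) \<Rightarrow> ('v, 'k::comm_ring_1) mpoly set" where
  "lower m = {q \<in> polys X. \<forall>m'\<in>keys q. total_degree m' = total_degree m \<and> weight m' < weight m}"

definition leads :: "('v \<Rightarrow>\<^sub>0 nat) \<Rightarrow> ('v, 'k::comm_ring_1) mpoly \<Rightarrow> bool" where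
  "leads m p \<longleftrightarrow> keys m \<subseteq> X \<and> p - monomial m 1 \<in> lower m"

lemma total_degree_add: "total_degree (m + m') = total_degree m + total_degree m'"
  by (simp add: total_degree_def lookup_add sum.distrib)

lemma weight_add: "weight (m + m') = weight m + weight m'"
  by (simp add: weight_def lookup_add distrib_right sum.distrib)

lemma lower_add: "p \<in> lower m \<Longrightarrow> q \<in> lower m \<Longrightarrow> p + q \<in> lower m"
  using Poly_Mapping.keys_add[of p q] mpoly_ring_closed(3)[of p X q] by (fastforce simp: lower_def)

lemma lower_mult:
  assumes "p \<in> lower m" "q \<in> lower m'"
  shows "p * q \<in> lower (m + m')"
proof -
  have "\<forall>t\<in>keys (p * q). \<exists>a\<in>keys p. \<exists>b\<in>keys q. t = a + b"
    using keys_mult[of p q] by blast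
  then show ?thesis
    using assms mpoly_ring_closed(4)[of p X q]
    by (fastforce simp: lower_def total_degree_add weight_add)
qed

lemma lower_monomial_mult:
  assumes "keys m \<subseteq> X" "q \<in> lower m'"
  shows "monomial m 1 * q \<in> lower (m + m')"
proof -
  have "monomial m 1 * q \<in> polys X"
    using mpoly_ring_closed(4)[OF monomial_mem_polys[OF assms(1)], of q] assms(2)
    by (simp add: lower_def)
  then show ?thesis
    using assms keys_monomial_mult[of m 1 q]
    by (fastforce simp: lower_def total_degree_add weight_add)
qed

lemma leads_mem: "leads m p \<Longrightarrow> p \<in> polys X"
  using mpoly_ring_closed(3)[of "p - monomial m 1" X "monomial m 1"] monomial_mem_polys[of m X 1]
  by (auto simp: leads_def lower_def)

lemma leads_monomial: "keys m \<subseteq> X \<Longrightarrow> leads m (monomial m 1)"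
  by (simp add: leads_def lower_def mpoly_ring_closed)

lemma leads_one: "leads 0 1"
  using leads_monomial[of 0] by simp

lemma leads_mult:
  assumes "leads m p" "leads m' q"
  shows "leads (m + m') (p * q)"
proof -
  let ?p = "p - monomial m 1" and ?q = "q - monomial m' 1"
  have "p * q - monomial (m + m') 1 = (?p * ?q + monomial m 1 * ?q) + monomial m' 1 * ?p"
    by (simp add: algebra_simps mult_single)
  moreover have "?p * ?q \<in> lower (m + m')" "monomial m 1 * ?q \<in> lower (m + m')"
      "monomial m' 1 * ?p \<in> lower (m + m')"
    using assms lower_mult[of ?p m ?q m'] lower_monomial_mult[of m ?q m'] lower_monomial_mult[of m' ?p m]
    by (auto simp: leads_def add.commute)
  ultimately have "p * q - monomial (m + m') 1 \<in> lower (m + m')"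
    by (metis lower_add)
  then show ?thesis
    using assms Poly_Mapping.keys_add[of m m'] by (auto simp: leads_def)
qed

lemma leads_prod:
  "finite K \<Longrightarrow> (\<And>i. i \<in> K \<Longrightarrow> leads (m i) (p i)) \<Longrightarrow> leads (sum m K) (prod p K)"
  by (induction K rule: finite_induct) (auto simp: leads_one leads_mult)

lemma lookup_leads:
  assumes "leads m p"
  shows "lookup p m = 1" and "m' \<noteq> m \<Longrightarrow> lookup p m' \<noteq> 0 \<Longrightarrow> weight m' < weight m"
proof -
  let ?q = "p - monomial m 1"
  have q: "?q \<in> lower m" using assms by (simp add: leads_def)
  have "m \<notin> keys ?q" using q by (auto simp: lower_def)
  then have "lookup ?q m = 0" by (simp add: in_keys_iff)
  then show "lookup p m = 1" by (simp add: lookup_minus)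
  assume "m' \<noteq> m" "lookup p m' \<noteq> 0"
  then have "m' \<in> keys ?q" by (simp add: in_keys_iff lookup_minus lookup_single)
  then show "weight m' < weight m" using q by (simp add: lower_def)
qed

lemma finite_monomials: "finite {m. keys m \<subseteq> X \<and> total_degree m = e}"
proof (rule finite_imageD)
  show "inj_on Poly_Mapping.lookup {m. keys m \<subseteq> X \<and> total_degree m = e}"
    by (intro inj_onI poly_mapping_eqI) simp
  have "lookup m v \<le> total_degree m" if "v \<in> X" for m v
    unfolding total_degree_def using finite_X that by (intro member_le_sum) auto
  then have "Poly_Mapping.lookup ` {m. keys m \<subseteq> X \<and> total_degree m = e} \<subseteq>
      {f. \<forall>v. (v \<in> X \<longrightarrow> f v \<in> {..e}) \<and> (v \<notin> X \<longrightarrow> f v = 0)}"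
    by (auto simp: in_keys_iff subset_iff)
  then show "finite (Poly_Mapping.lookup ` {m. keys m \<subseteq> X \<and> total_degree m = e})"
    by (rule finite_subset) (intro finite_set_of_finite_funs finite_X finite_atMost)
qed

end

text \<open>Each \<open>g i\<close> has a squarefree initial monomial, the product of the variables in \<open>U i\<close>, and these monomials
are pairwise coprime. The map \<open>lift\<close> below is the linear bijection that sends the monomial
\<open>n * (\<Prod>i\<in>K. (\<Prod>(U i)) ^ a i)\<close>, where \<open>n\<close> is divisible by none of the initial monomials, to
\<open>n * (\<Prod>i\<in>K. g i ^ a i)\<close>. It turns multiplication by the initial monomial of \<open>g i\<close> into
multiplication by \<open>g i\<close>. Consequently the \<open>g i\<close> form a regular sequence, in any order, because their
initial monomials do.\<close>

locale coprime_initial_forms = weighted_monomials X \<omega> for X :: "'v set" and \<omega> +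
  fixes K :: "'i set" and U :: "'i \<Rightarrow> 'v set" and g :: "'i \<Rightarrow> ('v, 'k::comm_ring_1) mpoly"
  assumes finite_K: "finite K"
    and U: "\<And>i. i \<in> K \<Longrightarrow> U i \<subseteq> X \<and> U i \<noteq> {}"
    and disj: "\<And>i j. i \<in> K \<Longrightarrow> j \<in> K \<Longrightarrow> i \<noteq> j \<Longrightarrow> U i \<inter> U j = {}"
    and initial: "\<And>i. i \<in> K \<Longrightarrow> leads (constant_monomial (U i) 1) (g i)"
begin

text \<open>The multiplicity of the initial monomial of \<open>g i\<close> in \<open>m\<close>; the minimum is over a nonempty set.\<close>

definition expo :: "'i \<Rightarrow> ('v \<Rightarrow>\<^sub>0 nat) \<Rightarrow> nat" where
  "expo i m = Min (lookup m ` U i)"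

definition initial_part :: "('v \<Rightarrow>\<^sub>0 nat) \<Rightarrow> ('v \<Rightarrow>\<^sub>0 nat)" where
  "initial_part m = (\<Sum>i\<in>K. constant_monomial (U i) (expo i m))"

definition basis :: "('v \<Rightarrow>\<^sub>0 nat) \<Rightarrow> ('v, 'k) mpoly" where
  "basis m = monomial (m - initial_part m) 1 * (\<Prod>i\<in>K. g i ^ expo i m)"

definition lift :: "('v, 'k) mpoly \<Rightarrow> ('v, 'k) mpoly" where
  "lift p = (\<Sum>m\<in>keys p. monomial 0 (lookup p m) * basis m)"

lemma finite_U: "i \<in> K \<Longrightarrow> finite (U i)"
  using U finite_X finite_subset by blast

lemma lookup_initial_part:
  "i \<in> K \<Longrightarrow> v \<in> U i \<Longrightarrow> lookup (initial_part m) v = expo i m"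
  "(\<And>i. i \<in> K \<Longrightarrow> v \<notin> U i) \<Longrightarrow> lookup (initial_part m) v = 0"
proof -
  have eq: "lookup (initial_part m) v = (\<Sum>i\<in>K. if v \<in> U i then expo i m else 0)"
    unfolding initial_part_def lookup_sum by (intro sum.cong refl lookup_constant_monomial finite_U)
  show "lookup (initial_part m) v = expo i m" if i: "i \<in> K" "v \<in> U i"
  proof -
    have "lookup (initial_part m) v = (\<Sum>j\<in>K. if j = i then expo i m else 0)"
      unfolding eq using disj[OF _ i(1)] i by (intro sum.cong) auto
    then show ?thesis using finite_K i by simp
  qed
  show "lookup (initial_part m) v = 0" if "\<And>i. i \<in> K \<Longrightarrow> v \<notin> U i"
    unfolding eq using that by simp
qed

lemma initial_part_le: "lookup (initial_part m) v \<le> lookup m v"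
proof (cases "\<exists>i\<in>K. v \<in> U i")
  case True
  then obtain i where i: "i \<in> K" "v \<in> U i" by blast
  then have "Min (lookup m ` U i) \<le> lookup m v" using finite_U by (intro Min_le) auto
  then show ?thesis using lookup_initial_part(1)[OF i] by (simp add: expo_def)
qed (use lookup_initial_part(2)[of v m] in auto)

lemma rest_add_initial_part: "(m - initial_part m) + initial_part m = m"
  by (rule poly_mapping_eqI) (simp add: lookup_add lookup_minus initial_part_le)

lemma leads_basis:
  assumes "keys m \<subseteq> X"
  shows "leads m (basis m)"
proof -
  have pow: "leads (constant_monomial (U i) e) (g i ^ e)" if "i \<in> K" for i e
  proof (induction e)
    case 0
    then show ?case using leads_one by (simp add: constant_monomial_def)
  next
    case (Suc e)
    have "constant_monomial (U i) (Suc e) = constant_monomial (U i) 1 + constant_monomial (U i) e"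
      by (simp add: constant_monomial_def flip: sum.distrib single_add)
    then show ?case using leads_mult[OF initial[OF that] Suc] by simp
  qed
  have "leads (initial_part m) (\<Prod>i\<in>K. g i ^ expo i m)"
    unfolding initial_part_def by (rule leads_prod[OF finite_K pow])
  moreover have "keys (m - initial_part m) \<subseteq> X"
    using assms by (auto simp: in_keys_iff lookup_minus subset_iff)
  ultimately have "leads ((m - initial_part m) + initial_part m) (basis m)"
    unfolding basis_def by (intro leads_mult leads_monomial)
  then show ?thesis by (simp add: rest_add_initial_part)
qed

lemma basis_shift:
  assumes i: "i \<in> K"
  shows "basis (constant_monomial (U i) 1 + m) = g i * basis m"
proof -
  let ?m = "constant_monomial (U i) 1 + m"
  have expo_i: "expo i ?m = Suc (expo i m)"
  proof -
    have "lookup ?m ` U i = Suc ` lookup m ` U i"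
      using finite_U[OF i] by (auto simp: lookup_add lookup_constant_monomial image_image)
    then show ?thesis
      unfolding expo_def using finite_U[OF i] U[OF i]
      by (simp add: mono_Min_commute[of Suc, symmetric] mono_Suc)
  qed
  have expo_j: "expo j ?m = expo j m" if "j \<in> K" "j \<noteq> i" for j
  proof -
    have "lookup ?m v = lookup m v" if "v \<in> U j" for v
      using that \<open>j \<in> K\<close> \<open>j \<noteq> i\<close> disj[of j i] i finite_U[OF i]
      by (auto simp: lookup_add lookup_constant_monomial)
    then show ?thesis unfolding expo_def by (simp cong: image_cong)
  qed
  have "?m - initial_part ?m = m - initial_part m"
  proof (rule poly_mapping_eqI)
    fix v
    show "lookup (?m - initial_part ?m) v = lookup (m - initial_part m) v"
    proof (cases "\<exists>j\<in>K. v \<in> U j")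
      case True
      then obtain j where j: "j \<in> K" "v \<in> U j" by blast
      show ?thesis
      proof (cases "j = i")
        case True
        then show ?thesis
          using j finite_U[OF i] lookup_initial_part(1)[OF j, of ?m] lookup_initial_part(1)[OF j, of m] expo_i
          by (simp add: lookup_minus lookup_add lookup_constant_monomial)
      next
        case False
        then have "v \<notin> U i" using disj[OF i j(1)] j by auto
        then show ?thesis
          using j finite_U[OF i] lookup_initial_part(1)[OF j, of ?m] lookup_initial_part(1)[OF j, of m] expo_j False
          by (simp add: lookup_minus lookup_add lookup_constant_monomial)
      qed
    next
      case False
      then show ?thesis
        using i finite_U[OF i] lookup_initial_part(2)[of v ?m] lookup_initial_part(2)[of v m]
        by (auto simp: lookup_minus lookup_add lookup_constant_monomial)
    qed
  qed
  moreover have "(\<Prod>j\<in>K. g j ^ expo j ?m) = g i * (\<Prod>j\<in>K. g j ^ expo j m)"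
  proof -
    have "(\<Prod>j\<in>K - {i}. g j ^ expo j ?m) = (\<Prod>j\<in>K - {i}. g j ^ expo j m)"
      using expo_j by (intro prod.cong) auto
    then show ?thesis
      using prod.remove[OF finite_K i, of "\<lambda>j. g j ^ expo j ?m"]
        prod.remove[OF finite_K i, of "\<lambda>j. g j ^ expo j m"] expo_i
      by (simp add: ac_simps)
  qed
  ultimately show ?thesis by (simp add: basis_def ac_simps)
qed

lemma lift_superset:
  assumes "finite S" "keys p \<subseteq> S"
  shows "lift p = (\<Sum>m\<in>S. monomial 0 (lookup p m) * basis m)"
  unfolding lift_def using assms by (intro sum.mono_neutral_left) (auto simp: in_keys_iff)

lemma lift_add: "lift (p + q) = lift p + lift q"
proof -
  let ?S = "keys p \<union> keys q"
  have "keys (p + q) \<subseteq> ?S" by (rule Poly_Mapping.keys_add)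
  then show ?thesis
    using lift_superset[of ?S "p + q"] lift_superset[of ?S p] lift_superset[of ?S q]
    by (simp add: lookup_add single_add distrib_right sum.distrib)
qed

lemma lift_zero: "lift 0 = 0"
  by (simp add: lift_def)

lemma lift_diff: "lift (p - q) = lift p - lift q"
  using lift_add[of "p - q" q] by simp

lemma lift_sum: "lift (sum f A) = (\<Sum>i\<in>A. lift (f i))"
  by (induction A rule: infinite_finite_induct) (simp_all add: lift_zero lift_add)

lemma lift_monomial: "lift (monomial m c) = monomial 0 c * basis m"
  by (simp add: lift_def)

lemma lift_shift:
  assumes i: "i \<in> K"
  shows "lift (monomial (constant_monomial (U i) 1) 1 * p) = g i * lift p"
proof -
  let ?u = "constant_monomial (U i) 1"
  have "monomial ?u 1 * p = (\<Sum>m\<in>keys p. monomial ?u 1 * monomial m (lookup p m))"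
    by (simp add: sum_monomials flip: sum_distrib_left)
  then have "lift (monomial ?u 1 * p) = (\<Sum>m\<in>keys p. monomial 0 (lookup p m) * basis (?u + m))"
    by (simp add: lift_sum mult_single lift_monomial)
  also have "\<dots> = g i * lift p"
    unfolding lift_def sum_distrib_left by (intro sum.cong refl) (simp only: basis_shift[OF i] mult.left_commute)
  finally show ?thesis .
qed

lemma polys_residue: "residue_ring_of (polys X :: ('v, 'k) mpoly set) {0}"
  using unital_subring_polys by (auto simp: residue_ring_of_def ideal_of_def mpoly_ring_closed)

lemma lift_mem: "p \<in> polys X \<Longrightarrow> lift p \<in> polys X"
proof -
  assume p: "p \<in> polys X"
  interpret P: residue_ring_of "polys X :: ('v, 'k) mpoly set" "{0}" by (rule polys_residue)
  show ?thesis
    unfolding lift_def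
  proof (rule P.sum_mem)
    fix m assume "m \<in> keys p"
    then have "basis m \<in> polys X"
      using p by (intro leads_mem[OF leads_basis]) (simp add: mem_mpoly_ring_iff)
    then show "monomial 0 (lookup p m) * basis m \<in> polys X"
      by (intro P.mult_mem monomial_mem_polys) auto
  qed
qed

lemma lift_injective:
  assumes p: "p \<in> polys X" and z: "lift p = 0"
  shows "p = 0"
proof (rule ccontr)
  assume "p \<noteq> 0"
  then have ne: "weight ` keys p \<noteq> {}" by simp
  have "Max (weight ` keys p) \<in> weight ` keys p"
    by (rule Max_in[OF _ ne]) simp
  then obtain m where m0: "m \<in> keys p" "weight m = Max (weight ` keys p)" by auto
  have m: "m \<in> keys p" "\<And>m'. m' \<in> keys p \<Longrightarrow> weight m' \<le> weight m"
    unfolding m0(2) using m0(1) by simp_all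
  have keysX: "keys m' \<subseteq> X" if "m' \<in> keys p" for m'
    using p that by (simp add: mem_mpoly_ring_iff)
  have mult0: "lookup (monomial 0 c * q) m = c * lookup q m" for c and q :: "('v, 'k) mpoly"
    using lookup_monomial_mult[of 0 c q m] by simp
  have "lookup (lift p) m = (\<Sum>m'\<in>keys p. lookup p m' * lookup (basis m') m)"
    by (simp add: lift_def lookup_sum mult0)
  also have "\<dots> = (\<Sum>m'\<in>keys p. if m' = m then lookup p m else 0)"
  proof (intro sum.cong refl)
    fix m' assume m': "m' \<in> keys p"
    show "lookup p m' * lookup (basis m') m = (if m' = m then lookup p m else 0)"
      using lookup_leads[OF leads_basis[OF keysX[OF m']]] m(2)[OF m'] by fastforce
  qed
  also have "\<dots> = lookup p m" using m(1) by simp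
  finally show False using z m(1) by (simp add: in_keys_iff)
qed

text \<open>A monomial \<open>m\<close> differs from \<open>basis m\<close> by monomials of the same degree and smaller weight, of which there
are finitely many, so induction on their number applies.\<close>

lemma lift_surjective: "lift ` polys X = polys X"
proof
  define below where "below m = {t. keys t \<subseteq> X \<and> total_degree t = total_degree m \<and> weight t < weight m}" for m
  interpret P: residue_ring_of "polys X :: ('v, 'k) mpoly set" "{0}" by (rule polys_residue)
  show "lift ` polys X \<subseteq> polys X" using lift_mem by blast
  have diff: "a - b \<in> lift ` polys X" if "a \<in> lift ` polys X" "b \<in> lift ` polys X" for a b
    using that P.diff_mem by (auto simp flip: lift_diff)
  have add: "sum f A \<in> lift ` polys X" if "\<And>i. i \<in> A \<Longrightarrow> f i \<in> lift ` polys X"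
    for f :: "('v \<Rightarrow>\<^sub>0 nat) \<Rightarrow> ('v, 'k) mpoly" and A
    using that
  proof (induction A rule: infinite_finite_induct)
    case (insert i A)
    then obtain p q where "p \<in> polys X" "q \<in> polys X" "f i = lift p" "sum f A = lift q" by blast
    then show ?case using insert P.add_mem by (auto simp flip: lift_add)
  qed (use lift_zero P.zero_mem in \<open>auto intro: image_eqI[of _ _ 0]\<close>)
  have mon: "monomial m c \<in> lift ` polys X" if "keys m \<subseteq> X" for m c
    using that
  proof (induction "card (below m)"
      arbitrary: m c rule: less_induct)
    case (less m)
    let ?low = "basis m - monomial m 1"
    have low: "?low \<in> lower m" using leads_basis[OF less.prems] by (simp add: leads_def)
    have "monomial 0 c * ?low \<in> lift ` polys X"
    proof -
      have "monomial 0 c * ?low = (\<Sum>m'\<in>keys ?low. monomial m' (c * lookup ?low m'))"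
      proof -
        have "monomial 0 c * ?low = monomial 0 c * (\<Sum>m'\<in>keys ?low. monomial m' (lookup ?low m'))"
          by (simp add: sum_monomials)
        also have "\<dots> = (\<Sum>m'\<in>keys ?low. monomial m' (c * lookup ?low m'))"
          by (simp add: sum_distrib_left mult_single)
        finally show ?thesis .
      qed
      moreover have "\<dots> \<in> lift ` polys X"
      proof (rule add)
        fix m' assume "m' \<in> keys ?low"
        then have m': "keys m' \<subseteq> X" "total_degree m' = total_degree m" "weight m' < weight m"
          using low by (auto simp: lower_def mem_mpoly_ring_iff)
        have "card (below m') <
            card (below m)"
        proof (rule psubset_card_mono)
          show "finite (below m)"
            by (rule finite_subset[OF _ finite_monomials[of "total_degree m"]]) (auto simp: below_def)
          have "m' \<in> below m"
            using m' by (simp add: below_def)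
          moreover have "m' \<notin> below m'"
            by (simp add: below_def)
          moreover have "below m' \<subseteq>
              below m"
            using m' by (auto simp: below_def)
          ultimately show "below m' \<subset>
              below m"
            by blast
        qed
        then show "monomial m' (c * lookup ?low m') \<in> lift ` polys X"
          using less.hyps m'(1) by blast
      qed
      ultimately show ?thesis by simp
    qed
    moreover have "lift (monomial m c) \<in> lift ` polys X"
      using less.prems monomial_mem_polys by blast
    moreover have "monomial m c = lift (monomial m c) - monomial 0 c * ?low"
      by (simp add: lift_monomial algebra_simps mult_single)
    ultimately show ?case using diff by metis
  qed
  show "polys X \<subseteq> lift ` polys X"
  proof
    fix p :: "('v, 'k) mpoly" assume p: "p \<in> polys X"
    have "(\<Sum>m\<in>keys p. monomial m (lookup p m)) \<in> lift ` polys X"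
      using p by (intro add mon) (simp add: mem_mpoly_ring_iff)
    then show "p \<in> lift ` polys X" by (simp add: sum_monomials)
  qed
qed

text \<open>The ideal generated by the initial monomials with index in \<open>J\<close>; since these are squarefree, divisibility
only depends on the support of a monomial.\<close>

definition monomial_ideal :: "'i set \<Rightarrow> ('v, 'k) mpoly set" where
  "monomial_ideal J = {q \<in> polys X. \<forall>m\<in>keys q. \<exists>i\<in>J. U i \<subseteq> keys m}"

lemma monomial_ideal_shift:
  assumes "i \<in> J" "J \<subseteq> K" "p \<in> polys X"
  shows "monomial (constant_monomial (U i) 1) 1 * p \<in> monomial_ideal J"
proof -
  interpret P: residue_ring_of "polys X :: ('v, 'k) mpoly set" "{0}" by (rule polys_residue)
  let ?u = "constant_monomial (U i) 1"
  have fin: "finite (U i)" using assms finite_U by blast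
  have "monomial ?u 1 * p \<in> polys X"
    using assms U by (intro P.mult_mem monomial_mem_polys) (auto simp: keys_constant_monomial[OF fin])
  moreover have "U i \<subseteq> keys m" if "m \<in> keys (monomial ?u 1 * p)" for m
    using that keys_monomial_mult[of ?u 1 p]
    by (auto simp: in_keys_iff lookup_add lookup_constant_monomial[OF fin])
  ultimately show ?thesis using assms(1) by (auto simp: monomial_ideal_def)
qed

lemma lift_monomial_ideal:
  assumes J: "J \<subseteq> K"
  shows "lift ` monomial_ideal J = ideal_gen (polys X) (g ` J)"
proof
  interpret P: residue_ring_of "polys X :: ('v, 'k) mpoly set" "{0}" by (rule polys_residue)
  have gX: "g ` J \<subseteq> polys X" using J leads_mem[OF initial] by blast
  interpret G: residue_ring_of "polys X" "ideal_gen (polys X) (g ` J)"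
    using ideal_of_ideal_gen[OF unital_subring_polys gX] unital_subring_polys
    by (simp add: residue_ring_of_def)
  show "lift ` monomial_ideal J \<subseteq> ideal_gen (polys X) (g ` J)"
  proof safe
    fix q assume q: "q \<in> monomial_ideal J"
    show "lift q \<in> ideal_gen (polys X) (g ` J)"
      unfolding lift_def
    proof (rule G.sum_ideal)
      fix m assume m: "m \<in> keys q"
      then obtain i where i: "i \<in> J" "U i \<subseteq> keys m"
        using q by (auto simp: monomial_ideal_def)
      let ?u = "constant_monomial (U i) 1"
      have iK: "i \<in> K" using i J by blast
      have "?u + (m - ?u) = m"
        using i(2) finite_U[OF iK]
        by (intro poly_mapping_eqI) (auto simp: lookup_add lookup_minus lookup_constant_monomial in_keys_iff)
      then have eq: "basis m = g i * basis (m - ?u)" using basis_shift[OF iK, of "m - ?u"] by simp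
      have "keys (m - ?u) \<subseteq> keys m"
        by (auto simp: in_keys_iff lookup_minus)
      moreover have "keys m \<subseteq> X"
        using q m by (simp add: monomial_ideal_def mem_mpoly_ring_iff)
      ultimately have "keys (m - ?u) \<subseteq> X" by (rule subset_trans)
      then have "basis (m - ?u) \<in> polys X" by (rule leads_mem[OF leads_basis])
      then have "(monomial 0 (lookup q m) * basis (m - ?u)) * g i \<in> ideal_gen (polys X) (g ` J)"
        using i by (intro G.ideal_mult G.mult_mem monomial_mem_polys ideal_gen_mem) auto
      then show "monomial 0 (lookup q m) * basis m \<in> ideal_gen (polys X) (g ` J)"
        by (simp add: eq ac_simps)
    qed
  qed
  show "ideal_gen (polys X) (g ` J) \<subseteq> lift ` monomial_ideal J"
  proof
    fix x assume "x \<in> ideal_gen (polys X) (g ` J)"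
    then show "x \<in> lift ` monomial_ideal J"
    proof induction
      case zero
      show ?case
        by (rule image_eqI[of _ _ 0]) (simp_all add: lift_zero monomial_ideal_def mpoly_ring_closed)
    next
      case (step h c f)
      obtain i where i: "i \<in> J" "f = g i" using step by blast
      obtain q where q: "q \<in> monomial_ideal J" "h = lift q" using step by blast
      obtain p where p: "p \<in> polys X" "c = lift p" using step lift_surjective by blast
      let ?s = "monomial (constant_monomial (U i) 1) 1 * p"
      have s: "?s \<in> monomial_ideal J" using monomial_ideal_shift[OF i(1) J p(1)] .
      have "?s + q \<in> monomial_ideal J"
        using s q(1) Poly_Mapping.keys_add[of ?s q] mpoly_ring_closed(3)[of ?s X q]
        by (fastforce simp: monomial_ideal_def)
      moreover have "c * f + h = lift (?s + q)"
        using lift_shift[of i p] i J p q by (auto simp: lift_add ac_simps)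
      ultimately show ?case by blast
    qed
  qed
qed

text \<open>Pulled back along \<open>lift\<close>, the claim is about monomials: if the product of the initial monomial of \<open>g i\<close>
and \<open>m\<close> is divisible by an initial monomial coprime to the former, then so is \<open>m\<close>.\<close>

theorem regular_modulo:
  assumes J: "J \<subseteq> K" and i: "i \<in> K - J" and b: "b \<in> polys X"
    and gb: "g i * b \<in> ideal_gen (polys X) (g ` J)"
  shows "b \<in> ideal_gen (polys X) (g ` J)"
proof -
  interpret P: residue_ring_of "polys X :: ('v, 'k) mpoly set" "{0}" by (rule polys_residue)
  let ?u = "constant_monomial (U i) 1"
  have iK: "i \<in> K" using i by blast
  have fin: "finite (U i)" using finite_U[OF iK] .
  obtain p where p: "p \<in> polys X" "b = lift p" using b lift_surjective by blast
  let ?s = "monomial ?u 1 * p"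
  obtain q where q: "q \<in> monomial_ideal J" "lift ?s = lift q"
    using gb lift_monomial_ideal[OF J] lift_shift[OF iK, of p] p by auto
  have s: "?s \<in> polys X"
    using monomial_ideal_shift[of i K p] iK p by (auto simp: monomial_ideal_def)
  have "q \<in> polys X" using q(1) by (simp add: monomial_ideal_def)
  then have "?s - q = 0"
    using lift_injective[OF P.diff_mem[OF s]] q(2) by (simp add: lift_diff)
  then have sJ: "?s \<in> monomial_ideal J" using q by simp
  have "\<exists>j\<in>J. U j \<subseteq> keys m" if m: "m \<in> keys p" for m
  proof -
    have "?u + m \<in> keys ?s"
      using m by (simp add: in_keys_iff lookup_monomial_mult)
    then obtain j where j: "j \<in> J" "U j \<subseteq> keys (?u + m)"
      using sJ by (auto simp: monomial_ideal_def)
    have "U j \<inter> U i = {}" using disj[of j i] i j J by blast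
    then have "U j \<subseteq> keys m"
      using j(2) by (auto simp: in_keys_iff lookup_add lookup_constant_monomial[OF fin] subset_iff split: if_splits)
    then show ?thesis using j by blast
  qed
  then have "p \<in> monomial_ideal J" using p by (simp add: monomial_ideal_def)
  then show ?thesis using p lift_monomial_ideal[OF J] by blast
qed

end

section \<open>Weights from positive matchings and for minors\<close>

lemma pmd_attained:
  assumes "simple_graph V E"
  shows "\<exists>F. positive_matching_decomposition E (pmd E) F"
  unfolding pmd_def using ex_positive_matching_decomposition[OF assms] by (rule LeastI_ex)

lemma degenerate_degeneracy:
  assumes "simple_graph V E"
  shows "degenerate V E (degeneracy V E)"
  unfolding degeneracy_def using ex_degenerate[OF assms] by (rule LeastI_ex)

text \<open>The \<open>l\<close>-th matching comes with a vertex weight that is positive on the edges of \<open>F l\<close> and negative on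
those of later blocks; it says nothing about earlier blocks. Scaling the \<open>l\<close>-th weight by \<open>R ^ (p - l)\<close>
with \<open>R\<close> large makes column \<open>l\<close> win on the edges of \<open>F l\<close>: by size against the later columns, and by
sign against the earlier ones.\<close>

theorem ex_edge_weights:
  assumes E: "finite E" and F: "positive_matching_decomposition E p F"
  obtains w :: "'a \<Rightarrow> nat \<Rightarrow> real" where
    "\<And>l e. l \<in> {1..p} \<Longrightarrow> e \<in> F l \<Longrightarrow> (\<Sum>i\<in>e. w i l) > 0"
    "\<And>l k e. l \<in> {1..p} \<Longrightarrow> k \<in> {1..p} \<Longrightarrow> k \<noteq> l \<Longrightarrow> e \<in> F l \<Longrightarrow> (\<Sum>i\<in>e. w i k) < (\<Sum>i\<in>e. w i l)"
proof -
  have sub: "F l \<subseteq> E" if "l \<in> {1..p}" for l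
    using F that by (auto simp: positive_matching_decomposition_def)
  have "\<forall>l\<in>{1..p}. \<exists>u :: 'a \<Rightarrow> real. (\<forall>e\<in>F l. (\<Sum>i\<in>e. u i) > 0) \<and>
      (\<forall>e\<in>E - (\<Union>j\<in>{1..<l}. F j) - F l. (\<Sum>i\<in>e. u i) < 0)"
    using F by (auto simp: positive_matching_decomposition_def positive_matching_def)
  then obtain u :: "nat \<Rightarrow> 'a \<Rightarrow> real" where
    u: "\<And>l e. l \<in> {1..p} \<Longrightarrow> e \<in> F l \<Longrightarrow> (\<Sum>i\<in>e. u l i) > 0"
       "\<And>l e. l \<in> {1..p} \<Longrightarrow> e \<in> E - (\<Union>j\<in>{1..<l}. F j) - F l \<Longrightarrow> (\<Sum>i\<in>e. u l i) < 0"
    by (metis (no_types, lifting) bchoice)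
  define s where "s l e = (\<Sum>i\<in>e. u l i)" for l e
  define A where "A = insert 1 ((\<lambda>(l, e). s l e) ` {(l, e). l \<in> {1..p} \<and> e \<in> F l})"
  define B where "B = insert 0 ((\<lambda>(l, e). s l e) ` ({1..p} \<times> E))"
  have "{(l, e). l \<in> {1..p} \<and> e \<in> F l} \<subseteq> {1..p} \<times> E" using sub by auto
  then have "finite {(l, e). l \<in> {1..p} \<and> e \<in> F l}"
    by (rule finite_subset) (use E in simp)
  then have fin: "finite A" "finite B"
    unfolding A_def B_def using E by blast+
  have A: "0 < Min A" "\<And>l e. l \<in> {1..p} \<Longrightarrow> e \<in> F l \<Longrightarrow> Min A \<le> s l e"
  proof -
    show "0 < Min A"
      using fin(1) u(1) by (subst Min_gr_iff) (auto simp: A_def s_def)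
    show "Min A \<le> s l e" if "l \<in> {1..p}" "e \<in> F l" for l e
      using fin(1) that by (intro Min_le) (auto simp: A_def)
  qed
  have B: "0 \<le> Max B" "\<And>l e. l \<in> {1..p} \<Longrightarrow> e \<in> E \<Longrightarrow> s l e \<le> Max B"
    using fin(2) by (auto intro!: Max_ge simp: B_def)
  \<comment> \<open>\<open>Min A\<close> bounds the positive edge sums from below and \<open>Max B\<close> bounds all edge sums from above.\<close>
  define R where "R = Max B / Min A + 1"
  have R: "1 \<le> R" "R * Min A > Max B" using A B by (auto simp: R_def field_simps)
  define w where "w i l = R ^ (p - l) * u l i" for i l
  have sw: "(\<Sum>i\<in>e. w i l) = R ^ (p - l) * s l e" for l e
    by (simp add: w_def s_def sum_distrib_left)
  have pos: "R ^ m > 0" for m using R by simp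
  show thesis
  proof (rule that[of w])
    show "(\<Sum>i\<in>e. w i l) > 0" if "l \<in> {1..p}" "e \<in> F l" for l e
      using u(1)[OF that] pos by (simp add: sw s_def)
    fix l k e assume lk: "l \<in> {1..p}" "k \<in> {1..p}" "k \<noteq> l" and e: "e \<in> F l"
    show "(\<Sum>i\<in>e. w i k) < (\<Sum>i\<in>e. w i l)"
    proof (cases "k < l")
      case True
      have "e \<notin> F j" if "j \<in> {1..k}" for j
        using F e lk True that unfolding positive_matching_decomposition_def disjoint_family_on_def
        by (metis (no_types, lifting) IntI atLeastAtMost_iff emptyE le_trans less_imp_le_nat linorder_not_less)
      then have "s k e < 0"
        unfolding s_def using sub[OF lk(1)] e lk by (intro u(2)) auto
      then have "R ^ (p - k) * s k e < 0" using pos by (simp add: mult_pos_neg)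
      also have "0 < R ^ (p - l) * s l e" using u(1)[OF lk(1) e] pos by (simp add: s_def)
      finally show ?thesis by (simp add: sw)
    next
      case False
      then have kl: "k > l" using lk by simp
      have "R ^ (p - k) * s k e \<le> R ^ (p - k) * Max B"
        using B(2)[OF lk(2)] sub[OF lk(1)] e pos[of "p - k"] by (intro mult_left_mono) auto
      also have "\<dots> < R ^ (p - k) * (R * Min A)"
        using R pos[of "p - k"] by (intro mult_strict_left_mono)
      also have "\<dots> = R ^ Suc (p - k) * Min A" by simp
      also have "\<dots> \<le> R ^ (p - l) * Min A"
        using R A kl lk by (intro mult_right_mono power_increasing) auto
      also have "\<dots> \<le> R ^ (p - l) * s l e"
        using A(2)[OF lk(1) e] pos[of "p - l"] by (intro mult_left_mono) auto
      finally show ?thesis by (simp add: sw)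
    qed
  qed
qed

text \<open>The coordinates of the vertices \<open>\<nu> 0, \<dots>, \<nu> (r - 1)\<close> in the \<open>r\<close> consecutive columns that start at \<open>c\<close>.\<close>

definition window_matrix :: "nat \<Rightarrow> nat \<Rightarrow> (nat \<Rightarrow> nat) \<Rightarrow> (nat \<times> nat, 'k::comm_ring_1) mpoly mat" where
  "window_matrix r c \<nu> = mat r r (\<lambda>(s, t). mvar (\<nu> s, c + t))"

lemma sum_squares_permutation:
  fixes r a :: nat
  assumes \<sigma>: "\<sigma> permutes {..<r}" "\<sigma> \<noteq> id"
  shows "(\<Sum>s<r. (real s - (real (\<sigma> s) + real a))\<^sup>2) > (\<Sum>s<r. (real s - (real s + real a))\<^sup>2)"
proof -
  obtain s where s: "\<sigma> s \<noteq> s" using \<sigma>(2) by (auto simp: fun_eq_iff)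
  then have sr: "s < r" using \<sigma>(1) by (metis lessThan_iff permutes_not_in)
  have "(\<Sum>s<r. real (\<sigma> s)) = (\<Sum>s<r. real s)"
    using sum.permute[OF \<sigma>(1), of real] by (simp add: comp_def)
  moreover have "(\<Sum>s<r. (real s - (real (\<sigma> s) + real a))\<^sup>2) =
      (\<Sum>s<r. (real s - real (\<sigma> s))\<^sup>2) - 2 * real a * ((\<Sum>s<r. real s) - (\<Sum>s<r. real (\<sigma> s)))
        + (\<Sum>s<r. (real s - (real s + real a))\<^sup>2)"
    by (simp add: power2_eq_square algebra_simps sum.distrib sum_subtractf sum_distrib_left)
  moreover have "(\<Sum>s<r. (real s - real (\<sigma> s))\<^sup>2) > 0"
    using s sr by (intro sum_pos2[of _ s]) auto
  ultimately show ?thesis by simp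
qed

context weighted_monomials
begin

lemma total_degree_single: "v \<in> X \<Longrightarrow> total_degree (Poly_Mapping.single v (Suc 0)) = 1"
  using finite_X by (simp add: total_degree_def lookup_single when_def)

lemma weight_single: "v \<in> X \<Longrightarrow> weight (Poly_Mapping.single v (Suc 0)) = \<omega> v"
  using finite_X by (simp add: weight_def lookup_single when_def if_distrib if_distribR cong: if_cong)

lemma total_degree_sum: "total_degree (sum f A) = (\<Sum>i\<in>A. total_degree (f i))"
  by (induction A rule: infinite_finite_induct) (simp_all add: total_degree_add total_degree_def[of 0])

lemma weight_sum: "weight (sum f A) = (\<Sum>i\<in>A. weight (f i))"
  by (induction A rule: infinite_finite_induct) (simp_all add: weight_add weight_def[of 0])

lemma lower_uminus: "p \<in> lower m \<Longrightarrow> - p \<in> lower m"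
  using mpoly_ring_closed(5)[of p X] by (auto simp: lower_def in_keys_iff)

lemma lower_zero: "0 \<in> lower m"
  by (simp add: lower_def mpoly_ring_closed)

lemma lower_sum: "(\<And>i. i \<in> A \<Longrightarrow> f i \<in> lower m) \<Longrightarrow> sum f A \<in> lower m"
  by (induction A rule: infinite_finite_induct) (simp_all add: lower_add lower_zero)

lemma monomial_lower:
  "keys m' \<subseteq> X \<Longrightarrow> total_degree m' = total_degree m \<Longrightarrow> weight m' < weight m \<Longrightarrow>
    monomial m' c \<in> lower m"
  by (auto simp: lower_def monomial_mem_polys)

end

lemma prod_mvar: "finite A \<Longrightarrow> (\<Prod>s\<in>A. mvar (f s)) = monomial (\<Sum>s\<in>A. Poly_Mapping.single (f s) 1) (1::'k::comm_ring_1)"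
  by (induction A rule: finite_induct) (simp_all add: mvar_def mult_single)

lemma keys_sum_single: "finite A \<Longrightarrow> keys (\<Sum>s\<in>A. Poly_Mapping.single (f s) (Suc 0)) = f ` A"
  by (auto simp: in_keys_iff lookup_sum lookup_single when_def split: if_splits)

lemma sum_single_inj: "inj_on f A \<Longrightarrow> (\<Sum>s\<in>A. Poly_Mapping.single (f s) e) = constant_monomial (f ` A) e"
  by (simp add: constant_monomial_def sum.reindex)

text \<open>With \<open>\<omega>\<close> as given, the term of a permutation \<open>\<sigma>\<close> in the Leibniz expansion has weight
\<open>- (\<Sum>s<r. (s - (\<sigma> s + a))\<^sup>2) - r\<close>, which is largest exactly for the identity. The same weight works for
every shift \<open>a\<close> of the window, because shifting changes the sum of squares by a quantity that does not
depend on the permutation.\<close>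

lemma leads_window_minor:
  fixes X :: "(nat \<times> nat) set" and \<omega> :: "nat \<times> nat \<Rightarrow> real"
  assumes X: "finite X" and \<nu>: "inj_on \<nu> {..<r}" and sub: "\<nu> ` {..<r} \<times> {c + a..<c + a + r} \<subseteq> X"
    and \<omega>: "\<And>s k. s < r \<Longrightarrow> \<omega> (\<nu> s, c + k) = - (real s - real k)\<^sup>2 - 1"
  shows "weighted_monomials.leads X \<omega> (constant_monomial ((\<lambda>s. (\<nu> s, c + a + s)) ` {..<r}) 1)
    (det (window_matrix r (c + a) \<nu>) :: (nat \<times> nat, 'k::comm_ring_1) mpoly)"
proof -
  interpret weighted_monomials X \<omega> by unfold_locales (rule X)
  define m where "m \<sigma> = (\<Sum>s<r. Poly_Mapping.single (\<nu> s, c + a + \<sigma> s) (1::nat))" for \<sigma> :: "nat \<Rightarrow> nat"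
  have inX: "(\<nu> s, c + a + \<sigma> s) \<in> X" if "\<sigma> permutes {..<r}" "s < r" for \<sigma> s
  proof -
    have "\<sigma> s < r" using permutes_in_image[OF that(1), of s] that(2) by simp
    then show ?thesis using sub that(2) by auto
  qed
  have keys: "keys (m \<sigma>) \<subseteq> X" if "\<sigma> permutes {..<r}" for \<sigma>
    using inX[OF that] by (auto simp: m_def keys_sum_single)
  have deg: "total_degree (m \<sigma>) = r" if "\<sigma> permutes {..<r}" for \<sigma>
    using inX[OF that] by (simp add: m_def total_degree_sum total_degree_single)
  have wt: "weight (m \<sigma>) = - (\<Sum>s<r. (real s - (real (\<sigma> s) + real a))\<^sup>2) - real r"
    if "\<sigma> permutes {..<r}" for \<sigma>
  proof -
    have "weight (m \<sigma>) = (\<Sum>s<r. \<omega> (\<nu> s, c + (a + \<sigma> s)))"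
      using inX[OF that] by (simp add: m_def weight_sum weight_single add.assoc)
    also have "\<dots> = (\<Sum>s<r. - (real s - (real (\<sigma> s) + real a))\<^sup>2 - 1)"
      by (intro sum.cong refl) (simp add: \<omega> add.commute)
    finally show ?thesis by (simp add: sum_subtractf sum_negf)
  qed
  let ?P = "{\<sigma>. \<sigma> permutes {0..<r}}"
  have entries: "(\<Prod>s = 0..<r. window_matrix r (c + a) \<nu> $$ (s, \<sigma> s)) = monomial (m \<sigma>) (1::'k)"
    if "\<sigma> permutes {..<r}" for \<sigma>
  proof -
    have "(\<Prod>s = 0..<r. window_matrix r (c + a) \<nu> $$ (s, \<sigma> s)) = (\<Prod>s<r. mvar (\<nu> s, c + a + \<sigma> s) :: (nat \<times> nat, 'k) mpoly)"
      using permutes_in_image[OF that]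
      by (intro prod.cong) (auto simp: window_matrix_def lessThan_atLeast0)
    then show ?thesis by (simp add: prod_mvar m_def)
  qed
  have "det (window_matrix r (c + a) \<nu>) = (\<Sum>\<sigma>\<in>?P. signof \<sigma> * monomial (m \<sigma>) (1::'k))"
  proof -
    have "window_matrix r (c + a) \<nu> \<in> carrier_mat r r" by (simp add: window_matrix_def)
    then have "det (window_matrix r (c + a) \<nu>) = (\<Sum>\<sigma>\<in>?P. signof \<sigma> *
        (\<Prod>s = 0..<r. window_matrix r (c + a) \<nu> $$ (s, \<sigma> s) :: (nat \<times> nat, 'k) mpoly))"
      by (rule det_def')
    also have "\<dots> = (\<Sum>\<sigma>\<in>?P. signof \<sigma> * monomial (m \<sigma>) (1::'k))"
      using entries by (intro sum.cong refl) (simp add: lessThan_atLeast0)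
    finally show ?thesis .
  qed
  also have "\<dots> = monomial (m id) 1 + (\<Sum>\<sigma>\<in>?P - {id}. signof \<sigma> * monomial (m \<sigma>) (1::'k))"
    by (subst sum.remove[of _ id]) (auto simp: finite_permutations permutes_id)
  finally have eq: "det (window_matrix r (c + a) \<nu>) - monomial (m id) 1 =
      (\<Sum>\<sigma>\<in>?P - {id}. signof \<sigma> * monomial (m \<sigma>) (1::'k))" by simp
  have "(\<Sum>\<sigma>\<in>?P - {id}. signof \<sigma> * monomial (m \<sigma>) (1::'k)) \<in> lower (m id)"
  proof (rule lower_sum)
    fix \<sigma> assume "\<sigma> \<in> ?P - {id}"
    then have \<sigma>: "\<sigma> permutes {..<r}" "\<sigma> \<noteq> id" by (auto simp: lessThan_atLeast0)
    have "monomial (m \<sigma>) (1::'k) \<in> lower (m id)"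
      using keys[OF \<sigma>(1)] deg[OF \<sigma>(1)] deg[OF permutes_id] wt[OF \<sigma>(1)] wt[OF permutes_id]
        sum_squares_permutation[OF \<sigma>, of a]
      by (intro monomial_lower) auto
    then show "signof \<sigma> * monomial (m \<sigma>) (1::'k) \<in> lower (m id)"
      using lower_uminus by (auto simp: sign_def)
  qed
  then have "leads (m id) (det (window_matrix r (c + a) \<nu>) :: (nat \<times> nat, 'k) mpoly)"
    using keys[OF permutes_id] by (simp only: leads_def eq simp_thms)
  moreover have "m id = constant_monomial ((\<lambda>s. (\<nu> s, c + a + s)) ` {..<r}) 1"
    unfolding m_def id_apply using \<nu> by (intro sum_single_inj) (auto simp: inj_on_def)
  ultimately show ?thesis by simp
qed

lemma leads_lss_form:
  fixes X :: "(nat \<times> nat) set" and \<omega> :: "nat \<times> nat \<Rightarrow> real"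
  assumes X: "finite X" and ij: "i \<noteq> j" and sub: "{i, j} \<times> {1..d} \<subseteq> X" and l: "l \<in> {1..d}"
    and \<omega>: "\<And>k. k \<in> {1..d} \<Longrightarrow> k \<noteq> l \<Longrightarrow> \<omega> (i, k) + \<omega> (j, k) < \<omega> (i, l) + \<omega> (j, l)"
  shows "weighted_monomials.leads X \<omega> (constant_monomial ({i, j} \<times> {l}) 1)
    (lss_form d i j :: (nat \<times> nat, 'k::comm_ring_1) mpoly)"
proof -
  interpret weighted_monomials X \<omega> by unfold_locales (rule X)
  define m where "m k = Poly_Mapping.single (i, k) (1::nat) + Poly_Mapping.single (j, k) 1" for k :: nat
  have mk: "mvar (i, k) * mvar (j, k) = monomial (m k) (1::'k)" for k
    by (simp add: mvar_def mult_single m_def)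
  have inX: "(i, k) \<in> X" "(j, k) \<in> X" if "k \<in> {1..d}" for k using sub that by auto
  have keys: "keys (m k) \<subseteq> X" if "k \<in> {1..d}" for k
    using inX[OF that] Poly_Mapping.keys_add[of "Poly_Mapping.single (i, k) (1::nat)" "Poly_Mapping.single (j, k) 1"]
    by (auto simp: m_def)
  have "lss_form d i j - monomial (m l) 1 = (\<Sum>k\<in>{1..d} - {l}. monomial (m k) (1::'k))"
    unfolding lss_form_def using l by (simp add: mk sum.remove[of _ l])
  also have "\<dots> \<in> lower (m l)"
    using inX l \<omega> keys
    by (intro lower_sum monomial_lower)
      (auto simp: m_def total_degree_add weight_add total_degree_single weight_single)
  finally have "lss_form d i j - monomial (m l) (1::'k) \<in> lower (m l)" .
  moreover have "m l = constant_monomial ({i, j} \<times> {l}) 1"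
    using ij by (simp add: m_def constant_monomial_def insert_Times_insert)
  ultimately show ?thesis using keys[OF l] by (simp add: leads_def)
qed

section \<open>Regularity of minors modulo the edge forms\<close>

definition lss_forms :: "nat \<Rightarrow> nat set set \<Rightarrow> (nat \<times> nat, 'k::comm_ring_1) mpoly set" where
  "lss_forms d E = {lss_form d i j | i j. {i, j} \<in> E}"

lemma lss_form_commute: "lss_form d i j = lss_form d j i"
  by (simp add: lss_form_def mult.commute)

lemma lss_form_mem_polys:
  assumes "{i, j} \<times> {1..d} \<subseteq> X"
  shows "(lss_form d i j :: (nat \<times> nat, 'k::comm_ring_1) mpoly) \<in> polys X"
proof -
  interpret P: residue_ring_of "polys X :: (nat \<times> nat, 'k) mpoly set" "{0}"
    using unital_subring_polys by (auto simp: residue_ring_of_def ideal_of_def mpoly_ring_closed)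
  show ?thesis
    unfolding lss_form_def using assms by (intro P.sum_mem P.mult_mem mvar_mem_mpoly_ring) auto
qed

lemma lss_forms_subset_polys:
  "(\<And>e. e \<in> E \<Longrightarrow> e \<times> {1..d} \<subseteq> X) \<Longrightarrow> lss_forms d E \<subseteq> polys X"
  unfolding lss_forms_def using lss_form_mem_polys by blast

text \<open>For a suitable weight, the form of an edge in the \<open>l\<close>-th matching has as its initial monomial the product
of its two variables in column \<open>l \<le> p\<close>, and the two minors have as initial monomials the diagonals of
their windows, which start at columns \<open>p + 1\<close> and \<open>p + 2\<close>. Edges within one matching are disjoint, and the
two diagonals are disjoint, so all these monomials are pairwise coprime.\<close>

lemma window_minors_regular:
  fixes X :: "(nat \<times> nat) set" and \<nu> :: "nat \<Rightarrow> nat"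
  assumes graph: "simple_graph V E" and F: "positive_matching_decomposition E p F" and E': "E' \<subseteq> E"
    and \<nu>: "inj_on \<nu> {..<r}" and d: "p + r + 1 \<le> d"
    and X: "finite X" "\<And>e. e \<in> E' \<Longrightarrow> e \<times> {1..d} \<subseteq> X" "\<nu> ` {..<r} \<times> {1..d} \<subseteq> X"
  defines "D \<equiv> \<lambda>a. det (window_matrix r (p + 1 + a) \<nu>) :: (nat \<times> nat, 'k::comm_ring_1) mpoly"
  shows "a \<in> {0, 1} \<Longrightarrow> x \<in> polys X \<Longrightarrow> D a * x \<in> ideal_gen (polys X) (lss_forms d E') \<Longrightarrow>
      x \<in> ideal_gen (polys X) (lss_forms d E')"
    and "x \<in> polys X \<Longrightarrow> D 1 * x \<in> ideal_gen (polys X) (insert (D 0) (lss_forms d E')) \<Longrightarrow>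
      x \<in> ideal_gen (polys X) (insert (D 0) (lss_forms d E'))"
proof -
  have "(a \<in> {0, 1} \<longrightarrow> x \<in> polys X \<longrightarrow> D a * x \<in> ideal_gen (polys X) (lss_forms d E') \<longrightarrow>
      x \<in> ideal_gen (polys X) (lss_forms d E')) \<and>
    (x \<in> polys X \<longrightarrow> D 1 * x \<in> ideal_gen (polys X) (insert (D 0) (lss_forms d E')) \<longrightarrow>
      x \<in> ideal_gen (polys X) (insert (D 0) (lss_forms d E')))" for a x
  proof (cases "r = 0")
    case True
    then have "D b = 1" for b
      unfolding D_def by (intro det_dim_zero) (simp add: window_matrix_def)
    then show ?thesis by simp
  next
    case r: False
    have finE: "finite E" using simple_graph_finite_edges[OF graph] .
    obtain w :: "nat \<Rightarrow> nat \<Rightarrow> real" where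
      w: "\<And>l e. l \<in> {1..p} \<Longrightarrow> e \<in> F l \<Longrightarrow> (\<Sum>i\<in>e. w i l) > 0"
         "\<And>l k e. l \<in> {1..p} \<Longrightarrow> k \<in> {1..p} \<Longrightarrow> k \<noteq> l \<Longrightarrow> e \<in> F l \<Longrightarrow> (\<Sum>i\<in>e. w i k) < (\<Sum>i\<in>e. w i l)"
      using ex_edge_weights[OF finE F] by blast
    define h where "h i = real (inv_into {..<r} \<nu> i)" for i
    \<comment> \<open>Columns beyond \<open>p\<close> get negative weights, so they never win within an edge form.\<close>
    define \<omega> :: "nat \<times> nat \<Rightarrow> real" where
      "\<omega> = (\<lambda>(i, k). if k \<le> p then w i k else - (h i - real (k - (p + 1)))\<^sup>2 - 1)"
    define blk where "blk e = (SOME l. l \<in> {1..p} \<and> e \<in> F l)" for e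
    have blk: "blk e \<in> {1..p} \<and> e \<in> F (blk e)" if "e \<in> E'" for e
    proof -
      have "\<exists>l. l \<in> {1..p} \<and> e \<in> F l"
        using F E' that unfolding positive_matching_decomposition_def by blast
      then show ?thesis unfolding blk_def by (rule someI_ex)
    qed
    define g :: "nat set + nat \<Rightarrow> (nat \<times> nat, 'k) mpoly" where
      "g = case_sum (\<lambda>e. lss_form d (Min e) (Max e)) D"
    define U :: "nat set + nat \<Rightarrow> (nat \<times> nat) set" where
      "U = case_sum (\<lambda>e. e \<times> {blk e}) (\<lambda>a. (\<lambda>s. (\<nu> s, p + 1 + a + s)) ` {..<r})"
    define K :: "(nat set + nat) set" where "K = Inl ` E' \<union> Inr ` {0, 1}"
    have edge: "\<exists>i j. e = {i, j} \<and> i < j" if "e \<in> E'" for e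
    proof -
      have "card e = 2" using graph E' that by (auto simp: simple_graph_def)
      then obtain i j where "e = {i, j}" "i \<noteq> j" by (meson card_2_iff)
      then show ?thesis by (metis insert_commute nat_neq_iff)
    qed
    interpret W: weighted_monomials X \<omega> by unfold_locales (rule X)
    interpret coprime_initial_forms X \<omega> K U g
    proof unfold_locales
      show "finite K" unfolding K_def using finite_subset[OF E' finE] by simp
      show "U i \<subseteq> X \<and> U i \<noteq> {}" if "i \<in> K" for i
      proof (cases i)
        case (Inl e)
        then have e: "e \<in> E'" using that by (auto simp: K_def)
        have "blk e \<in> {1..d}" using blk[OF e] d by auto
        then show ?thesis using Inl X(2)[OF e] edge[OF e] by (auto simp: U_def)
      next
        case (Inr a)
        then have "a \<in> {0, 1}" using that by (auto simp: K_def)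
        then have "(\<lambda>s. (\<nu> s, p + 1 + a + s)) ` {..<r} \<subseteq> \<nu> ` {..<r} \<times> {1..d}" using d by auto
        then show ?thesis using Inr X(3) r by (auto simp: U_def)
      qed
      show "U i \<inter> U j = {}" if ij: "i \<in> K" "j \<in> K" "i \<noteq> j" for i j
      proof -
        have 1: "U (Inl e) \<inter> U (Inl e') = {}" if e: "e \<in> E'" "e' \<in> E'" "e \<noteq> e'" for e e'
        proof (cases "blk e = blk e'")
          case True
          have "pairwise disjnt (F (blk e))"
            using F blk[OF e(1)] by (auto simp: positive_matching_decomposition_def positive_matching_def)
          then have "disjnt e e'" using blk e True unfolding pairwise_def by metis
          then show ?thesis by (auto simp: U_def disjnt_def)
        qed (auto simp: U_def)
        have 2: "U (Inl e) \<inter> U (Inr a) = {}" if "e \<in> E'" for e a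
          using blk[OF that] by (auto simp: U_def)
        have 3: "U (Inr 0) \<inter> U (Inr 1) = {}"
          using \<nu> by (auto simp: U_def dest!: inj_onD)
        have disj2: "U (Inr a) \<inter> U (Inl e) = {}" if "e \<in> E'" for e a
          using 2[OF that] by (simp add: Int_commute)
        have disj3: "U (Inr 1) \<inter> U (Inr 0) = {}" using 3 by (simp add: Int_commute)
        show ?thesis using ij unfolding K_def by (elim UnE imageE insertE emptyE) (use 1 2 disj2 3 disj3 in simp_all)
      qed
      show "W.leads (constant_monomial (U i) 1) (g i)" if i: "i \<in> K" for i
      proof (cases i)
        case (Inl e)
        then have e: "e \<in> E'" using i by (auto simp: K_def)
        then obtain i1 j1 where ij: "e = {i1, j1}" "i1 < j1" using edge by blast
        have "W.leads (constant_monomial ({i1, j1} \<times> {blk e}) 1) (lss_form d i1 j1 :: (nat \<times> nat, 'k) mpoly)"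
        proof (rule leads_lss_form)
          show "finite X" "i1 \<noteq> j1" "{i1, j1} \<times> {1..d} \<subseteq> X" using X e ij by auto
          show "blk e \<in> {1..d}" using blk[OF e] d by auto
          fix k assume k: "k \<in> {1..d}" "k \<noteq> blk e"
          have b: "blk e \<in> {1..p}" "e \<in> F (blk e)" using blk[OF e] by auto
          then have bp: "blk e \<le> p" by simp
          have pos: "w i1 (blk e) + w j1 (blk e) > 0" using w(1)[OF b] ij by simp
          show "\<omega> (i1, k) + \<omega> (j1, k) < \<omega> (i1, blk e) + \<omega> (j1, blk e)"
          proof (cases "k \<le> p")
            case True
            then have "w i1 k + w j1 k < w i1 (blk e) + w j1 (blk e)"
              using w(2)[OF b(1) _ k(2) b(2)] k ij by simp
            then show ?thesis using True bp by (simp add: \<omega>_def)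
          next
            case False
            then have "\<omega> (i1, k) + \<omega> (j1, k) < 0"
              by (simp add: \<omega>_def) (smt (verit) zero_le_power2)
            then show ?thesis using pos bp by (simp add: \<omega>_def)
          qed
        qed
        then show ?thesis using Inl ij by (simp add: g_def U_def)
      next
        case (Inr a)
        then have a: "a \<in> {0, 1}" using i by (auto simp: K_def)
        have "W.leads (constant_monomial ((\<lambda>s. (\<nu> s, p + 1 + a + s)) ` {..<r}) 1)
          (det (window_matrix r (p + 1 + a) \<nu>) :: (nat \<times> nat, 'k) mpoly)"
        proof (rule leads_window_minor[OF X(1) \<nu>])
          have "{p + 1 + a..<p + 1 + a + r} \<subseteq> {1..d}" using a d by auto
          then show "\<nu> ` {..<r} \<times> {p + 1 + a..<p + 1 + a + r} \<subseteq> X" using X(3) by blast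
          show "\<omega> (\<nu> s, p + 1 + k) = - (real s - real k)\<^sup>2 - 1" if "s < r" for s k
            using that \<nu> by (simp add: \<omega>_def h_def inv_into_f_f)
        qed
        then show ?thesis using Inr by (simp add: g_def U_def D_def)
      qed
    qed
    have forms: "g ` Inl ` E' = lss_forms d E'"
    proof (intro subset_antisym subsetI)
      fix f :: "(nat \<times> nat, 'k) mpoly" assume "f \<in> g ` Inl ` E'"
      then obtain e where e: "e \<in> E'" "f = lss_form d (Min e) (Max e)" by (auto simp: g_def)
      obtain i j where "e = {i, j}" "i < j" using edge[OF e(1)] by blast
      then show "f \<in> lss_forms d E'" using e by (auto simp: lss_forms_def)
    next
      fix f :: "(nat \<times> nat, 'k) mpoly" assume "f \<in> lss_forms d E'"
      then obtain i j where ij: "{i, j} \<in> E'" "f = lss_form d i j" by (auto simp: lss_forms_def)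
      have "lss_form d i j = (lss_form d (Min {i, j}) (Max {i, j}) :: (nat \<times> nat, 'k) mpoly)"
        using lss_form_commute by (auto simp: min_def max_def)
      then show "f \<in> g ` Inl ` E'"
        using ij by (intro image_eqI[of _ g "Inl {i, j}"]) (simp_all add: g_def)
    qed
    have "x \<in> ideal_gen (polys X) (lss_forms d E')"
      if "a \<in> {0, 1}" "x \<in> polys X" "D a * x \<in> ideal_gen (polys X) (lss_forms d E')"
      using regular_modulo[of "Inl ` E'" "Inr a" x] that by (simp add: forms) (auto simp: K_def g_def)
    moreover have "x \<in> ideal_gen (polys X) (insert (D 0) (lss_forms d E'))"
      if "x \<in> polys X" "D 1 * x \<in> ideal_gen (polys X) (insert (D 0) (lss_forms d E'))"
    proof -
      have "g ` (insert (Inr 0) (Inl ` E')) = insert (D 0) (lss_forms d E')"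
        by (simp add: forms) (simp add: g_def)
      then show ?thesis
        using regular_modulo[of "insert (Inr 0) (Inl ` E')" "Inr 1" x] that by (auto simp: K_def g_def)
    qed
    ultimately show ?thesis by blast
  qed
  then show "a \<in> {0, 1} \<Longrightarrow> x \<in> polys X \<Longrightarrow> D a * x \<in> ideal_gen (polys X) (lss_forms d E') \<Longrightarrow>
      x \<in> ideal_gen (polys X) (lss_forms d E')"
    "x \<in> polys X \<Longrightarrow> D 1 * x \<in> ideal_gen (polys X) (insert (D 0) (lss_forms d E')) \<Longrightarrow>
      x \<in> ideal_gen (polys X) (insert (D 0) (lss_forms d E'))" by blast+
qed

lemma (in residue_ring_of) det_mem:
  assumes "A \<in> carrier_mat n n" "\<And>i j. i < n \<Longrightarrow> j < n \<Longrightarrow> A $$ (i, j) \<in> C"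
  shows "det A \<in> C"
proof -
  have "signof \<sigma> \<in> C" for \<sigma> :: "nat \<Rightarrow> nat" by (simp add: sign_def)
  moreover have "(\<Prod>i = 0..<n. A $$ (i, \<sigma> i)) \<in> C" if "\<sigma> permutes {0..<n}" for \<sigma>
  proof -
    have prod_mem: "prod f K \<in> C" if "\<And>i. i \<in> K \<Longrightarrow> f i \<in> C" for f :: "nat \<Rightarrow> 'a" and K
      using that by (induction K rule: infinite_finite_induct) auto
    show ?thesis
      using assms(2) permutes_in_image[OF that] by (intro prod_mem) auto
  qed
  ultimately show ?thesis
    unfolding det_def'[OF assms(1)] by (intro sum_mem mult_mem) auto
qed

lemma (in residue_ring_of) adj_mat_mem:
  assumes "A \<in> carrier_mat n n" "\<And>i j. i < n \<Longrightarrow> j < n \<Longrightarrow> A $$ (i, j) \<in> C" and ij: "i < n" "j < n"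
  shows "adj_mat A $$ (i, j) \<in> C"
proof -
  have "det (mat_delete A j i) \<in> C"
  proof (rule det_mem)
    show "mat_delete A j i \<in> carrier_mat (n - 1) (n - 1)" using assms(1) by (rule mat_delete_carrier)
    fix i' j' assume "i' < n - 1" "j' < n - 1"
    then show "mat_delete A j i $$ (i', j') \<in> C"
      using assms by (auto simp: mat_delete_def)
  qed
  then show ?thesis using assms by (auto simp: adj_mat_def cofactor_def)
qed

lemma adj_mat_sums:
  fixes A :: "'a::comm_ring_1 mat"
  assumes "A \<in> carrier_mat n n" "i < n" "j < n"
  shows "(\<Sum>s<n. adj_mat A $$ (i, s) * A $$ (s, j)) = (if i = j then det A else 0)"
    and "(\<Sum>s<n. A $$ (i, s) * adj_mat A $$ (s, j)) = (if i = j then det A else 0)"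
proof -
  have "(adj_mat A * A) $$ (i, j) = (det A \<cdot>\<^sub>m 1\<^sub>m n) $$ (i, j)" "(A * adj_mat A) $$ (i, j) = (det A \<cdot>\<^sub>m 1\<^sub>m n) $$ (i, j)"
    using adj_mat[OF assms(1)] by simp_all
  then show "(\<Sum>s<n. adj_mat A $$ (i, s) * A $$ (s, j)) = (if i = j then det A else 0)"
    "(\<Sum>s<n. A $$ (i, s) * adj_mat A $$ (s, j)) = (if i = j then det A else 0)"
    using assms adj_mat(1)[OF assms(1)] by (auto simp: scalar_prod_def lessThan_atLeast0)
qed

section \<open>Solving for the coordinates of a vertex by Cramer's rule\<close>

lemma lss_form_split_window:
  assumes "1 \<le> c" "c + r \<le> d + 1" "s < r"
  shows "lss_form d v (\<nu> s) = (\<Sum>t<r. mvar (v, c + t) * window_matrix r c \<nu> $$ (s, t)) +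
    (\<Sum>k\<in>{1..d} - {c..<c + r}. mvar (v, k) * (mvar (\<nu> s, k) :: (nat \<times> nat, 'k::comm_ring_1) mpoly))"
proof -
  let ?f = "\<lambda>k. mvar (v, k) * (mvar (\<nu> s, k) :: (nat \<times> nat, 'k) mpoly)"
  have "{c..<c + r} \<subseteq> {1..d}" using assms by auto
  then have "lss_form d v (\<nu> s) = sum ?f {c..<c + r} + sum ?f ({1..d} - {c..<c + r})"
    unfolding lss_form_def using sum.subset_diff[of "{c..<c + r}" "{1..d}" ?f] by (simp add: add.commute)
  also have "sum ?f {c..<c + r} = (\<Sum>t<r. ?f (c + t))"
    using sum.atLeastLessThan_shift_0[of ?f c "c + r"] by (simp add: lessThan_atLeast0 comp_def)
  also have "\<dots> = (\<Sum>t<r. mvar (v, c + t) * window_matrix r c \<nu> $$ (s, t))"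
    using assms(3) by (intro sum.cong) (auto simp: window_matrix_def)
  finally show ?thesis .
qed

text \<open>The forms of the edges from \<open>v\<close> to the vertices \<open>\<nu> s\<close> are linear equations for the coordinates of \<open>v\<close>.
Cramer's rule with the minor \<open>D\<close> solves them for the coordinates of \<open>v\<close> in the window, in terms of the
remaining ones; the numerators come from the adjugate matrix.\<close>

theorem prime_ideal_by_window_minor:
  fixes X :: "(nat \<times> nat) set" and \<pp> L :: "(nat \<times> nat, 'k::field) mpoly set"
    and \<nu> :: "nat \<Rightarrow> nat" and v c r d :: nat
  defines "D \<equiv> det (window_matrix r c \<nu>) :: (nat \<times> nat, 'k) mpoly"
    and "XA \<equiv> X - {v} \<times> {c..<c + r}"
    and "Ls \<equiv> (\<lambda>s. lss_form d v (\<nu> s)) ` {..<r} :: (nat \<times> nat, 'k) mpoly set"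
  assumes c: "1 \<le> c" "c + r \<le> d + 1" and v: "\<And>s. s < r \<Longrightarrow> \<nu> s \<noteq> v"
    and X: "\<nu> ` {..<r} \<times> {1..d} \<subseteq> X" "{v} \<times> {1..d} \<subseteq> X"
    and \<pp>: "prime_ideal_of (polys XA) \<pp>" "D \<notin> \<pp>" and L: "L = ideal_gen (polys X) (\<pp> \<union> Ls)"
    and regular: "\<And>x. x \<in> polys X \<Longrightarrow> D * x \<in> L \<Longrightarrow> x \<in> L"
  shows "prime_ideal_of (polys X) L" and "L \<inter> polys XA = \<pp>"
    and "x \<in> polys X \<Longrightarrow> \<exists>m. \<exists>a\<in>polys XA. D ^ m * x - a \<in> L"
proof -
  let ?W = "window_matrix r c \<nu> :: (nat \<times> nat, 'k) mpoly mat" and ?J = "{c..<c + r}"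
  have W: "?W \<in> carrier_mat r r" by (simp add: window_matrix_def)
  define rest :: "nat \<Rightarrow> (nat \<times> nat, 'k) mpoly" where
    "rest s = (\<Sum>k\<in>{1..d} - ?J. mvar (v, k) * mvar (\<nu> s, k))" for s
  define N :: "nat \<times> nat \<Rightarrow> (nat \<times> nat, 'k) mpoly" where
    "N u = - (\<Sum>s<r. adj_mat ?W $$ (snd u - c, s) * rest s)" for u
  interpret A: residue_domain_of "polys XA" \<pp>
    by (rule residue_domain_ofI[OF unital_subring_polys \<pp>(1)])
  have \<nu>XA: "(\<nu> s, k) \<in> XA" if "s < r" "k \<in> {1..d}" for s k
    using that X(1) v[OF that(1)] by (auto simp: XA_def)
  have entries: "?W $$ (s, t) \<in> polys XA" if "s < r" "t < r" for s t
    using that c \<nu>XA[of s "c + t"] by (auto simp: window_matrix_def intro!: mvar_mem_mpoly_ring)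
  have split: "lss_form d v (\<nu> s) = (\<Sum>t<r. mvar (v, c + t) * ?W $$ (s, t)) + rest s" if "s < r" for s
    unfolding rest_def by (rule lss_form_split_window[OF c that])
  have rest: "rest s \<in> polys XA" if "s < r" for s
    unfolding rest_def
  proof (rule A.sum_mem)
    fix k assume k: "k \<in> {1..d} - ?J"
    then have "(v, k) \<in> XA" using X(2) by (auto simp: XA_def)
    moreover have "(\<nu> s, k) \<in> XA" using k \<nu>XA[OF that] by blast
    ultimately show "mvar (v, k) * mvar (\<nu> s, k) \<in> (polys XA :: (nat \<times> nat, 'k) mpoly set)"
      by (rule A.mult_mem[OF mvar_mem_mpoly_ring mvar_mem_mpoly_ring])
  qed
  have D: "D \<in> polys XA" unfolding D_def using A.det_mem[OF W entries] .
  have NA: "N u \<in> polys XA" if "u \<in> X - XA" for u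
    unfolding N_def using that A.adj_mat_mem[OF W entries] rest
    by (intro A.uminus_mem A.sum_mem A.mult_mem) (auto simp: XA_def)
  have LsX: "Ls \<subseteq> polys X"
  proof -
    have "{v, \<nu> s} \<times> {1..d} \<subseteq> X" if "s < r" for s using X that by blast
    then show ?thesis unfolding Ls_def using lss_form_mem_polys by blast
  qed
  have AX: "polys XA \<subseteq> (polys X :: (nat \<times> nat, 'k) mpoly set)"
    by (rule polys_mono) (auto simp: XA_def)
  have pX: "\<pp> \<union> Ls \<subseteq> polys X" using A.ideal_sub AX LsX by blast
  interpret B: residue_ring_of "polys X" L
    using ideal_of_ideal_gen[OF unital_subring_polys pX] unital_subring_polys
    by (simp add: residue_ring_of_def L)
  have elim: "D * mvar u - N u \<in> L" if u: "u \<in> X - XA" for u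
  proof -
    obtain t where t: "u = (v, c + t)" "t < r"
      using u by (auto simp: XA_def le_iff_add)
    have "(\<Sum>s<r. adj_mat ?W $$ (t, s) * lss_form d v (\<nu> s)) \<in> L"
    proof (rule B.sum_ideal)
      fix s assume s: "s \<in> {..<r}"
      have "lss_form d v (\<nu> s) \<in> L"
        using s unfolding L Ls_def by (intro ideal_gen_mem B.one_mem) auto
      moreover have "adj_mat ?W $$ (t, s) \<in> polys X"
        using A.adj_mat_mem[OF W entries t(2)] s AX by auto
      ultimately show "adj_mat ?W $$ (t, s) * lss_form d v (\<nu> s) \<in> L" by (rule B.ideal_mult[rotated])
    qed
    also have "(\<Sum>s<r. adj_mat ?W $$ (t, s) * lss_form d v (\<nu> s)) =
        (\<Sum>s<r. \<Sum>t'<r. mvar (v, c + t') * (adj_mat ?W $$ (t, s) * ?W $$ (s, t'))) +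
        (\<Sum>s<r. adj_mat ?W $$ (t, s) * rest s)"
      by (simp add: split distrib_left sum_distrib_left sum.distrib ac_simps)
    also have "(\<Sum>s<r. \<Sum>t'<r. mvar (v, c + t') * (adj_mat ?W $$ (t, s) * ?W $$ (s, t'))) =
        (\<Sum>t'<r. mvar (v, c + t') * (\<Sum>s<r. adj_mat ?W $$ (t, s) * ?W $$ (s, t')))"
      unfolding sum_distrib_left by (rule sum.swap)
    also have "\<dots> = (\<Sum>t'<r. if t' = t then D * mvar (v, c + t) else 0)"
      using adj_mat_sums(1)[OF W t(2)] by (intro sum.cong refl) (simp add: D_def mult.commute)
    also have "\<dots> = D * mvar (v, c + t)" using t(2) by simp
    also have "(\<Sum>s<r. adj_mat ?W $$ (t, s) * rest s) = - N u" by (simp add: N_def t)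
    finally show ?thesis by (simp add: t)
  qed
  interpret E: coefficient_hom "\<lambda>c::'k. to_fract (monomial 0 c :: (nat \<times> nat, 'k) mpoly)"
    by (rule coefficient_hom_fract)
  have D0: "D \<noteq> 0" using \<pp>(2) A.ideal_zero by metis
  have solves: "fract_eval XA N D l = 0" if l: "l \<in> Ls" for l
  proof -
    obtain s where s: "s < r" "l = lss_form d v (\<nu> s)" using l by (auto simp: Ls_def)
    have "to_fract D * fract_eval XA N D l =
        to_fract ((\<Sum>t<r. N (v, c + t) * ?W $$ (s, t)) + D * rest s)"
    proof -
      have "fract_eval XA N D l = (\<Sum>t<r. (to_fract (N (v, c + t)) / to_fract D) * to_fract (?W $$ (s, t))) + to_fract (rest s)"
        using s entries rest
        by (simp add: split E.eval_add E.eval_sum E.eval_mult E.eval_mvar fract_eval_fixes XA_def[symmetric])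
          (simp add: XA_def)
      then have "to_fract D * fract_eval XA N D l =
        (\<Sum>t<r. to_fract (N (v, c + t)) * to_fract (?W $$ (s, t))) + to_fract D * to_fract (rest s)"
        using D0 by (simp add: distrib_left sum_distrib_left)
      then show ?thesis
        by (simp add: hom_distribs)
    qed
    also have "(\<Sum>t<r. N (v, c + t) * ?W $$ (s, t)) =
        - (\<Sum>t<r. \<Sum>s'<r. rest s' * (?W $$ (s, t) * adj_mat ?W $$ (t, s')))"
      by (simp add: N_def sum_negf sum_distrib_left sum_distrib_right ac_simps)
    also have "(\<Sum>t<r. \<Sum>s'<r. rest s' * (?W $$ (s, t) * adj_mat ?W $$ (t, s'))) =
        (\<Sum>s'<r. rest s' * (\<Sum>t<r. ?W $$ (s, t) * adj_mat ?W $$ (t, s')))"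
      unfolding sum_distrib_left by (rule sum.swap)
    also have "\<dots> = (\<Sum>s'<r. if s' = s then D * rest s else 0)"
      using adj_mat_sums(2)[OF W s(1)] by (intro sum.cong refl) (simp add: D_def mult.commute)
    also have "\<dots> = D * rest s" using s(1) by simp
    finally show ?thesis using D0 by simp
  qed
  have sub: "XA \<subseteq> X" by (auto simp: XA_def)
  show "prime_ideal_of (polys X) L" "L \<inter> polys XA = \<pp>"
    "x \<in> polys X \<Longrightarrow> \<exists>m. \<exists>a\<in>polys XA. D ^ m * x - a \<in> L"
    using prime_ideal_by_elimination[OF sub \<pp>(1) D \<pp>(2) NA LsX L elim solves regular] by blast+
qed

section \<open>Attaching a vertex\<close>

lemma dvd_mod_mono:
  "C \<subseteq> C' \<Longrightarrow> I \<subseteq> I' \<Longrightarrow> dvd_mod C I a b \<Longrightarrow> dvd_mod C' I' a b"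
  unfolding dvd_mod_def by blast

lemma lss_forms_add_vertex:
  "lss_forms d (E \<union> (\<lambda>s. {v, \<nu> s}) ` S) = lss_forms d E \<union> (\<lambda>s. lss_form d v (\<nu> s)) ` S"
proof (intro subset_antisym subsetI)
  fix f :: "(nat \<times> nat, 'k::comm_ring_1) mpoly"
  assume "f \<in> lss_forms d (E \<union> (\<lambda>s. {v, \<nu> s}) ` S)"
  then obtain i j where f: "f = lss_form d i j" and "{i, j} \<in> E \<union> (\<lambda>s. {v, \<nu> s}) ` S"
    by (auto simp: lss_forms_def)
  then consider "{i, j} \<in> E" | s where "s \<in> S" "{i, j} = {v, \<nu> s}" by auto
  then show "f \<in> lss_forms d E \<union> (\<lambda>s. lss_form d v (\<nu> s)) ` S"
  proof cases
    case 1
    then show ?thesis using f by (auto simp: lss_forms_def)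
  next
    case 2
    then have "i = v \<and> j = \<nu> s \<or> i = \<nu> s \<and> j = v" by (auto simp: doubleton_eq_iff)
    then show ?thesis using f 2(1) lss_form_commute[of d i j] by auto
  qed
next
  fix f :: "(nat \<times> nat, 'k::comm_ring_1) mpoly"
  assume "f \<in> lss_forms d E \<union> (\<lambda>s. lss_form d v (\<nu> s)) ` S"
  then show "f \<in> lss_forms d (E \<union> (\<lambda>s. {v, \<nu> s}) ` S)"
    by (auto simp: lss_forms_def)
qed

text \<open>Let \<open>L\<close> be the ideal after attaching \<open>v\<close>. For \<open>a = 0, 1\<close> let \<open>D a\<close> be the minor of the neighbours of \<open>v\<close>
in the window that starts at column \<open>p + 1 + a\<close>, and let \<open>XA a\<close> be the variables without those of \<open>v\<close> in
this window. By Cramer's rule both \<open>D 0\<close> and \<open>D 1\<close> provide a chart: after inverting \<open>D a\<close>, the new ring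
equals the ring of the old graph in the variables \<open>XA a\<close>, which is factorial by assumption. For \<open>a = 0\<close>
this is the setting of Nagata's criterion, so the prime factors of \<open>D 0\<close> in the old ring have to remain
prime in the new one. This is where the second minor enters: \<open>D 1\<close> is regular modulo \<open>D 0\<close>, hence modulo
each factor \<open>q\<close> of \<open>D 0\<close>, so primality of \<open>q\<close> can be checked in the chart of \<open>D 1\<close>, where it is inherited
from the old ring.\<close>

theorem ufd_mod_attach_vertex:
  fixes X :: "(nat \<times> nat) set" and \<nu> :: "nat \<Rightarrow> nat" and v p r d :: nat and W V :: "nat set"
  assumes graph: "simple_graph V E" and F: "positive_matching_decomposition E p F"
    and \<nu>: "inj_on \<nu> {..<r}" "\<nu> ` {..<r} \<subseteq> W" and v: "v \<notin> W"
    and E1: "\<And>e. e \<in> E1 \<Longrightarrow> e \<subseteq> W" and E2: "E2 = E1 \<union> (\<lambda>s. {v, \<nu> s}) ` {..<r}" "E2 \<subseteq> E"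
    and d: "p + r + 1 \<le> d"
    and IH: "\<And>X. finite X \<Longrightarrow> W \<times> {1..d} \<subseteq> X \<Longrightarrow>
      ufd_mod (polys X :: (nat \<times> nat, 'k::field) mpoly set) (ideal_gen (polys X) (lss_forms d E1))"
    and X: "finite X" "insert v W \<times> {1..d} \<subseteq> X"
  shows "ufd_mod (polys X :: (nat \<times> nat, 'k) mpoly set) (ideal_gen (polys X) (lss_forms d E2))"
proof -
  define D :: "nat \<Rightarrow> (nat \<times> nat, 'k) mpoly" where "D a = det (window_matrix r (p + 1 + a) \<nu>)" for a
  define F1 :: "(nat \<times> nat, 'k) mpoly set" where "F1 = lss_forms d E1"
  define Ls :: "(nat \<times> nat, 'k) mpoly set" where "Ls = (\<lambda>s. lss_form d v (\<nu> s)) ` {..<r}"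
  define I where "I Y = ideal_gen (polys Y) F1" for Y
  define L where "L = ideal_gen (polys X) (F1 \<union> Ls)"
  define X0 where "X0 = X - {v} \<times> {1..d}"
  define XA where "XA a = X - {v} \<times> {p + 1 + a..<p + 1 + a + r}" for a
  have forms2: "lss_forms d E2 = F1 \<union> Ls"
    unfolding E2(1) F1_def Ls_def by (rule lss_forms_add_vertex)
  have W0: "W \<times> {1..d} \<subseteq> X0" and WA: "W \<times> {1..d} \<subseteq> XA a" for a
    using X v by (auto simp: X0_def XA_def)
  have sub: "X0 \<subseteq> XA a" "XA a \<subseteq> X" if "a \<in> {0, 1}" for a
    using that d by (auto simp: X0_def XA_def)
  have fin: "finite X0" "finite (XA a)" for a using X(1) by (auto simp: X0_def XA_def)
  have F1Y: "F1 \<subseteq> polys Y" if "W \<times> {1..d} \<subseteq> Y" for Y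
    unfolding F1_def using that E1 by (intro lss_forms_subset_polys) blast
  have F1X: "F1 \<union> Ls \<subseteq> polys X"
    unfolding forms2[symmetric] using X(2) E1 \<nu> E2(1) by (intro lss_forms_subset_polys) auto
  have polys: "(polys Y :: (nat \<times> nat, 'k) mpoly set) \<subseteq> polys Z" if "Y \<subseteq> Z" for Y Z :: "(nat \<times> nat) set"
    using that by (rule polys_mono)
  have ufdI: "ufd_mod (polys Y) (I Y)" if "finite Y" "W \<times> {1..d} \<subseteq> Y" for Y
    unfolding I_def F1_def using IH that by blast
  have domI: "residue_domain_of (polys Y) (I Y)" if "finite Y" "W \<times> {1..d} \<subseteq> Y" for Y
    using ufdI[OF that] by (intro residue_domain_ofI unital_subring_polys) (simp add: ufd_mod_def)
  interpret R0: residue_domain_of "polys X0" "I X0" by (rule domI[OF fin(1) W0])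
  interpret RA: residue_domain_of "polys (XA 0)" "I (XA 0)" by (rule domI[OF fin(2) WA])
  interpret RB: residue_domain_of "polys (XA 1)" "I (XA 1)" by (rule domI[OF fin(2) WA])
  interpret RX: residue_ring_of "polys X" L
    using ideal_of_ideal_gen[OF unital_subring_polys F1X] unital_subring_polys
    by (simp add: residue_ring_of_def L_def)
  have I_mono: "I Y \<subseteq> I Z" if "Y \<subseteq> Z" for Y Z
    unfolding I_def using polys[OF that] by (intro ideal_gen_mono) auto
  have IL: "I Y \<subseteq> L" if "Y \<subseteq> X" for Y
    unfolding I_def L_def using polys[OF that] by (intro ideal_gen_mono) auto
  have DX0: "D a \<in> polys X0" if "a \<in> {0, 1}" for a
    unfolding D_def
  proof (rule R0.det_mem)
    show "window_matrix r (p + 1 + a) \<nu> \<in> carrier_mat r r" by (simp add: window_matrix_def)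
    fix s t assume st: "s < r" "t < r"
    have "\<nu> s \<in> W" "p + 1 + a + t \<in> {1..d}" using \<nu>(2) d that st by auto
    then have "(\<nu> s, p + 1 + a + t) \<in> X0" using W0 by blast
    then show "window_matrix r (p + 1 + a) \<nu> $$ (s, t) \<in> (polys X0 :: (nat \<times> nat, 'k) mpoly set)"
      using st by (simp add: window_matrix_def mvar_mem_mpoly_ring)
  qed
  have D_mem: "D a \<in> polys Y" if "a \<in> {0, 1}" "X0 \<subseteq> Y" for a Y
    using DX0[OF that(1)] polys[OF that(2)] by blast
  note regular = window_minors_regular[OF graph F _ \<nu>(1) d, where ?'k = 'k, folded D_def]
  have E1E: "E1 \<subseteq> E" using E2 by blast
  have E1Y: "e \<times> {1..d} \<subseteq> Y" if "W \<times> {1..d} \<subseteq> Y" "e \<in> E1" for e Y using E1 that by blast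
  have \<nu>Y: "\<nu> ` {..<r} \<times> {1..d} \<subseteq> Y" if "W \<times> {1..d} \<subseteq> Y" for Y using \<nu>(2) that by blast
  have reg1: "x \<in> I Y" if "finite Y" "W \<times> {1..d} \<subseteq> Y" "a \<in> {0, 1}" "x \<in> polys Y" "D a * x \<in> I Y" for a x Y
    using regular(1)[OF E1E that(1) E1Y[OF that(2)] \<nu>Y[OF that(2)] that(3,4)] that(5)
    unfolding I_def F1_def by simp
  have reg1': "dvd_mod (polys Y) (I Y) (D 0) x"
    if Y: "finite Y" "W \<times> {1..d} \<subseteq> Y" "X0 \<subseteq> Y" "x \<in> polys Y" "dvd_mod (polys Y) (I Y) (D 0) (D 1 * x)" for x Y
  proof -
    interpret R: residue_domain_of "polys Y" "I Y" by (rule domI[OF Y(1,2)])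
    have eq: "adjoin (polys Y) (I Y) (D 0) = ideal_gen (polys Y) (insert (D 0) F1)"
      using D_mem Y F1Y by (intro R.adjoin_ideal_gen) (auto simp: I_def)
    have "D 1 * x \<in> adjoin (polys Y) (I Y) (D 0)"
      using Y D_mem by (auto simp: adjoin_def)
    then have "x \<in> adjoin (polys Y) (I Y) (D 0)"
      using regular(2)[OF E1E Y(1) E1Y[OF Y(2)] \<nu>Y[OF Y(2)] Y(4)] unfolding eq F1_def by simp
    then show ?thesis by (simp add: adjoin_def)
  qed
  have E2X: "e \<times> {1..d} \<subseteq> X" if "e \<in> E2" for e using that X(2) E1 \<nu> E2(1) by auto
  have \<nu>X: "\<nu> ` {..<r} \<times> {1..d} \<subseteq> X" "{v} \<times> {1..d} \<subseteq> X" using \<nu>(2) X(2) by auto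
  have regX: "x \<in> L" if "a \<in> {0, 1}" "x \<in> polys X" "D a * x \<in> L" for a x
    using regular(1)[OF E2(2) X(1) E2X \<nu>X(1) that(1,2)] that(3) unfolding L_def forms2 by simp
  have regX': "dvd_mod (polys X) L (D 0) x" if x: "x \<in> polys X" "dvd_mod (polys X) L (D 0) (D 1 * x)" for x
  proof -
    have D0X: "D 0 \<in> polys X" "D 1 \<in> polys X" using D_mem by (auto simp: X0_def)
    have eq: "adjoin (polys X) L (D 0) = ideal_gen (polys X) (insert (D 0) (F1 \<union> Ls))"
      using D0X F1X by (intro RX.adjoin_ideal_gen) (auto simp: L_def)
    have "D 1 * x \<in> adjoin (polys X) L (D 0)"
      using x D0X by (auto simp: adjoin_def)
    then have "x \<in> adjoin (polys X) L (D 0)"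
      using regular(2)[OF E2(2) X(1) E2X \<nu>X(1) x(1)] unfolding eq forms2 by simp
    then show ?thesis by (simp add: adjoin_def)
  qed
  have D_nonzero: "D a \<notin> I Y" if Y: "finite Y" "W \<times> {1..d} \<subseteq> Y" "a \<in> {0, 1}" for a Y
  proof
    interpret R: residue_domain_of "polys Y" "I Y" by (rule domI[OF Y(1,2)])
    assume "D a \<in> I Y"
    then show False using reg1[OF Y R.one_mem] R.one_not_mem by simp
  qed
  have gen_L: "ideal_gen (polys X) (I Y \<union> Ls) = L" if Y: "Y \<subseteq> X" for Y
  proof
    show "ideal_gen (polys X) (I Y \<union> Ls) \<subseteq> L"
      using IL[OF Y] by (intro ideal_gen_least[OF RX.ideal]) (auto simp: L_def intro: ideal_gen_mem)
    show "L \<subseteq> ideal_gen (polys X) (I Y \<union> Ls)"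
      unfolding L_def I_def by (intro ideal_gen_mono) (auto intro: ideal_gen_mem mpoly_ring_closed)
  qed
  have window: "1 \<le> p + 1 + a" "p + 1 + a + r \<le> d + 1" if "a \<in> {0, 1}" for a using that d by auto
  have \<nu>v: "\<nu> s \<noteq> v" if "s < r" for s using \<nu>(2) v that by auto
  note eliminate = prime_ideal_by_window_minor[OF window \<nu>v \<nu>X, where ?'k = 'k, folded D_def XA_def Ls_def]
  have zero_one: "(0::nat) \<in> {0, 1}" "(1::nat) \<in> {0, 1}" by auto
  have chart: "prime_ideal_of (polys X) L" "L \<inter> polys (XA a) = I (XA a)"
    "\<And>x. x \<in> polys X \<Longrightarrow> \<exists>m. \<exists>y\<in>polys (XA a). D a ^ m * x - y \<in> L" if a: "a \<in> {0, 1}" for a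
  proof -
    interpret R: residue_domain_of "polys (XA a)" "I (XA a)" by (rule domI[OF fin(2) WA])
    note el = eliminate[OF a a _ R.prime_ideal D_nonzero[OF fin(2) WA a] gen_L[OF sub(2)[OF a], symmetric] regX[OF a]]
    show "prime_ideal_of (polys X) L" "L \<inter> polys (XA a) = I (XA a)"
      "\<And>x. x \<in> polys X \<Longrightarrow> \<exists>m. \<exists>y\<in>polys (XA a). D a ^ m * x - y \<in> L"
      using el by blast+
  qed
  interpret L: residue_domain_of "polys X" L
    by (rule residue_domain_ofI[OF unital_subring_polys chart(1)[OF zero_one(1)]])
  have D_L: "D a \<notin> L" if a: "a \<in> {0, 1}" for a
    using regX[OF a RX.one_mem] L.one_not_mem by auto
  obtain ps where ps: "\<forall>p\<in>set ps. prime_mod (polys X0) (I X0) p \<and> dvd_mod (polys X0) (I X0) p (D 0)"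
      "dvd_mod (polys X0) (I X0) (D 0) (prod_list ps)"
    using R0.ufd_mod_dvd_primes[OF ufdI[OF fin(1) W0] DX0[OF zero_one(1)] D_nonzero[OF fin(1) W0 zero_one(1)]]
    by blast
  have primes: "prime_mod (polys X) L q" "prime_mod (polys (XA 1)) (I (XA 1)) q"
      "\<not> dvd_mod (polys (XA 1)) (I (XA 1)) q (D 1)"
    if q: "prime_mod (polys X0) (I X0) q" "dvd_mod (polys X0) (I X0) q (D 0)" for q
  proof -
    let ?A = "polys (XA 1) :: (nat \<times> nat, 'k) mpoly set" and ?I = "I (XA 1)"
    have q0: "q \<in> polys X0" using R0.prime_modD[OF q(1)] by blast
    have qA: "q \<in> ?A" and qX: "q \<in> polys X"
      using q0 polys sub[OF zero_one(2)] by blast+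
    obtain e where e: "e \<in> polys X0" "D 0 - q * e \<in> I X0" using q(2) by (auto simp: dvd_mod_def)
    have eA: "e \<in> ?A" "D 0 - q * e \<in> ?I"
      using e polys I_mono sub[OF zero_one(2)] by blast+
    have eX: "e \<in> polys X" "D 0 - q * e \<in> L"
      using eA polys IL sub[OF zero_one(2)] by blast+
    have DA: "D 0 \<in> ?A" "D 1 \<in> ?A" using D_mem sub zero_one by blast+
    have DX: "D 0 \<in> polys X" "D 1 \<in> polys X" using D_mem by (auto simp: X0_def)
    have regA: "x \<in> adjoin ?A ?I q" if "x \<in> ?A" "D 1 * x \<in> adjoin ?A ?I q" for x
      using RB.dvd_of_regular_factor[OF DA qA eA reg1[OF fin(2) WA zero_one(1)]
        reg1'[OF fin(2) WA sub(1)[OF zero_one(2)]], of x] that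
      by (simp add: adjoin_def)
    have regB: "x \<in> adjoin (polys X) L q" if "x \<in> polys X" "D 1 * x \<in> adjoin (polys X) L q" for x
      using RX.dvd_of_regular_factor[OF DX qX eX regX[OF zero_one(1)] regX', of x] that
      by (simp add: adjoin_def)
    have adj0: "adjoin (polys X0) (I X0) q = ideal_gen (polys X0) (insert q F1)"
      using q0 F1Y[OF W0] by (intro R0.adjoin_ideal_gen) (auto simp: I_def)
    have adjA: "adjoin ?A ?I q = ideal_gen ?A (insert q F1)"
      using qA F1Y[OF WA] by (intro RB.adjoin_ideal_gen) (auto simp: I_def)
    have adjX: "adjoin (polys X) L q = ideal_gen (polys X) (insert q (F1 \<union> Ls))"
      using qX F1X by (intro RX.adjoin_ideal_gen) (auto simp: L_def)
    \<comment> \<open>The coordinates of \<open>v\<close> outside the window are free variables over the old ring.\<close>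
    have primeA: "prime_ideal_of ?A (adjoin ?A ?I q)"
    proof -
      have "prime_ideal_of (polys (X0 \<union> (XA 1 - X0)))
          (ideal_gen (polys (X0 \<union> (XA 1 - X0))) (adjoin (polys X0) (I X0) q))"
        using q(1) fin(2)[of 1] by (intro prime_ideal_of_extend_variables) (auto simp: prime_mod_def)
      moreover have "X0 \<union> (XA 1 - X0) = XA 1" using sub(1)[OF zero_one(2)] by blast
      moreover have "ideal_gen ?A (ideal_gen (polys X0) (insert q F1)) = ideal_gen ?A (insert q F1)"
        using polys sub(1)[OF zero_one(2)] qA F1Y[OF WA]
        by (intro ideal_gen_ideal_gen unital_subring_polys) auto
      ultimately show ?thesis by (simp only: adj0 adjA)
    qed
    interpret Q: residue_domain_of ?A "adjoin ?A ?I q"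
      by (rule residue_domain_ofI[OF unital_subring_polys primeA])
    have D1: "D 1 \<notin> adjoin ?A ?I q"
      using regA[OF Q.one_mem] Q.one_not_mem by auto
    have gen: "adjoin (polys X) L q = ideal_gen (polys X) (adjoin ?A ?I q \<union> Ls)"
    proof
      show "adjoin (polys X) L q \<subseteq> ideal_gen (polys X) (adjoin ?A ?I q \<union> Ls)"
        unfolding adjX adjA by (intro ideal_gen_mono) (auto intro: ideal_gen_mem mpoly_ring_closed)
      have "ideal_gen ?A (insert q F1) \<subseteq> ideal_gen (polys X) (insert q (F1 \<union> Ls))"
        using polys sub(2)[OF zero_one(2)] by (intro ideal_gen_mono) auto
      then show "ideal_gen (polys X) (adjoin ?A ?I q \<union> Ls) \<subseteq> adjoin (polys X) L q"
        using RX.ideal_adjoin[OF qX] unfolding adjX adjA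
        by (intro ideal_gen_least) (auto intro: ideal_gen_mem mpoly_ring_closed)
    qed
    have "prime_ideal_of (polys X) (adjoin (polys X) L q)"
      using eliminate(1)[OF zero_one(2) zero_one(2) _ primeA D1 gen regB] by blast
    moreover have qL: "q \<notin> L"
    proof
      assume "q \<in> L"
      then have "e * q \<in> L" using eX by (simp add: RX.ideal_mult)
      then have "D 0 \<in> L" using RX.ideal_cong[OF eX(2)] by (simp add: mult.commute)
      then show False using D_L zero_one by blast
    qed
    ultimately show "prime_mod (polys X) L q" using qX by (simp add: prime_mod_def)
    have "q \<notin> ?I" using qL IL sub(2)[OF zero_one(2)] by blast
    then show "prime_mod ?A ?I q" using qA primeA by (simp add: prime_mod_def)
    show "\<not> dvd_mod ?A ?I q (D 1)" using D1 DA by (simp add: adjoin_def)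
  qed
  have "ufd_mod (polys X) L"
  proof (rule L.nagata_criterion[OF RA.residue_domain_of_axioms polys[OF sub(2)[OF zero_one(1)]]])
    show "I (XA 0) = L \<inter> polys (XA 0)" using chart(2)[OF zero_one(1)] by simp
    show "ufd_mod (polys (XA 0)) (I (XA 0))" by (rule ufdI[OF fin(2) WA])
    show "D 0 \<in> polys (XA 0)" using D_mem sub zero_one by blast
    show "D 0 \<notin> L" using D_L zero_one by blast
    show "\<exists>m. \<exists>a\<in>polys (XA 0). D 0 ^ m * x - a \<in> L" if "x \<in> polys X" for x
      using chart(3)[OF zero_one(1) that] .
    show "prime_mod (polys X) L q" if "q \<in> set ps" for q using primes ps that by blast
    have mono0: "polys X0 \<subseteq> (polys (XA 0) :: (nat \<times> nat, 'k) mpoly set)" "I X0 \<subseteq> I (XA 0)"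
      using polys I_mono sub(1)[OF zero_one(1)] by blast+
    show "q \<in> polys (XA 0) \<and> dvd_mod (polys (XA 0)) (I (XA 0)) q (D 0)" if "q \<in> set ps" for q
      using ps(1) that dvd_mod_mono[OF mono0] mono0 R0.prime_modD(1) by blast
    show "dvd_mod (polys (XA 0)) (I (XA 0)) (D 0) (prod_list ps)"
      using dvd_mod_mono[OF mono0 ps(2)] .
    show "\<exists>N. \<forall>rs. set rs \<subseteq> set ps \<and> dvd_mod (polys X) L (prod_list rs) b \<longrightarrow> length rs \<le> N"
      if b: "b \<in> polys X" "b \<notin> L" for b
    proof (rule L.multiplicity_bounded_by_chart[OF RB.residue_domain_of_axioms polys[OF sub(2)[OF zero_one(2)]]])
      show "I (XA 1) = L \<inter> polys (XA 1)" using chart(2)[OF zero_one(2)] by simp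
      show "ufd_mod (polys (XA 1)) (I (XA 1))" by (rule ufdI[OF fin(2) WA])
      show "D 1 \<in> polys (XA 1)" using D_mem sub zero_one by blast
      show "D 1 \<notin> L" using D_L zero_one by blast
      show "\<exists>m. \<exists>a\<in>polys (XA 1). D 1 ^ m * x - a \<in> L" if "x \<in> polys X" for x
        using chart(3)[OF zero_one(2) that] .
      show "prime_mod (polys (XA 1)) (I (XA 1)) q \<and> \<not> dvd_mod (polys (XA 1)) (I (XA 1)) q (D 1)"
        if "q \<in> set ps" for q using primes ps that by blast
    qed (use b in auto)
  qed
  then show ?thesis by (simp add: L_def forms2)
qed

section \<open>Factorial quotient rings\<close>

text \<open>Only one factor of an irreducible product of primes is a nonunit, so irreducible elements are prime. This
gives uniqueness of factorizations.\<close>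

lemma (in comm_monoid_cancel) factorial_monoid_if_products_of_primes:
  assumes "\<And>a. a \<in> carrier G \<Longrightarrow> \<exists>fs. set fs \<subseteq> carrier G \<and> (\<forall>f\<in>set fs. Divisibility.prime G f) \<and> foldr (\<otimes>) fs \<one> \<sim> a"
  shows "factorial_monoid G"
proof -
  have closed: "foldr (\<otimes>) fs \<one> \<in> carrier G" if "set fs \<subseteq> carrier G" for fs
    using that by (induction fs) auto
  have prod: "Divisibility.prime G (foldr (\<otimes>) fs \<one>)"
    if "set fs \<subseteq> carrier G" "\<forall>f\<in>set fs. Divisibility.prime G f" "Divisibility.irreducible G (foldr (\<otimes>) fs \<one>)" for fs
  proof (cases fs)
    case Nil
    then show ?thesis using that(3) by (simp add: Divisibility.irreducible_def)
  next
    case (Cons f gs)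
    have f: "f \<in> carrier G" "Divisibility.prime G f" and gs: "foldr (\<otimes>) gs \<one> \<in> carrier G"
      using that Cons closed[of gs] by auto
    have "Divisibility.irreducible G (f \<otimes> foldr (\<otimes>) gs \<one>)" using that(3) Cons by simp
    then show ?thesis
    proof (rule irreducible_prodE[OF _ f(1) gs])
      assume "foldr (\<otimes>) gs \<one> \<in> Units G"
      then have "f \<sim> f \<otimes> foldr (\<otimes>) gs \<one>"
        using f(1) by (intro associated_sym[OF associatedI2']) auto
      then show ?thesis using prime_cong[OF f(2)] f(1) gs Cons by auto
    next
      assume "f \<in> Units G"
      then show ?thesis using f(2) by (simp add: Divisibility.prime_def)
    qed
  qed
  interpret primeness_condition_monoid G
  proof unfold_locales
    fix a assume a: "a \<in> carrier G" "Divisibility.irreducible G a"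
    obtain fs where fs: "set fs \<subseteq> carrier G" "\<forall>f\<in>set fs. Divisibility.prime G f" "foldr (\<otimes>) fs \<one> \<sim> a"
      using assms[OF a(1)] by blast
    have "Divisibility.irreducible G (foldr (\<otimes>) fs \<one>)"
      using irreducible_cong[OF a(2) associated_sym[OF fs(3)]] a closed[OF fs(1)] by blast
    then show "Divisibility.prime G a"
      using prime_cong[OF prod[OF fs(1,2)] fs(3)] a closed[OF fs(1)] by blast
  qed
  show ?thesis
  proof (rule factorial_monoidI)
    fix a assume "a \<in> carrier G"
    then obtain fs where "set fs \<subseteq> carrier G" "\<forall>f\<in>set fs. Divisibility.prime G f" "foldr (\<otimes>) fs \<one> \<sim> a"
      using assms by blast
    then show "\<exists>fs. set fs \<subseteq> carrier G \<and> wfactors G fs a"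
      using prime_irreducible by (intro exI[of _ fs]) (auto simp: wfactors_def)
  qed (rule wfactors_unique)
qed

lemma ideal_mpoly_ring:
  fixes I :: "('v, 'k::comm_ring_1) mpoly set"
  assumes "ideal_of (polys X) I"
  shows "Ideal.ideal I (mpoly_ring X)"
proof -
  let ?R = "mpoly_ring X :: ('v, 'k) mpoly ring"
  interpret residue_ring_of "polys X" I
    using assms unital_subring_polys by (simp add: residue_ring_of_def)
  interpret R: cring ?R by (rule cring_mpoly_ring)
  have inv: "inv\<^bsub>add_monoid ?R\<^esub> x = - x" if "x \<in> polys X" for x
    using that R.minus_equality[of "- x" x] uminus_mem[OF that] by (simp add: a_inv_def)
  show ?thesis
  proof (rule idealI)
    show "ring ?R" by (rule R.ring_axioms)
    show "subgroup I (add_monoid ?R)"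
    proof
      show "I \<subseteq> carrier (add_monoid ?R)" using ideal_sub by auto
      show "\<one>\<^bsub>add_monoid ?R\<^esub> \<in> I" by simp
      show "x \<otimes>\<^bsub>add_monoid ?R\<^esub> y \<in> I" if "x \<in> I" "y \<in> I" for x y
        using that ideal_add by simp
      show "inv\<^bsub>add_monoid ?R\<^esub> x \<in> I" if "x \<in> I" for x
        using that inv[OF ideal_sub[OF that]] ideal_mult[of "- 1" x] by simp
    qed
    show "x \<otimes>\<^bsub>?R\<^esub> a \<in> I" "a \<otimes>\<^bsub>?R\<^esub> x \<in> I" if "a \<in> I" "x \<in> carrier ?R" for a x
      using that ideal_mult[of x a] by (simp_all add: mult.commute)
  qed
qed

text \<open>The coset map translates divisibility and primality modulo \<open>I\<close> into divisibility and primality in the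
multiplicative monoid of the quotient ring.\<close>

theorem factorial_domain_quotient:
  fixes I :: "('v, 'k::comm_ring_1) mpoly set"
  assumes ufd: "ufd_mod (polys X) I"
  shows "factorial_domain (mpoly_ring X Quot I)"
proof -
  let ?R = "mpoly_ring X :: ('v, 'k) mpoly ring" and ?Q = "mpoly_ring X Quot I"
  let ?\<pi> = "\<lambda>x. I +>\<^bsub>?R\<^esub> x" and ?G = "mult_of (mpoly_ring X Quot I)"
  interpret residue_domain_of "polys X" I
    using ufd by (intro residue_domain_ofI unital_subring_polys) (simp add: ufd_mod_def)
  interpret R: cring ?R by (rule cring_mpoly_ring)
  have ideal_R: "Ideal.ideal I ?R" by (rule ideal_mpoly_ring[OF ideal])
  interpret I: Ideal.ideal I ?R by (rule ideal_R)
  have prime: "primeideal I ?R"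
  proof (rule primeidealI[OF ideal_R R.is_cring])
    show "carrier ?R \<noteq> I" using one_not_mem one_mem by blast
    show "a \<in> I \<or> b \<in> I" if "a \<in> carrier ?R" "b \<in> carrier ?R" "a \<otimes>\<^bsub>?R\<^esub> b \<in> I" for a b
      using mult_memD that by simp
  qed
  interpret Q: domain ?Q by (rule primeideal.quotient_is_domain[OF prime])
  have coset: "?\<pi> x = (\<lambda>i. i + x) ` I" for x
    by (auto simp: a_r_coset_def')
  have eq: "?\<pi> x = ?\<pi> y \<longleftrightarrow> x - y \<in> I" for x y
  proof
    assume "?\<pi> x = ?\<pi> y"
    moreover have "x \<in> ?\<pi> x" unfolding coset by (rule image_eqI[of _ _ 0]) auto
    ultimately obtain i where "i \<in> I" "x = i + y" unfolding coset by auto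
    then show "x - y \<in> I" by simp
  next
    assume xy: "x - y \<in> I"
    have "i + x \<in> (\<lambda>i. i + y) ` I" if "i \<in> I" for i
      using ideal_add[OF that xy] by (intro image_eqI[of _ _ "i + (x - y)"]) auto
    moreover have "i + y \<in> (\<lambda>i. i + x) ` I" if "i \<in> I" for i
      using ideal_sub_lin[OF that xy] by (intro image_eqI[of _ _ "i - (x - y)"]) auto
    ultimately show "?\<pi> x = ?\<pi> y" unfolding coset by blast
  qed
  have mult: "?\<pi> x \<otimes>\<^bsub>?Q\<^esub> ?\<pi> y = ?\<pi> (x * y)" if "x \<in> polys X" "y \<in> polys X" for x y
    using I.rcoset_mult_add[of x y] that by (simp add: FactRing_def)
  have one: "\<one>\<^bsub>?Q\<^esub> = ?\<pi> 1" by (simp add: FactRing_def)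
  have zero: "\<zero>\<^bsub>?Q\<^esub> = ?\<pi> 0" by (auto simp: FactRing_def coset)
  have carrier_Q: "carrier ?Q = ?\<pi> ` polys X"
    by (auto simp: FactRing_def A_RCOSETS_def')
  have G: "?\<pi> x \<in> carrier ?G \<longleftrightarrow> x \<notin> I" if "x \<in> polys X" for x
    using that eq[of x 0] by (auto simp: carrier_Q zero)
  have G_obtain: "\<exists>x\<in>polys X. x \<notin> I \<and> a = ?\<pi> x" if aG: "a \<in> carrier ?G" for a
  proof -
    obtain x where x: "x \<in> polys X" "a = ?\<pi> x" "a \<noteq> ?\<pi> 0"
      using aG unfolding carrier_mult_of carrier_Q zero by blast
    moreover from this have "x \<notin> I" using eq[of x 0] by simp
    ultimately show ?thesis by blast
  qed
  have dvd: "?\<pi> a divides\<^bsub>?G\<^esub> ?\<pi> b \<longleftrightarrow> dvd_mod (polys X) I a b"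
    if ab: "a \<in> polys X" "b \<in> polys X" "b \<notin> I" for a b
  proof
    assume "?\<pi> a divides\<^bsub>?G\<^esub> ?\<pi> b"
    then obtain c where c: "c \<in> carrier ?G" "?\<pi> b = ?\<pi> a \<otimes>\<^bsub>?Q\<^esub> c" by (auto simp: factor_def)
    obtain x where x: "x \<in> polys X" "c = ?\<pi> x" using G_obtain[OF c(1)] by blast
    then have "?\<pi> b = ?\<pi> (a * x)" using c(2) mult[OF ab(1) x(1)] by simp
    then show "dvd_mod (polys X) I a b" using eq[of b "a * x"] x(1) by (auto intro: dvdI)
  next
    assume "dvd_mod (polys X) I a b"
    then obtain c where c: "c \<in> polys X" "b - a * c \<in> I" by (auto simp: dvd_mod_def)
    have "c \<notin> I"
    proof
      assume "c \<in> I"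
      then show False using ideal_cong[OF c(2)] ideal_mult[OF ab(1)] ab(3) by blast
    qed
    then show "?\<pi> a divides\<^bsub>?G\<^esub> ?\<pi> b"
      using c ab mult[OF ab(1) c(1)] eq[of b "a * c"] G[OF c(1)] by (auto simp: factor_def)
  qed
  have prime_G: "Divisibility.prime ?G (?\<pi> p)" if p: "prime_mod (polys X) I p" for p
  proof (rule Divisibility.primeI)
    show "?\<pi> p \<notin> Units ?G"
    proof
      assume "?\<pi> p \<in> Units ?G"
      then obtain y where y: "y \<in> carrier ?G" "?\<pi> p \<otimes>\<^bsub>?Q\<^esub> y = ?\<pi> 1"
        unfolding Units_def by (auto simp: one)
      obtain x where x: "x \<in> polys X" "y = ?\<pi> x" using G_obtain[OF y(1)] by blast
      then have "?\<pi> 1 = ?\<pi> (p * x)" using y(2) mult[OF prime_modD(1)[OF p] x(1)] by simp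
      then have "1 - p * x \<in> I" using eq by blast
      then show False using prime_modD(3)[OF p] x(1) by (auto intro: dvdI)
    qed
    fix a b assume "a \<in> carrier ?G" "b \<in> carrier ?G" and div: "?\<pi> p divides\<^bsub>?G\<^esub> a \<otimes>\<^bsub>?G\<^esub> b"
    then obtain x y where xy: "x \<in> polys X" "x \<notin> I" "a = ?\<pi> x" "y \<in> polys X" "y \<notin> I" "b = ?\<pi> y"
      using G_obtain by meson
    have "x * y \<notin> I" using xy mult_memD by blast
    then have "dvd_mod (polys X) I p (x * y)"
      using div xy mult dvd[of p "x * y"] prime_modD(1)[OF p] by simp
    then show "?\<pi> p divides\<^bsub>?G\<^esub> a \<or> ?\<pi> p divides\<^bsub>?G\<^esub> b"
      using prime_modD(4)[OF p xy(1,4)] dvd prime_modD(1)[OF p] xy by auto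
  qed
  have "factorial_monoid ?G"
  proof (rule comm_monoid_cancel.factorial_monoid_if_products_of_primes)
    show "comm_monoid_cancel ?G" by (rule Q.mult_of.comm_monoid_cancel_axioms)
    fix a assume "a \<in> carrier ?G"
    then obtain x where x: "x \<in> polys X" "x \<notin> I" "a = ?\<pi> x" using G_obtain by blast
    obtain ps u where ps: "\<forall>p\<in>set ps. prime_mod (polys X) I p" "u \<in> polys X"
        "dvd_mod (polys X) I u 1" "x - u * prod_list ps \<in> I"
      using ufd x unfolding ufd_mod_def by blast
    have psX: "set ps \<subseteq> polys X" using ps prime_modD(1) by blast
    then have P: "prod_list ps \<in> polys X" by (intro prod_list_mem) auto
    have "foldr (\<otimes>\<^bsub>?G\<^esub>) (map ?\<pi> ps) \<one>\<^bsub>?G\<^esub> = ?\<pi> (prod_list ps)"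
      using psX by (induction ps) (auto simp: one mult subset_iff)
    moreover have "?\<pi> (prod_list ps) \<sim>\<^bsub>?G\<^esub> a"
    proof -
      have "x - prod_list ps * u \<in> I" using ps(4) by (simp add: mult.commute)
      then have 1: "dvd_mod (polys X) I (prod_list ps) x" using ps by (intro dvdI)
      obtain w where w: "w \<in> polys X" "1 - u * w \<in> I" using ps by (auto simp: dvd_mod_def)
      have "prod_list ps - x * w \<in> I"
        using ps w P by - (rule ideal_lin[of "x - u * prod_list ps" "1 - u * w" "- w" "prod_list ps"];
          auto simp: algebra_simps)
      then have 2: "dvd_mod (polys X) I x (prod_list ps)" using w by (intro dvdI)
      have "prod_list ps \<notin> I"
      proof
        assume "prod_list ps \<in> I"
        then show False using ideal_cong[OF ps(4)] ideal_mult[OF ps(2)] x by blast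
      qed
      then show ?thesis
        using 1 2 dvd x P by (auto simp: associated_def)
    qed
    moreover have "set (map ?\<pi> ps) \<subseteq> carrier ?G"
    proof
      fix f assume "f \<in> set (map ?\<pi> ps)"
      then obtain q where "q \<in> set ps" "f = ?\<pi> q" by auto
      then show "f \<in> carrier ?G" using G[of q] ps(1) prime_modD(1,2)[of q] by auto
    qed
    ultimately show "\<exists>fs. set fs \<subseteq> carrier ?G \<and> (\<forall>f\<in>set fs. Divisibility.prime ?G f) \<and>
        foldr (\<otimes>\<^bsub>?G\<^esub>) fs \<one>\<^bsub>?G\<^esub> \<sim>\<^bsub>?G\<^esub> a"
      using prime_G ps(1) by (intro exI[of _ "map ?\<pi> ps"]) auto
  qed
  then show ?thesis
    using Q.domain_axioms by (simp add: factorial_domain_def)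
qed

section \<open>Lovasz--Saks--Schrijver rings\<close>

text \<open>Degeneracy provides in each induced subgraph a vertex with at most \<open>k\<close> neighbours, and attaching this vertex
to the rest needs the columns \<open>p + 1, \<dots>, p + k + 1\<close> for the two minors. The set \<open>X\<close> of variables is
kept arbitrary because the charts of the next step use the old graph together with additional free
variables.\<close>

theorem ufd_mod_induced_lss:
  assumes graph: "simple_graph V E" and F: "positive_matching_decomposition E p F"
    and deg: "degenerate V E k" and d: "p + k + 1 \<le> d"
    and W: "finite W" "W \<subseteq> V" and X: "finite X" "W \<times> {1..d} \<subseteq> X"
  shows "ufd_mod (polys X :: (nat \<times> nat, 'k::field) mpoly set)
    (ideal_gen (polys X) (lss_forms d (induced_edges E W)))"
  using W X
proof (induction "card W" arbitrary: W X)
  case 0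
  then have "W = {}" by simp
  moreover have "{} \<notin> E" using graph by (auto simp: simple_graph_def)
  ultimately have "lss_forms d (induced_edges E W) = ({} :: (nat \<times> nat, 'k) mpoly set)"
    by (auto simp: lss_forms_def induced_edges_def)
  moreover have "ideal_gen (polys X) {} = ({0} :: (nat \<times> nat, 'k) mpoly set)"
  proof -
    have "x = 0" if "x \<in> ideal_gen (polys X) {}" for x :: "(nat \<times> nat, 'k) mpoly"
      using that by induction auto
    then show ?thesis by (auto intro: ideal_gen.zero)
  qed
  ultimately show ?case using ufd_mod_polys[OF 0(4)] by simp
next
  case (Suc c)
  then have "W \<noteq> {}" by auto
  then obtain v where v: "v \<in> W" "vertex_degree (induced_edges E W) v \<le> k"
    using deg Suc.prems(2) unfolding degenerate_def by blast
  define W' where "W' = W - {v}"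
  define N where "N = {j \<in> W'. {v, j} \<in> E}"
  have finN: "finite N" using Suc.prems(1) by (simp add: N_def W'_def)
  obtain \<nu> where \<nu>: "bij_betw \<nu> {0..<card N} N"
    using ex_bij_betw_nat_finite[OF finN] by blast
  have edges: "induced_edges E W = induced_edges E W' \<union> (\<lambda>s. {v, \<nu> s}) ` {..<card N}"
  proof -
    have "(\<lambda>s. {v, \<nu> s}) ` {..<card N} = (\<lambda>j. {v, j}) ` N"
      using bij_betw_imp_surj_on[OF \<nu>] by (auto simp: lessThan_atLeast0)
    moreover have "induced_edges E W = induced_edges E W' \<union> (\<lambda>j. {v, j}) ` N"
    proof (intro subset_antisym subsetI)
      fix e assume e: "e \<in> induced_edges E W"
      then have eE: "e \<in> E" "e \<subseteq> W" by (auto simp: induced_edges_def)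
      obtain i j where ij: "e = {i, j}" "i \<noteq> j"
        using graph eE by (metis simple_graph_def card_2_iff)
      show "e \<in> induced_edges E W' \<union> (\<lambda>j. {v, j}) ` N"
      proof (cases "v \<in> e")
        case True
        then obtain j' where "e = {v, j'}" "j' \<noteq> v" using ij by auto
        then show ?thesis using eE by (auto simp: N_def W'_def)
      qed (use eE in \<open>auto simp: induced_edges_def W'_def\<close>)
    qed (use v in \<open>auto simp: induced_edges_def W'_def N_def\<close>)
    ultimately show ?thesis by simp
  qed
  have "card N \<le> vertex_degree (induced_edges E W) v"
    unfolding vertex_degree_def
  proof (rule card_inj_on_le)
    show "inj_on (\<lambda>j. {v, j}) N" by (auto simp: inj_on_def doubleton_eq_iff)
    show "(\<lambda>j. {v, j}) ` N \<subseteq> {e \<in> induced_edges E W. v \<in> e}"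
      using v by (auto simp: N_def W'_def induced_edges_def)
    show "finite {e \<in> induced_edges E W. v \<in> e}"
      using simple_graph_finite_edges[OF graph] by (simp add: induced_edges_def)
  qed
  then have r: "p + card N + 1 \<le> d" using v d by simp
  show ?case
  proof (rule ufd_mod_attach_vertex[OF graph F _ _ _ _ edges _ r, where W = W'])
    show "inj_on \<nu> {..<card N}"
      using bij_betw_imp_inj_on[OF \<nu>] by (simp add: lessThan_atLeast0)
    show "\<nu> ` {..<card N} \<subseteq> W'"
      using bij_betw_imp_surj_on[OF \<nu>] by (auto simp: lessThan_atLeast0 N_def)
    show "v \<notin> W'" by (simp add: W'_def)
    show "e \<subseteq> W'" if "e \<in> induced_edges E W'" for e using that by (simp add: induced_edges_def)
    show "induced_edges E W \<subseteq> E" by (auto simp: induced_edges_def)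
    show "ufd_mod (polys Y :: (nat \<times> nat, 'k) mpoly set) (ideal_gen (polys Y) (lss_forms d (induced_edges E W')))"
      if "finite Y" "W' \<times> {1..d} \<subseteq> Y" for Y
      using Suc.hyps(2) Suc.prems v that by (intro Suc.hyps(1)) (auto simp: W'_def)
    show "finite X" by fact
    show "insert v W' \<times> {1..d} \<subseteq> X" using Suc.prems(4) v by (auto simp: W'_def)
  qed
qed

lemma lss_ideal_eq_ideal_gen:
  assumes "simple_graph {1..n} E"
  shows "(lss_ideal n E d :: (nat \<times> nat, 'k::comm_ring_1) mpoly set) =
    ideal_gen (polys ({1..n} \<times> {1..d})) (lss_forms d E)"
proof -
  let ?R = "mpoly_ring ({1..n} \<times> {1..d}) :: (nat \<times> nat, 'k) mpoly ring"
  interpret R: cring ?R by (rule cring_mpoly_ring)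
  have lss: "lss_ideal n E d = Idl\<^bsub>?R\<^esub> (lss_forms d E)"
    by (simp add: lss_ideal_def lss_forms_def lss_ambient_def)
  have sub: "lss_forms d E \<subseteq> carrier ?R"
    using assms by (intro lss_forms_subset_polys) (auto simp: simple_graph_def)
  interpret P: residue_ring_of "polys ({1..n} \<times> {1..d})" "ideal_gen (carrier ?R) (lss_forms d E)"
    using ideal_of_ideal_gen[OF unital_subring_polys sub] unital_subring_polys
    by (simp add: residue_ring_of_def)
  have idl: "Ideal.ideal (Idl\<^bsub>?R\<^esub> (lss_forms d E)) ?R" by (rule R.genideal_ideal[OF sub])
  interpret I: Ideal.ideal "Idl\<^bsub>?R\<^esub> (lss_forms d E)" ?R by (rule idl)
  show ?thesis
    unfolding lss
  proof
    show "ideal_gen (carrier ?R) (lss_forms d E) \<subseteq> Idl\<^bsub>?R\<^esub> (lss_forms d E)"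
    proof (rule ideal_gen_least)
      show "ideal_of (carrier ?R) (Idl\<^bsub>?R\<^esub> (lss_forms d E))"
        using I.a_subset I.zero_closed I.a_closed I.I_l_closed by (auto simp: ideal_of_def)
    qed (rule R.genideal_self[OF sub])
    have "Ideal.ideal (ideal_gen (carrier ?R) (lss_forms d E)) ?R"
      by (rule ideal_mpoly_ring[OF P.ideal])
    then show "Idl\<^bsub>?R\<^esub> (lss_forms d E) \<subseteq> ideal_gen (carrier ?R) (lss_forms d E)"
      by (rule R.genideal_minimal) (auto intro: ideal_gen_mem mpoly_ring_closed)
  qed
qed

theorem theorem2:
  fixes n d :: nat and E :: "nat set set"
  assumes "simple_graph {1..n} E"
    and "d > 0"
    and "d \<ge> pmd E + degeneracy {1..n} E + 1"
  shows "factorial_domain (lss_ring n E d :: (nat \<times> nat, 'k::field) mpoly set ring)"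
proof -
  obtain F where F: "positive_matching_decomposition E (pmd E) F"
    using pmd_attained[OF assms(1)] by blast
  have "induced_edges E {1..n} = E"
    using assms(1) by (auto simp: induced_edges_def simple_graph_def)
  then have "ufd_mod (polys ({1..n} \<times> {1..d}) :: (nat \<times> nat, 'k) mpoly set) (lss_ideal n E d)"
    using ufd_mod_induced_lss[OF assms(1) F degenerate_degeneracy[OF assms(1)] assms(3),
      of "{1..n}" "{1..n} \<times> {1..d}"]
    by (simp add: lss_ideal_eq_ideal_gen[OF assms(1)])
  then show ?thesis
    unfolding lss_ring_def lss_ambient_def by (rule factorial_domain_quotient)
qed

end
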